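(* Let $\mathcal{X}$ be a complete separable metric space, $\nu$ a diffuse, boundedly finite measure on $\mathcal{X}$, and $\mathcal{P}(dN|\nu)$ the law of a Poisson random measure $N$ on $\mathcal{X}$ with mean measure $\nu$. Let $n\ge 1$ and let $g$ be a measurable function on $\mathcal{X}^n\times\mathcal{M}$ that is non-negative, or integrable with respect to $\prod_{i=1}^n N(dx_i)\,\mathcal{P}(dN|\nu)$. Then $$\int_{\mathcal{M}\times\mathcal{X}^n} g(\mathbf{x},N)\prod_{i=1}^n N(dx_i)\,\mathcal{P}(dN|\nu)=\sum_{\mathbf{p}}\int_{\mathcal{X}^{n(\mathbf{p})}}\left[\int_{\mathcal{M}} g\Big(\mathbf{X}^*,\mathbf{p},N+\sum_{j=1}^{n(\mathbf{p})}\delta_{X_j^*}\Big)\mathcal{P}(dN|\nu)\right]\prod_{j=1}^{n(\mathbf{p})}\nu(dX_j^* ).$$ Equivalently, the conditional law $\mathcal{P}(dN|\nu,\mathbf{X})$ of $N$ given $\mathbf{X}=(\mathbf{X}^*,\mathbf{p})$ is the law of $N+\sum_{j=1}^{n(\mathbf{p})}\delta_{X_j^*}$ with $N\sim\mathcal{P}(dN|\nu)$, that is, $$\int_{\mathcal{M}} g\Big(\mathbf{X}^*,\mathbf{p},N+\sum_{j=1}^{n(\mathbf{p})}\delta_{X_j^*}\Big)\mathcal{P}(dN|\nu)=\int_{\mathcal{M}} g(\mathbf{X}^*,\mathbf{p},N)\,\mathcal{P}(dN|\nu,\mathbf{X}).$$ Moreover the joint moment measure $M(dX_1,\dots,dX_n)=\int_{\mathcal{M}}\prod_{i=1}^n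 N(dX_i)\,\mathcal{P}(dN|\nu)$ can be written as $$M(d\mathbf{X})=\nu(dX_1)\prod_{i=2}^n\left[\nu(dX_i)+\sum_{j=1}^{n(\mathbf{p}_{i-1})}\delta_{X_j^*}(dX_i)\right],$$ where in the $i$-th factor $X_1^*,\dots,X^*_{n(\mathbf{p}_{i-1})}$ are the distinct values among $X_1,\dots,X_{i-1}$.
   Context: $\mathcal{M}$ is the space of boundedly finite measures on $\mathcal{X}$. The sum $\sum_{\mathbf{p}}$ is over all partitions $\mathbf{p}=\{C_1,\dots,C_{n(\mathbf{p})}\}$ of $\{1,\dots,n\}$. A point $\mathbf{X}=(X_1,\dots,X_n)$ is encoded as $(\mathbf{X}^*,\mathbf{p})$, where $\mathbf{X}^*=(X_1^*,\dots,X_{n(\mathbf{p})}^* )$ are its distinct values and $X_i=X_j^*$ if and only if $i\in C_j$; $g(\mathbf{X}^*,\mathbf{p},\cdot)$ means $g(\mathbf{X},\cdot)$ for this $\mathbf{X}$. $\mathbf{p}_{r}$ denotes the partition of $\{1,\dots,r\}$ induced by the ties among $X_1,\dots,X_r$, and $n(\mathbf{p}_r)$ its number of cells. *)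

theory Defs
  imports "HOL-Probability.Probability"
begin

definition boundedly_finite :: "'a::metric_space measure \<Rightarrow> bool" where
  "boundedly_finite \<mu> \<longleftrightarrow>
     sets \<mu> = sets borel \<and> (\<forall>A\<in>sets borel. bounded A \<longrightarrow> emeasure \<mu> A < \<infinity>)"

text \<open>The space of boundedly finite measures, with the \<open>\<sigma>\<close>-algebra generated by the
  evaluations \<open>\<mu> \<mapsto> \<mu>(A)\<close> at Borel sets (for a complete separable metric space this
  is also the Borel \<open>\<sigma>\<close>-algebra of the usual weak-hash topology).\<close>

definition bf_measures :: "'a::metric_space measure measure" where
  "bf_measures =
     (SUP A \<in> sets borel. vimage_algebra {\<mu>. boundedly_finite \<mu>} (\<lambda>\<mu>. emeasure \<mu> A) borel)"

definition diffuse :: "'a measure \<Rightarrow> bool" where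
  "diffuse \<mu> \<longleftrightarrow> (\<forall>x\<in>space \<mu>. emeasure \<mu> {x} = 0)"

text \<open>The Poisson probabilities are written out, since \<^const>\<open>poisson_pmf\<close> is only
  specified for a strictly positive rate.\<close>

definition poisson_law :: "'a::metric_space measure \<Rightarrow> 'a measure measure \<Rightarrow> bool" where
  "poisson_law \<nu> P \<longleftrightarrow>
     prob_space P \<and> sets P = sets bf_measures \<and>
     (\<forall>A\<in>sets borel. bounded A \<longrightarrow>
        (\<forall>k::nat. measure P {N\<in>space P. emeasure N A = of_nat k} =
                  measure \<nu> A ^ k / fact k * exp (- measure \<nu> A))) \<and>
     (\<forall>(A::nat \<Rightarrow> 'a set) m.
        (\<forall>i<m. A i \<in> sets borel \<and> bounded (A i)) \<and> disjoint_family_on A {..<m} \<longrightarrow>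
        prob_space.indep_vars P (\<lambda>_. borel) (\<lambda>i N. emeasure N (A i)) {..<m})"

text \<open>The measure \<open>\<mu> + \<Sum>\<^sub>j\<^sub>\<in>\<^sub>J \<delta>\<^bsub>x(j)\<^esub>\<close>.\<close>

definition add_atoms :: "'a::metric_space measure \<Rightarrow> 'i set \<Rightarrow> ('i \<Rightarrow> 'a) \<Rightarrow> 'a measure" where
  "add_atoms \<mu> J x =
     measure_of UNIV (sets borel) (\<lambda>A. emeasure \<mu> A + (\<Sum>j\<in>J. emeasure (return borel (x j)) A))"

text \<open>Points \<open>(X\<^sub>1, \<dots>, X\<^sub>n)\<close> are extensional functions on \<open>{1..n}\<close>.\<close>

abbreviation points :: "nat \<Rightarrow> (nat \<Rightarrow> 'a::metric_space) measure" where
  "points n \<equiv> PiM {1..n} (\<lambda>_. borel)"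

text \<open>The measure \<open>\<Prod>\<^sub>i N(dx\<^sub>i) P(dN)\<close> on pairs \<open>(x, N)\<close>, and its marginal
  \<open>M(dx) = \<integral> \<Prod>\<^sub>i N(dx\<^sub>i) P(dN)\<close>. The first factor depends on \<open>N\<close> and is not finite,
  so neither a product measure nor the monadic bind of the library applies.\<close>

definition joint_measure ::
  "nat \<Rightarrow> 'a::metric_space measure measure \<Rightarrow> ((nat \<Rightarrow> 'a) \<times> 'a measure) measure" where
  "joint_measure n P =
     measure_of (space (points n \<Otimes>\<^sub>M bf_measures)) (sets (points n \<Otimes>\<^sub>M bf_measures))
       (\<lambda>B. \<integral>\<^sup>+ N. emeasure (PiM {1..n} (\<lambda>_. N)) {x. (x, N) \<in> B} \<partial>P)"

definition moment_measure ::
  "nat \<Rightarrow> 'a::metric_space measure measure \<Rightarrow> (nat \<Rightarrow> 'a) measure" where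
  "moment_measure n P =
     measure_of (space (points n)) (sets (points n))
       (\<lambda>B. \<integral>\<^sup>+ N. emeasure (PiM {1..n} (\<lambda>_. N)) B \<partial>P)"

text \<open>A numbering \<open>C\<^sub>1, \<dots>, C\<^bsub>n(p)\<^esub>\<close> of the cells of a partition \<open>p\<close>, where \<open>n(p) = card p\<close>.\<close>

definition numbering :: "nat set set \<Rightarrow> (nat \<Rightarrow> nat set) \<Rightarrow> bool" where
  "numbering p C \<longleftrightarrow> bij_betw C {1..card p} p"

text \<open>The point \<open>X\<close> with \<open>X\<^sub>i = X\<^sub>j\<^sup>*\<close> for \<open>i \<in> C\<^sub>j\<close>.\<close>

definition point_of ::
  "nat \<Rightarrow> nat set set \<Rightarrow> (nat \<Rightarrow> nat set) \<Rightarrow> (nat \<Rightarrow> 'a) \<Rightarrow> (nat \<Rightarrow> 'a)" where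
  "point_of n p C Xs = (\<lambda>i\<in>{1..n}. Xs (THE j. j \<in> {1..card p} \<and> i \<in> C j))"

definition encodes ::
  "nat \<Rightarrow> (nat \<Rightarrow> 'a) \<Rightarrow> nat set set \<Rightarrow> (nat \<Rightarrow> nat set) \<Rightarrow> (nat \<Rightarrow> 'a) \<Rightarrow> bool" where
  "encodes n X p C Xs \<longleftrightarrow>
     partition_on {1..n} p \<and> inj_on Xs {1..card p} \<and>
     (\<forall>i\<in>{1..n}. \<forall>j\<in>{1..card p}. X i = Xs j \<longleftrightarrow> i \<in> C j)"

text \<open>\<open>K\<close> is a version of the conditional law of \<open>N\<close> given \<open>X\<close> under the joint measure:
  a probability kernel that disintegrates it over its marginal,
  \<open>\<Prod>\<^sub>i N(dX\<^sub>i) P(dN) = K(X, dN) M(dX)\<close>.\<close>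

definition conditional_law ::
  "nat \<Rightarrow> 'a::metric_space measure measure \<Rightarrow> ((nat \<Rightarrow> 'a) \<Rightarrow> 'a measure measure) \<Rightarrow> bool" where
  "conditional_law n P K \<longleftrightarrow>
     K \<in> points n \<rightarrow>\<^sub>M prob_algebra bf_measures \<and>
     (\<forall>B\<in>sets (points n \<Otimes>\<^sub>M bf_measures).
        emeasure (joint_measure n P) B =
        (\<integral>\<^sup>+ X. emeasure (K X) {N. (X, N) \<in> B} \<partial>moment_measure n P))"

text \<open>The measure
  \<open>\<nu>(dX\<^sub>1) \<Prod>\<^sub>i\<^sub>=\<^sub>2\<^sup>n [\<nu>(dX\<^sub>i) + \<Sum>\<^sub>j \<delta>\<^bsub>X*(j)\<^esub>(dX\<^sub>i)]\<close>, whose \<open>i\<close>-th factor is a kernel in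
  \<open>X\<^sub>1, \<dots>, X\<^bsub>i-1\<^esub>\<close> with atoms at their distinct values, i.e. at the elements of the set
  \<open>X ` {1..i-1}\<close>. The recursion starts from the unit mass on the one-point space, so
  the first factor, which has no atoms, is just \<open>\<nu>(dX\<^sub>1)\<close>.\<close>

primrec sequential_measure ::
  "'a::metric_space measure \<Rightarrow> nat \<Rightarrow> (nat \<Rightarrow> 'a) measure" where
  "sequential_measure \<nu> 0 = return (points 0) (\<lambda>_. undefined)"
| "sequential_measure \<nu> (Suc i) =
     measure_of (space (points (Suc i))) (sets (points (Suc i)))
       (\<lambda>B. \<integral>\<^sup>+ X. emeasure (add_atoms \<nu> (X ` {1..i}) (\<lambda>x. x)) {y. X(Suc i := y) \<in> B}
               \<partial>sequential_measure \<nu> i)"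

end

theory Submission
  imports Defs
begin

text \<open>For a Poisson measure, \<open>E[Y f(Y)] = \<lambda> E[f(Y + 1)]\<close> for a single count \<open>Y\<close> of mean \<open>\<lambda>\<close>;
  by independence this extends to functions of the counts in finitely many disjoint bounded sets.
  Dissecting the sets of a cylinder event into such atoms, and using that two measures which agree on
  products of bounded sets with cylinders are equal, one gets Mecke's formula
  \<open>E \<integral> g(x, N) N(dx) = \<integral> E g(x, N + \<delta>\<^sub>x) \<nu>(dx)\<close>.

  Applying it to one further coordinate at a time, the integral against
  \<open>(N + \<Sum>\<^sub>j \<delta>\<^bsub>X*(j)\<^esub>)(dy)\<close> splits into a new point drawn from \<open>\<nu>\<close>, almost surely distinct from
  the previous ones as \<open>\<nu>\<close> is diffuse, and a repetition of one of the previous points. This is the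
  sequential form of the moment measure. Expanding the product of these alternatives, a new value
  opens a cell and a repetition enlarges one, so that the terms are indexed by the partitions.
  Conditional laws are unique because the \<open>\<sigma>\<close>-algebra on the space of boundedly finite measures
  is countably generated and the moment measure is \<open>\<sigma>\<close>-finite.\<close>

section \<open>Boundedly finite measures and mixtures\<close>

text \<open>Neither \<nu> nor a realisation N is finite, and the kernel sending N to
  \<open>PiM {1..n} (\<lambda>_. N)\<close> inherits this. Measurability and equality of measures
  are therefore settled on bounded sets, where complements can be subtracted, and carried to the
  whole space along balls of integer radius about a base point. Ties are never looked for among the
  atoms of N. The augmented measure is written with the set of values of X as index set, so that a
  repeated value is counted once: repeating an earlier point leaves the added atoms unchanged, while
  a new point adds one. This form needs no partition and depends measurably on X, so it also serves
  as the explicit conditional law. The form with atoms at \<open>Xs 1\<close>, ...,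
  \<open>Xs (card p)\<close> agrees with it where these values are distinct, which is almost
  everywhere for a product of copies of \<nu>. Partitions enter only once the sequential measure is
  available. Signed functions come last: the identity for all non-negative functions bounds each of
  its finitely many terms, after which positive and negative parts can be subtracted.\<close>

lemma space_bf_measures: "space bf_measures = {\<mu>. boundedly_finite \<mu>}"
  unfolding bf_measures_def by (subst space_Sup_eq_UN) auto

text \<open>The \<sigma>-algebra is the initial one for the evaluations at Borel sets, and this is
  its universal property. All later proofs use it in place of the supremum in the
  definition.\<close>

lemma measurable_bf_measures_iff:
  "f \<in> M \<rightarrow>\<^sub>M bf_measures \<longleftrightarrow>
    (\<forall>x\<in>space M. boundedly_finite (f x)) \<and>
    (\<forall>A\<in>sets borel. (\<lambda>x. emeasure (f x) A) \<in> borel_measurable M)"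
proof safe
  assume f: "f \<in> M \<rightarrow>\<^sub>M bf_measures"
  show "boundedly_finite (f x)" if "x \<in> space M" for x
    using measurable_space[OF f that] by (simp add: space_bf_measures)
  fix A :: "'b set" assume A: "A \<in> sets borel"
  have "(\<lambda>\<mu>. emeasure \<mu> A) \<in> borel_measurable bf_measures"
    unfolding bf_measures_def using A
    by (intro measurable_Sup1[OF imageI]) (auto intro!: measurable_vimage_algebra1)
  from measurable_compose[OF f this] show "(\<lambda>x. emeasure (f x) A) \<in> borel_measurable M" .
next
  assume "\<forall>x\<in>space M. boundedly_finite (f x)"
    and "\<forall>A\<in>sets borel. (\<lambda>x. emeasure (f x) A) \<in> borel_measurable M"
  then show "f \<in> M \<rightarrow>\<^sub>M bf_measures"
    unfolding bf_measures_def
    by (intro measurable_Sup2) (auto intro!: measurable_vimage_algebra2)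
qed

lemma measurable_bf_measuresI:
  assumes "\<And>x. x \<in> space M \<Longrightarrow> boundedly_finite (f x)"
    and "\<And>A. A \<in> sets borel \<Longrightarrow> (\<lambda>x. emeasure (f x) A) \<in> borel_measurable M"
  shows "f \<in> M \<rightarrow>\<^sub>M bf_measures"
  using assms by (simp add: measurable_bf_measures_iff)

lemma measurable_emeasure_bf_measures:
  "f \<in> M \<rightarrow>\<^sub>M bf_measures \<Longrightarrow> A \<in> sets borel \<Longrightarrow> (\<lambda>x. emeasure (f x) A) \<in> borel_measurable M"
  by (simp add: measurable_bf_measures_iff)

lemma boundedly_finite_sets [measurable_cong]: "boundedly_finite \<mu> \<Longrightarrow> sets \<mu> = sets borel"
  by (simp add: boundedly_finite_def)

lemma boundedly_finite_less_top:
  "boundedly_finite \<mu> \<Longrightarrow> A \<in> sets borel \<Longrightarrow> bounded A \<Longrightarrow> emeasure \<mu> A < \<top>"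
  by (auto simp: boundedly_finite_def)

lemma boundedly_finite_space: "boundedly_finite \<mu> \<Longrightarrow> space \<mu> = UNIV"
  by (metis boundedly_finite_sets sets_eq_imp_space_eq space_borel)

lemma ball_of_nat_cover: "(\<Union>k::nat. ball (x::'a::metric_space) (real k)) = UNIV"
proof -
  have "\<exists>k::nat. dist x y < k" for y
    using reals_Archimedean2 by blast
  then show ?thesis by auto
qed

lemma boundedly_finite_sigma_finite:
  fixes \<mu> :: "'a::metric_space measure"
  assumes "boundedly_finite \<mu>"
  shows "sigma_finite_measure \<mu>"
proof
  \<comment> \<open>An arbitrary base point for the exhausting balls.\<close>
  obtain x :: 'a where True by simp
  show "\<exists>A. countable A \<and> A \<subseteq> sets \<mu> \<and> \<Union> A = space \<mu> \<and> (\<forall>a\<in>A. emeasure \<mu> a \<noteq> \<infinity>)"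
    using assms ball_of_nat_cover[of x]
    by (intro exI[of _ "range (\<lambda>k::nat. ball x (real k))"])
      (auto simp: boundedly_finite_space boundedly_finite_def top.not_eq_extremum)
qed

lemma boundedly_finite_product_sigma_finite:
  "boundedly_finite \<mu> \<Longrightarrow> product_sigma_finite (\<lambda>_. \<mu>)"
  by (simp add: product_sigma_finite_def boundedly_finite_sigma_finite)

lemma sets_PiM_boundedly_finite:
  "boundedly_finite \<mu> \<Longrightarrow> sets (PiM I (\<lambda>_. \<mu>)) = sets (PiM I (\<lambda>_. borel))"
  by (intro sets_PiM_cong) (auto simp: boundedly_finite_sets)

section \<open>Adding finitely many atoms to a measure\<close>

lemma
  fixes \<mu> :: "'a::metric_space measure"
  assumes "sets \<mu> = sets borel" and fin: "finite J"
  shows sets_add_atoms: "sets (add_atoms \<mu> J x) = sets borel"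
    and emeasure_add_atoms: "A \<in> sets borel \<Longrightarrow>
      emeasure (add_atoms \<mu> J x) A = emeasure \<mu> A + (\<Sum>j\<in>J. indicator A (x j))"
    and nn_integral_add_atoms: "f \<in> borel_measurable borel \<Longrightarrow>
      (\<integral>\<^sup>+ y. f y \<partial>add_atoms \<mu> J x) = (\<integral>\<^sup>+ y. f y \<partial>\<mu>) + (\<Sum>j\<in>J. f (x j))"
proof -
  show sets: "sets (add_atoms \<mu> J x) = sets borel"
    using sets.sigma_sets_eq[of "borel :: 'a measure"] by (simp add: add_atoms_def)
  show em: "emeasure (add_atoms \<mu> J x) A = emeasure \<mu> A + (\<Sum>j\<in>J. indicator A (x j))"
    if "A \<in> sets borel" for A
  proof -
    have "emeasure (add_atoms \<mu> J x) A = emeasure \<mu> A + (\<Sum>j\<in>J. emeasure (return borel (x j)) A)"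
    proof (rule emeasure_measure_of[OF add_atoms_def])
      show "countably_additive (sets (add_atoms \<mu> J x))
        (\<lambda>A. emeasure \<mu> A + (\<Sum>j\<in>J. emeasure (return borel (x j)) A))"
      proof (rule countably_additiveI)
        fix A :: "nat \<Rightarrow> 'a set"
        assume A: "range A \<subseteq> sets (add_atoms \<mu> J x)" "disjoint_family A" "(\<Union>i. A i) \<in> sets (add_atoms \<mu> J x)"
        have "(\<Sum>i. emeasure \<mu> (A i) + (\<Sum>j\<in>J. emeasure (return borel (x j)) (A i))) =
          (\<Sum>i. emeasure \<mu> (A i)) + (\<Sum>j\<in>J. \<Sum>i. emeasure (return borel (x j)) (A i))"
          by (subst suminf_add[symmetric], simp, simp, subst suminf_sum) auto
        also have "\<dots> = emeasure \<mu> (\<Union>i. A i) + (\<Sum>j\<in>J. emeasure (return borel (x j)) (\<Union>i. A i))"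
          using A assms(1)
          by (intro arg_cong2[where f="(+)"] sum.cong suminf_emeasure refl) (auto simp: sets)
        finally show "(\<Sum>i. emeasure \<mu> (A i) + (\<Sum>j\<in>J. emeasure (return borel (x j)) (A i))) =
          emeasure \<mu> (\<Union>i. A i) + (\<Sum>j\<in>J. emeasure (return borel (x j)) (\<Union>i. A i))" .
      qed
    qed (use that sets in \<open>auto simp: positive_def\<close>)
    then show ?thesis
      using that by (simp add: indicator_def)
  qed
  have space: "space (add_atoms \<mu> J x) = space \<mu>" "space \<mu> = UNIV"
    using sets_eq_imp_space_eq[OF sets] sets_eq_imp_space_eq[OF assms(1)] by auto
  note meas = measurable_cong_sets[OF sets refl] measurable_cong_sets[OF assms(1) refl]
  show "(\<integral>\<^sup>+ y. f y \<partial>add_atoms \<mu> J x) = (\<integral>\<^sup>+ y. f y \<partial>\<mu>) + (\<Sum>j\<in>J. f (x j))"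
    if "f \<in> borel_measurable borel"
    using that
  proof (induction rule: borel_measurable_induct)
    case (cong f g)
    then show ?case by (simp add: fun_eq_iff)
  next
    case (set A)
    then show ?case by (simp add: em sets assms(1))
  next
    case (mult u c)
    then show ?case by (simp add: nn_integral_cmult meas distrib_left sum_distrib_left)
  next
    case (add u v)
    then show ?case by (simp add: nn_integral_add meas sum.distrib ac_simps)
  next
    case (seq U)
    have "(\<integral>\<^sup>+ y. (SUP i. U i) y \<partial>add_atoms \<mu> J x) = (SUP i. \<integral>\<^sup>+ y. U i y \<partial>add_atoms \<mu> J x)"
      using seq by (subst SUP_apply, intro nn_integral_monotone_convergence_SUP) (auto simp: meas)
    also have "\<dots> = (SUP i. (\<integral>\<^sup>+ y. U i y \<partial>\<mu>) + (\<Sum>j\<in>J. U i (x j)))"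
      using seq by simp
    also have "\<dots> = (SUP i. \<integral>\<^sup>+ y. U i y \<partial>\<mu>) + (SUP i. \<Sum>j\<in>J. U i (x j))"
      using \<open>incseq U\<close> by (intro ennreal_SUP_add)
        (auto simp: incseq_def le_fun_def intro!: nn_integral_mono sum_mono)
    also have "(SUP i. \<integral>\<^sup>+ y. U i y \<partial>\<mu>) = (\<integral>\<^sup>+ y. (SUP i. U i) y \<partial>\<mu>)"
      using seq by (subst SUP_apply, intro nn_integral_monotone_convergence_SUP[symmetric]) (auto simp: meas)
    also have "(SUP i. \<Sum>j\<in>J. U i (x j)) = (\<Sum>j\<in>J. (SUP i. U i) (x j))"
      using \<open>incseq U\<close> unfolding SUP_apply
      by (intro ennreal_SUP_sum) (auto simp: incseq_def le_fun_def)
    finally show ?case .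
  qed
qed

lemma boundedly_finite_add_atoms:
  assumes "boundedly_finite \<mu>" "finite J"
  shows "boundedly_finite (add_atoms \<mu> J x)"
  using assms
  by (auto simp: boundedly_finite_def sets_add_atoms emeasure_add_atoms less_top sum_Pinfty
      intro!: ennreal_sum_less_top) (auto simp: indicator_def)

text \<open>\<open>add_atoms\<close> counts with multiplicity over its index set, so replacing
  indices by the set of their values preserves the measure only if no two indices share a value.
  This is the bridge between numbered atoms and a set of atoms.\<close>

lemma add_atoms_reindex:
  assumes "inj_on h I" "f = x \<circ> h"
  shows "add_atoms \<mu> (h ` I) x = add_atoms \<mu> I f"
  using assms by (simp add: add_atoms_def sum.reindex)

text \<open>The joint, the moment and the sequential measure are mixtures of this kind.\<close>

locale mixture =
  fixes P :: "'a measure" and S :: "'b measure" and \<kappa> :: "'a \<Rightarrow> 'b measure" and \<mu> :: "'b measure"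
  assumes sets_kernel: "\<And>z. z \<in> space P \<Longrightarrow> sets (\<kappa> z) = sets S"
    and measurable_kernel: "\<And>B. B \<in> sets S \<Longrightarrow> (\<lambda>z. emeasure (\<kappa> z) B) \<in> borel_measurable P"
    and mixture: "\<mu> = measure_of (space S) (sets S) (\<lambda>B. \<integral>\<^sup>+ z. emeasure (\<kappa> z) B \<partial>P)"
begin

lemma sets_mixture: "sets \<mu> = sets S"
  by (simp add: mixture)

lemma emeasure_mixture:
  assumes "B \<in> sets S"
  shows "emeasure \<mu> B = (\<integral>\<^sup>+ z. emeasure (\<kappa> z) B \<partial>P)"
proof (rule emeasure_measure_of[OF mixture])
  show "countably_additive (sets \<mu>) (\<lambda>B. \<integral>\<^sup>+ z. emeasure (\<kappa> z) B \<partial>P)"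
  proof (rule countably_additiveI)
    fix A :: "nat \<Rightarrow> 'b set"
    assume A: "range A \<subseteq> sets \<mu>" "disjoint_family A"
    then have "(\<Sum>i. \<integral>\<^sup>+ z. emeasure (\<kappa> z) (A i) \<partial>P) = (\<integral>\<^sup>+ z. (\<Sum>i. emeasure (\<kappa> z) (A i)) \<partial>P)"
      by (intro nn_integral_suminf[symmetric] measurable_kernel) (auto simp: sets_mixture)
    also have "\<dots> = (\<integral>\<^sup>+ z. emeasure (\<kappa> z) (\<Union>i. A i) \<partial>P)"
      using A by (intro nn_integral_cong suminf_emeasure) (auto simp: sets_mixture sets_kernel)
    finally show "(\<Sum>i. \<integral>\<^sup>+ z. emeasure (\<kappa> z) (A i) \<partial>P) = (\<integral>\<^sup>+ z. emeasure (\<kappa> z) (\<Union>i. A i) \<partial>P)" .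
  qed
qed (use assms sets.space_closed in \<open>auto simp: positive_def sets_mixture\<close>)

lemma
  assumes "f \<in> borel_measurable S"
  shows measurable_nn_integral_kernel: "(\<lambda>z. \<integral>\<^sup>+ y. f y \<partial>\<kappa> z) \<in> borel_measurable P" (is ?M)
    and nn_integral_mixture: "(\<integral>\<^sup>+ y. f y \<partial>\<mu>) = (\<integral>\<^sup>+ z. \<integral>\<^sup>+ y. f y \<partial>\<kappa> z \<partial>P)" (is ?I)
proof -
  have meas: "u \<in> borel_measurable \<mu>" "z \<in> space P \<Longrightarrow> u \<in> borel_measurable (\<kappa> z)"
    if "u \<in> borel_measurable S" for u :: "'b \<Rightarrow> ennreal" and z
    using that by (simp_all add: measurable_cong_sets[OF sets_mixture refl] measurable_cong_sets[OF sets_kernel refl])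
  have space: "space \<mu> = space S" "\<And>z. z \<in> space P \<Longrightarrow> space (\<kappa> z) = space S"
    using sets_mixture sets_kernel by (auto dest: sets_eq_imp_space_eq)
  \<comment> \<open>Both claims go through one induction: in the limit step the supremum passes
    under the integral against P only because the inner integrals of the approximants are already
    known to be measurable.\<close>
  have "?M \<and> ?I"
    using assms
  proof (induction rule: borel_measurable_induct)
    case (cong f g)
    have "(\<integral>\<^sup>+ y. f y \<partial>\<mu>) = (\<integral>\<^sup>+ y. g y \<partial>\<mu>)"
      using cong(3) by (intro nn_integral_cong) (simp add: space)
    moreover have "(\<integral>\<^sup>+ y. f y \<partial>\<kappa> z) = (\<integral>\<^sup>+ y. g y \<partial>\<kappa> z)" if "z \<in> space P" for z
      using cong(3) that by (intro nn_integral_cong) (simp add: space)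
    ultimately show ?case
      using cong(4) by (simp cong: nn_integral_cong measurable_cong)
  next
    case (set A)
    have "(\<integral>\<^sup>+ y. indicator A y \<partial>\<kappa> z) = emeasure (\<kappa> z) A" if "z \<in> space P" for z
      using set that by (intro nn_integral_indicator) (simp add: sets_kernel)
    then show ?case
      using set by (simp add: emeasure_mixture measurable_kernel sets_mixture
          cong: nn_integral_cong measurable_cong)
  next
    case (mult u c)
    then show ?case
      by (simp add: nn_integral_cmult meas borel_measurable_times_ennreal
          cong: nn_integral_cong measurable_cong)
  next
    case (add u v)
    then show ?case
      by (simp add: nn_integral_add meas borel_measurable_add
          cong: nn_integral_cong measurable_cong)
  next
    case (seq U)
    have 1: "(\<integral>\<^sup>+ y. (SUP i. U i) y \<partial>\<kappa> z) = (SUP i. \<integral>\<^sup>+ y. U i y \<partial>\<kappa> z)" if "z \<in> space P" for z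
      using seq that by (subst SUP_apply, intro nn_integral_monotone_convergence_SUP) (auto intro: meas)
    have 2: "(\<integral>\<^sup>+ y. (SUP i. U i) y \<partial>\<mu>) = (SUP i. \<integral>\<^sup>+ y. U i y \<partial>\<mu>)"
      using seq by (subst SUP_apply, intro nn_integral_monotone_convergence_SUP) (auto intro: meas)
    have 3: "(SUP i. \<integral>\<^sup>+ z. \<integral>\<^sup>+ y. U i y \<partial>\<kappa> z \<partial>P) = (\<integral>\<^sup>+ z. (SUP i. \<integral>\<^sup>+ y. U i y \<partial>\<kappa> z) \<partial>P)"
      using seq by (intro nn_integral_monotone_convergence_SUP[symmetric])
        (auto simp: incseq_def le_fun_def intro!: nn_integral_mono)
    have 4: "(\<lambda>z. SUP i. \<integral>\<^sup>+ y. U i y \<partial>\<kappa> z) \<in> borel_measurable P"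
      using seq by (intro borel_measurable_SUP) auto
    show ?case
      using seq 4 by (simp add: 1 2 3 del: SUP_apply Sup_apply cong: nn_integral_cong measurable_cong)
  qed
  then show ?M ?I by auto
qed

end

section \<open>Measurability of integrals against a varying measure\<close>

text \<open>On a rectangle the section mass is an indicator times an evaluation, which is
  measurable. A Dynkin class argument extends this to the product \<sigma>-algebra, and
  approximation by simple functions to all integrands.\<close>

lemma measurable_nn_integral_bf_measures:
  fixes \<kappa> :: "'b \<Rightarrow> 'a::metric_space measure"
  assumes \<kappa>: "\<kappa> \<in> \<Lambda> \<rightarrow>\<^sub>M bf_measures"
    and g: "(\<lambda>(z, y). g z y) \<in> borel_measurable (\<Lambda> \<Otimes>\<^sub>M borel)"
  shows "(\<lambda>z. \<integral>\<^sup>+ y. g z y \<partial>\<kappa> z) \<in> borel_measurable \<Lambda>"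
proof -
  obtain x0 :: 'a where True by simp
  have bf: "boundedly_finite (\<kappa> z)" if "z \<in> space \<Lambda>" for z
    using measurable_space[OF \<kappa> that] by (simp add: space_bf_measures)
  note sets = boundedly_finite_sets[OF bf]
  have em: "(\<lambda>z. emeasure (\<kappa> z) A) \<in> borel_measurable \<Lambda>" if "A \<in> sets borel" for A
    using measurable_emeasure_bf_measures[OF \<kappa> that] .
  have slice: "Pair z -` Q \<in> sets borel" if "Q \<in> sets (\<Lambda> \<Otimes>\<^sub>M borel)" for Q :: "('b \<times> 'a) set" and z
    using sets_Pair1[OF that] by simp
  \<comment> \<open>Inside a ball every section has finite mass, so the mass of a complement is a
    difference. The restriction is lifted afterwards by letting the radius grow.\<close>
  have ball: "(\<lambda>z. emeasure (\<kappa> z) (Pair z -` Q \<inter> ball x0 (real k))) \<in> borel_measurable \<Lambda>"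
    if Q: "Q \<in> sets (\<Lambda> \<Otimes>\<^sub>M borel)" for Q and k :: nat
  proof -
    from Q have "Q \<in> sigma_sets (space \<Lambda> \<times> space borel) {a \<times> b |a b. a \<in> sets \<Lambda> \<and> b \<in> sets (borel::'a measure)}"
      by (simp only: sets_pair_measure)
    with Int_stable_pair_measure_generator pair_measure_closed show ?thesis
    proof (induct rule: sigma_sets_induct_disjoint)
      case (basic Q)
      then obtain a b where Q: "Q = a \<times> b" "a \<in> sets \<Lambda>" "b \<in> sets (borel::'a measure)" by auto
      have "emeasure (\<kappa> z) (Pair z -` Q \<inter> ball x0 (real k)) =
          indicator a z * emeasure (\<kappa> z) (b \<inter> ball x0 (real k))" for z
        by (auto simp: Q indicator_def vimage_def)
      moreover have "(\<lambda>z. indicator a z * emeasure (\<kappa> z) (b \<inter> ball x0 (real k))) \<in> borel_measurable \<Lambda>"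
        using Q by (intro borel_measurable_times_ennreal em borel_measurable_indicator) auto
      ultimately show ?case
        by simp
    next
      case empty
      then show ?case by simp
    next
      case (compl Q)
      then have Q: "Q \<in> sets (\<Lambda> \<Otimes>\<^sub>M borel)"
        by (simp only: sets_pair_measure)
      have "emeasure (\<kappa> z) (Pair z -` (space \<Lambda> \<times> space borel - Q) \<inter> ball x0 (real k)) =
          emeasure (\<kappa> z) (ball x0 (real k)) - emeasure (\<kappa> z) (Pair z -` Q \<inter> ball x0 (real k))"
        if z: "z \<in> space \<Lambda>" for z
      proof -
        have "emeasure (\<kappa> z) (Pair z -` Q \<inter> ball x0 (real k)) \<noteq> \<infinity>"
          using boundedly_finite_less_top[OF bf[OF z], of "Pair z -` Q \<inter> ball x0 (real k)"] slice[OF Q]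
          by (simp add: less_top bounded_Int)
        then have "emeasure (\<kappa> z) (ball x0 (real k)) - emeasure (\<kappa> z) (Pair z -` Q \<inter> ball x0 (real k)) =
          emeasure (\<kappa> z) (ball x0 (real k) - (Pair z -` Q \<inter> ball x0 (real k)))"
          using slice[OF Q] by (intro emeasure_Diff[symmetric]) (auto simp: sets z)
        also have "ball x0 (real k) - (Pair z -` Q \<inter> ball x0 (real k)) =
          Pair z -` (space \<Lambda> \<times> space borel - Q) \<inter> ball x0 (real k)"
          using z by auto
        finally show ?thesis by simp
      qed
      then show ?case
        using compl em by (simp cong: measurable_cong)
    next
      case (union F)
      then have F: "F i \<in> sets (\<Lambda> \<Otimes>\<^sub>M borel)" for i
        unfolding sets_pair_measure by auto
      have "emeasure (\<kappa> z) (Pair z -` (\<Union>i. F i) \<inter> ball x0 (real k)) =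
          (\<Sum>i. emeasure (\<kappa> z) (Pair z -` F i \<inter> ball x0 (real k)))" if z: "z \<in> space \<Lambda>" for z
      proof -
        have "Pair z -` (\<Union>i. F i) \<inter> ball x0 (real k) = (\<Union>i. Pair z -` F i \<inter> ball x0 (real k))"
          by auto
        moreover have "disjoint_family (\<lambda>i. Pair z -` F i \<inter> ball x0 (real k))"
          using union(1) by (auto simp: disjoint_family_on_def)
        moreover have "range (\<lambda>i. Pair z -` F i \<inter> ball x0 (real k)) \<subseteq> sets (\<kappa> z)"
          using slice[OF F] by (auto simp: sets z)
        ultimately show ?thesis
          by (simp only: suminf_emeasure)
      qed
      then show ?case
        using union by (simp cong: measurable_cong)
    qed
  qed
  have em_Q: "(\<lambda>z. emeasure (\<kappa> z) (Pair z -` Q)) \<in> borel_measurable \<Lambda>"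
    if Q: "Q \<in> sets (\<Lambda> \<Otimes>\<^sub>M borel)" for Q
  proof -
    have "emeasure (\<kappa> z) (Pair z -` Q) = (SUP k. emeasure (\<kappa> z) (Pair z -` Q \<inter> ball x0 (real k)))"
      if z: "z \<in> space \<Lambda>" for z
    proof -
      have "(SUP k. emeasure (\<kappa> z) (Pair z -` Q \<inter> ball x0 (real k))) =
          emeasure (\<kappa> z) (\<Union>k. Pair z -` Q \<inter> ball x0 (real k))"
        using slice[OF Q] by (intro SUP_emeasure_incseq) (auto simp: sets z incseq_def)
      also have "(\<Union>k. Pair z -` Q \<inter> ball x0 (real k)) = Pair z -` Q"
        using ball_of_nat_cover[of x0] by auto
      finally show ?thesis by simp
    qed
    then show ?thesis
      using ball[OF Q] by (simp cong: measurable_cong)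
  qed
  have Pair: "Pair z \<in> \<kappa> z \<rightarrow>\<^sub>M \<Lambda> \<Otimes>\<^sub>M borel" if "z \<in> space \<Lambda>" for z
    using measurable_Pair1'[OF that, of "borel :: 'a measure"]
    by (simp add: measurable_cong_sets[OF sets[OF that] refl])
  \<comment> \<open>Each kernel is pushed forward under \<open>Pair z\<close> onto the product
    space, where an integral of a function of two variables becomes an integral of its section. The
    mixture is formed in order to read off measurability in z.\<close>
  interpret mixture \<Lambda> "\<Lambda> \<Otimes>\<^sub>M borel" "\<lambda>z. distr (\<kappa> z) (\<Lambda> \<Otimes>\<^sub>M borel) (Pair z)"
    "measure_of (space (\<Lambda> \<Otimes>\<^sub>M borel)) (sets (\<Lambda> \<Otimes>\<^sub>M borel))
      (\<lambda>B. \<integral>\<^sup>+ z. emeasure (distr (\<kappa> z) (\<Lambda> \<Otimes>\<^sub>M borel) (Pair z)) B \<partial>\<Lambda>)"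
    by standard (simp_all add: emeasure_distr Pair em_Q boundedly_finite_space[OF bf] cong: measurable_cong)
  have "(\<integral>\<^sup>+ w. (case w of (z, y) \<Rightarrow> g z y) \<partial>distr (\<kappa> z) (\<Lambda> \<Otimes>\<^sub>M borel) (Pair z)) = (\<integral>\<^sup>+ y. g z y \<partial>\<kappa> z)"
    if "z \<in> space \<Lambda>" for z
    using that g by (simp add: nn_integral_distr Pair)
  then show ?thesis
    using measurable_nn_integral_kernel[OF g] by (simp cong: measurable_cong)
qed

text \<open>One coordinate is integrated at a time. For the inner integral the remaining coordinates
  join the parameter space, on which \<kappa> is lifted so as to ignore them; this is why g varies
  in the induction.\<close>

lemma measurable_nn_integral_PiM_bf_measures:
  fixes \<kappa> :: "'b \<Rightarrow> 'a::metric_space measure"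
  assumes "finite I" and \<kappa>: "\<kappa> \<in> \<Lambda> \<rightarrow>\<^sub>M bf_measures"
    and "(\<lambda>(z, X). g z X) \<in> borel_measurable (\<Lambda> \<Otimes>\<^sub>M PiM I (\<lambda>_. borel))"
  shows "(\<lambda>z. \<integral>\<^sup>+ X. g z X \<partial>PiM I (\<lambda>_. \<kappa> z)) \<in> borel_measurable \<Lambda>"
  using assms(1,3)
proof (induction I arbitrary: g rule: finite_induct)
  case empty
  have "(\<lambda>z. g z (\<lambda>_. undefined)) \<in> borel_measurable \<Lambda>"
    using measurable_compose[OF _ empty, of "\<lambda>z. (z, \<lambda>_. undefined)" \<Lambda>]
    by (simp add: space_PiM)
  then show ?case
    by (simp add: PiM_empty nn_integral_count_space_finite)
next
  case (insert i I)
  note [measurable] = insert.prems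
  have [measurable]: "(\<lambda>z. \<kappa> (fst z)) \<in> \<Lambda> \<Otimes>\<^sub>M PiM I (\<lambda>_. borel) \<rightarrow>\<^sub>M bf_measures"
    using \<kappa> by measurable
  have "(\<lambda>w. \<integral>\<^sup>+ y. g (fst w) ((snd w)(i := y)) \<partial>\<kappa> (fst w)) \<in> borel_measurable (\<Lambda> \<Otimes>\<^sub>M PiM I (\<lambda>_. borel))"
    by (rule measurable_nn_integral_bf_measures) measurable
  then have "(\<lambda>z. \<integral>\<^sup>+ X. \<integral>\<^sup>+ y. g z (X(i := y)) \<partial>\<kappa> z \<partial>PiM I (\<lambda>_. \<kappa> z)) \<in> borel_measurable \<Lambda>"
    by (intro insert.IH) (simp only: case_prod_beta')
  moreover have "(\<integral>\<^sup>+ X. \<integral>\<^sup>+ y. g z (X(i := y)) \<partial>\<kappa> z \<partial>PiM I (\<lambda>_. \<kappa> z)) =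
      (\<integral>\<^sup>+ X. g z X \<partial>PiM (insert i I) (\<lambda>_. \<kappa> z))" if z: "z \<in> space \<Lambda>" for z
  proof -
    have bf: "boundedly_finite (\<kappa> z)"
      using measurable_space[OF \<kappa> z] by (simp add: space_bf_measures)
    have "g z \<in> borel_measurable (PiM (insert i I) (\<lambda>_. \<kappa> z))"
      using insert.prems z by (simp add: measurable_cong_sets[OF sets_PiM_boundedly_finite[OF bf] refl])
    then show ?thesis
      using boundedly_finite_product_sigma_finite[OF bf] insert.hyps
      by (intro product_sigma_finite.product_nn_integral_insert[symmetric])
  qed
  ultimately show ?case
    by (simp cong: measurable_cong)
qed

section \<open>Measurable dependence of the augmented measure on its atoms\<close>

lemma measurable_add_atoms:
  fixes \<kappa> :: "'b \<Rightarrow> 'a::metric_space measure"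
  assumes \<kappa>: "\<kappa> \<in> \<Lambda> \<rightarrow>\<^sub>M bf_measures" and J: "finite J"
    and x: "\<And>j. j \<in> J \<Longrightarrow> (\<lambda>z. x z j) \<in> \<Lambda> \<rightarrow>\<^sub>M borel"
  shows "(\<lambda>z. add_atoms (\<kappa> z) J (x z)) \<in> \<Lambda> \<rightarrow>\<^sub>M bf_measures"
proof (rule measurable_bf_measuresI)
  have bf: "boundedly_finite (\<kappa> z)" if "z \<in> space \<Lambda>" for z
    using measurable_space[OF \<kappa> that] by (simp add: space_bf_measures)
  then show "boundedly_finite (add_atoms (\<kappa> z) J (x z))" if "z \<in> space \<Lambda>" for z
    using that J by (simp add: boundedly_finite_add_atoms)
  fix A :: "'a set" assume A [measurable]: "A \<in> sets borel"
  have [measurable]: "(\<lambda>z. emeasure (\<kappa> z) A) \<in> borel_measurable \<Lambda>"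
    using measurable_emeasure_bf_measures[OF \<kappa> A] .
  have "(\<lambda>z. emeasure (\<kappa> z) A + (\<Sum>j\<in>J. indicator A (x z j))) \<in> borel_measurable \<Lambda>"
    using x by measurable
  then show "(\<lambda>z. emeasure (add_atoms (\<kappa> z) J (x z)) A) \<in> borel_measurable \<Lambda>"
    using A J by (simp add: emeasure_add_atoms boundedly_finite_sets[OF bf] cong: measurable_cong)
qed

text \<open>The set of values of X changes its size with X. Letting each value count only at its
  first index gives a sum with a fixed range, whose measurability in X can be checked term by
  term.\<close>

lemma sum_image_first_occurrence:
  fixes f :: "'a \<Rightarrow> 'b::comm_monoid_add"
  shows "(\<Sum>x\<in>X ` {1..n::nat}. f x) = (\<Sum>i=1..n. if X i \<in> X ` {1..<i} then 0 else f (X i))"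
proof (induction n)
  case (Suc n)
  have "{1..Suc n} = insert (Suc n) {1..n}" "{1..<Suc n} = {1..n}" by auto
  then show ?case
    using Suc by (auto simp: insert_absorb add.commute)
qed simp

text \<open>After the rewriting by first occurrences, only the tie events
  \<open>X z i = X z j\<close> have to be measurable. Second countability of the space enters
  here.\<close>

lemma measurable_add_atoms_image:
  fixes \<kappa> :: "'b \<Rightarrow> 'a::{metric_space,second_countable_topology} measure"
  assumes \<kappa>: "\<kappa> \<in> \<Lambda> \<rightarrow>\<^sub>M bf_measures"
    and X: "X \<in> \<Lambda> \<rightarrow>\<^sub>M points n"
  shows "(\<lambda>z. add_atoms (\<kappa> z) (X z ` {1..n}) (\<lambda>x. x)) \<in> \<Lambda> \<rightarrow>\<^sub>M bf_measures"
proof (rule measurable_bf_measuresI)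
  have bf: "boundedly_finite (\<kappa> z)" if "z \<in> space \<Lambda>" for z
    using measurable_space[OF \<kappa> that] by (simp add: space_bf_measures)
  then show "boundedly_finite (add_atoms (\<kappa> z) (X z ` {1..n}) (\<lambda>x. x))" if "z \<in> space \<Lambda>" for z
    using that by (simp add: boundedly_finite_add_atoms)
  fix A :: "'a set" assume A [measurable]: "A \<in> sets borel"
  have [measurable]: "(\<lambda>z. emeasure (\<kappa> z) A) \<in> borel_measurable \<Lambda>"
    using measurable_emeasure_bf_measures[OF \<kappa> A] .
  have Xi[measurable]: "(\<lambda>z. X z i) \<in> \<Lambda> \<rightarrow>\<^sub>M borel" if "i \<in> {1..n}" for i
    using measurable_compose[OF X measurable_component_singleton[OF that]] by simp
  have "(\<lambda>z. \<Sum>i=1..n. if (\<exists>j\<in>{1..<i}. X z i = X z j) then 0 else indicator A (X z i) :: ennreal) \<in> borel_measurable \<Lambda>"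
    by (intro borel_measurable_sum measurable_If pred_intros_finite) auto
  then have "(\<lambda>z. emeasure (\<kappa> z) A + (\<Sum>i=1..n. if X z i \<in> X z ` {1..<i} then 0 else indicator A (X z i))) \<in> borel_measurable \<Lambda>"
    by (simp add: image_iff del: One_nat_def)
  then show "(\<lambda>z. emeasure (add_atoms (\<kappa> z) (X z ` {1..n}) (\<lambda>x. x)) A) \<in> borel_measurable \<Lambda>"
    using A by (simp add: emeasure_add_atoms boundedly_finite_sets[OF bf] sum_image_first_occurrence
        del: One_nat_def cong: measurable_cong)
qed

section \<open>A countable generator of the space of boundedly finite measures\<close>

text \<open>Indexing by a set of constraints makes an intersection of cylinders the cylinder of a
  union. \<open>cylinder {}\<close> is the whole space and serves as the exhausting set whenever
  measures are compared on cylinders.\<close>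

definition cylinder :: "('a::metric_space set \<times> ennreal set) set \<Rightarrow> 'a measure set" where
  "cylinder F = {\<mu>. boundedly_finite \<mu> \<and> (\<forall>(B, S)\<in>F. emeasure \<mu> B \<in> S)}"

lemma cylinder_in_sets:
  assumes "finite F" "\<And>B S. (B, S) \<in> F \<Longrightarrow> B \<in> sets borel \<and> S \<in> sets borel"
  shows "cylinder F \<in> sets bf_measures"
proof -
  have "{\<mu>\<in>space bf_measures. emeasure \<mu> (fst p) \<in> snd p} \<in> sets bf_measures" if "p \<in> F" for p
  proof -
    have p: "fst p \<in> sets borel" "snd p \<in> sets borel"
      using assms(2)[of "fst p" "snd p"] that by auto
    have "(\<lambda>\<mu>. emeasure \<mu> (fst p)) \<in> borel_measurable bf_measures"
      using p(1) by (intro measurable_emeasure_bf_measures) simp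
    from measurable_sets[OF this p(2)] show ?thesis
      by (simp add: vimage_def Int_def conj_commute)
  qed
  then have "{\<mu>\<in>space bf_measures. \<forall>p\<in>F. emeasure \<mu> (fst p) \<in> snd p} \<in> sets bf_measures"
    using assms(1) by (intro sets.sets_Collect_finite_All) auto
  also have "{\<mu>\<in>space bf_measures. \<forall>p\<in>F. emeasure \<mu> (fst p) \<in> snd p} = cylinder F"
    by (auto simp: cylinder_def space_bf_measures)
  finally show ?thesis .
qed

lemma cylinder_Int: "cylinder F \<inter> cylinder G = cylinder (F \<union> G)"
  by (auto simp: cylinder_def)

text \<open>Countability of \<open>T\<close> is what makes conditional laws on \<^const>\<open>bf_measures\<close> unique.\<close>

lemma bf_measures_generator:
  obtains T :: "('a::{metric_space,second_countable_topology} set \<times> ennreal set) set"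
  where "countable T"
    and "\<And>B S. (B, S) \<in> T \<Longrightarrow> B \<in> sets borel \<and> bounded B \<and> S \<in> sets borel"
    and "sets bf_measures = sigma_sets (space bf_measures) {cylinder F | F. finite F \<and> F \<subseteq> T}"
proof -
  obtain x0 :: 'a where True by simp
  obtain \<U> :: "'a set set" where \<U>: "countable \<U>" "topological_basis \<U>"
    using ex_countable_basis by auto
  obtain \<V> :: "ennreal set set" where \<V>: "countable \<V>" "topological_basis \<V>"
    using ex_countable_basis by auto
  have borel_ennreal: "borel = sigma UNIV \<V>"
    using borel_eq_countable_basis[OF \<V>] .
  \<comment> \<open>Finite intersections make the countable base stable under intersection, as the
    Dynkin argument requires. The empty intersection contributes \<open>UNIV\<close>, from which
    complements are subtracted.\<close>
  define \<B> where "\<B> = {\<Inter>F | F. finite F \<and> F \<subseteq> \<U>}"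
  have \<B>_sets: "B \<in> sets borel" if B: "B \<in> \<B>" for B
  proof -
    obtain F where "finite F" "F \<subseteq> \<U>" "B = \<Inter>F"
      using B by (auto simp: \<B>_def)
    then have "open B"
      using \<U>(2) by (auto intro!: open_Inter simp: topological_basis_open)
    then show ?thesis by simp
  qed
  have borel_\<B>: "sets borel = sigma_sets UNIV \<B>"
  proof
    have "sets borel = sigma_sets UNIV \<U>"
      unfolding borel_eq_countable_basis[OF \<U>] by simp
    also have "\<dots> \<subseteq> sigma_sets UNIV \<B>"
    proof (rule sigma_sets_mono)
      show "\<U> \<subseteq> sigma_sets UNIV \<B>"
      proof
        fix U assume "U \<in> \<U>"
        then have "U \<in> \<B>"
          by (auto simp: \<B>_def intro!: exI[of _ "{U}"])
        then show "U \<in> sigma_sets UNIV \<B>" ..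
      qed
    qed
    finally show "sets borel \<subseteq> sigma_sets UNIV \<B>" .
    show "sigma_sets UNIV \<B> \<subseteq> sets borel"
      using sets.sigma_sets_subset[of \<B> borel] \<B>_sets by auto
  qed
  have Int_\<B>: "Int_stable \<B>"
  proof (rule Int_stableI)
    fix A B assume "A \<in> \<B>" "B \<in> \<B>"
    then obtain F G where "finite F" "F \<subseteq> \<U>" "A = \<Inter>F" "finite G" "G \<subseteq> \<U>" "B = \<Inter>G"
      by (auto simp: \<B>_def)
    then show "A \<inter> B \<in> \<B>"
      by (auto simp: \<B>_def intro!: exI[of _ "F \<union> G"])
  qed
  have "countable \<B>"
  proof -
    have "\<B> = Inter ` {F. F \<subseteq> \<U> \<and> finite F}"
      by (auto simp: \<B>_def)
    then show ?thesis
      using countable_Collect_finite_subset[OF \<U>(1)] by (simp add: conj_commute)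
  qed
  \<comment> \<open>The test sets are cut by balls so that all of them are bounded: Poisson counts
    are prescribed on bounded sets only, and masses stay finite.\<close>
  define T where "T = (\<lambda>(B, k::nat, S). (B \<inter> ball x0 (real k), S)) ` (\<B> \<times> UNIV \<times> \<V>)"
  have T1: "countable T"
    unfolding T_def using \<open>countable \<B>\<close> \<V>(1) by auto
  have T2: "B \<in> sets borel \<and> bounded B \<and> S \<in> sets borel" if "(B, S) \<in> T" for B S
    using that \<B>_sets topological_basis_open[OF \<V>(2)] by (auto simp: T_def)
  define G where "G = {cylinder F | F. finite F \<and> F \<subseteq> T}"
  define \<Sigma> where "\<Sigma> = sigma (space (bf_measures :: 'a measure measure)) G"
  have G: "G \<subseteq> sets bf_measures"
    using T2 by (auto simp: G_def intro!: cylinder_in_sets)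
  then have G': "G \<subseteq> Pow (space bf_measures)"
    using sets.space_closed by blast
  have \<Sigma>: "space \<Sigma> = space bf_measures" "sets \<Sigma> = sigma_sets (space bf_measures) G"
    using G' by (simp_all add: \<Sigma>_def)
  have bf: "boundedly_finite \<mu>" if "\<mu> \<in> space \<Sigma>" for \<mu>
    using that by (simp add: \<Sigma> space_bf_measures)
  have ball: "(\<lambda>\<mu>. emeasure \<mu> (A \<inter> ball x0 (real k))) \<in> borel_measurable \<Sigma>"
    if A: "A \<in> sets borel" for A and k :: nat
  proof -
    have \<B>_ball: "(\<lambda>\<mu>. emeasure \<mu> (A \<inter> ball x0 (real k))) \<in> borel_measurable \<Sigma>" if A: "A \<in> \<B>" for A
      unfolding borel_ennreal
    proof (rule measurable_measure_of)
      fix S assume S: "S \<in> \<V>"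
      have "(\<lambda>\<mu>. emeasure \<mu> (A \<inter> ball x0 (real k))) -` S \<inter> space \<Sigma> = cylinder {(A \<inter> ball x0 (real k), S)}"
        by (auto simp: cylinder_def \<Sigma> space_bf_measures)
      also have "\<dots> \<in> G"
        using A S by (auto simp: G_def T_def image_iff intro!: exI[of _ "{(A \<inter> ball x0 (real k), S)}"] bexI[of _ A])
      finally show "(\<lambda>\<mu>. emeasure \<mu> (A \<inter> ball x0 (real k))) -` S \<inter> space \<Sigma> \<in> sets \<Sigma>"
        by (auto simp: \<Sigma>)
    qed auto
    from A have "A \<in> sigma_sets UNIV \<B>"
      by (simp add: borel_\<B>)
    with Int_\<B> subset_UNIV[of \<B>, folded Pow_UNIV] show ?thesis
    proof (induction rule: sigma_sets_induct_disjoint)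
      case (basic A)
      then show ?case by (rule \<B>_ball)
    next
      case empty
      then show ?case by simp
    next
      case (compl A)
      then have A: "A \<in> sets borel"
        by (simp add: borel_\<B>)
      have "UNIV \<in> \<B>"
        by (auto simp: \<B>_def intro!: exI[of _ "{}"])
      from \<B>_ball[OF this] have "(\<lambda>\<mu>. emeasure \<mu> (ball x0 (real k))) \<in> borel_measurable \<Sigma>"
        by simp
      moreover have "emeasure \<mu> ((UNIV - A) \<inter> ball x0 (real k)) =
          emeasure \<mu> (ball x0 (real k)) - emeasure \<mu> (A \<inter> ball x0 (real k))" if \<mu>: "\<mu> \<in> space \<Sigma>" for \<mu>
      proof -
        have "(UNIV - A) \<inter> ball x0 (real k) = ball x0 (real k) - (A \<inter> ball x0 (real k))"
          by auto
        then show ?thesis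
          using A boundedly_finite_less_top[OF bf[OF \<mu>], of "A \<inter> ball x0 (real k)"]
          by (auto intro!: emeasure_Diff simp: boundedly_finite_sets[OF bf[OF \<mu>]] bounded_Int less_top)
      qed
      ultimately show ?case
        using compl by (simp cong: measurable_cong)
    next
      case (union F)
      then have F: "F i \<in> sets borel" for i
        by (auto simp: borel_\<B>)
      have "emeasure \<mu> ((\<Union>i. F i) \<inter> ball x0 (real k)) = (\<Sum>i. emeasure \<mu> (F i \<inter> ball x0 (real k)))"
        if \<mu>: "\<mu> \<in> space \<Sigma>" for \<mu>
      proof -
        have "(\<Union>i. F i) \<inter> ball x0 (real k) = (\<Union>i. F i \<inter> ball x0 (real k))"
          by auto
        moreover have "disjoint_family (\<lambda>i. F i \<inter> ball x0 (real k))"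
          using union(1) by (auto simp: disjoint_family_on_def)
        moreover have "range (\<lambda>i. F i \<inter> ball x0 (real k)) \<subseteq> sets \<mu>"
          using F by (auto simp: boundedly_finite_sets[OF bf[OF \<mu>]])
        ultimately show ?thesis
          by (simp only: suminf_emeasure)
      qed
      then show ?case
        using union by (simp cong: measurable_cong)
    qed
  qed
  \<comment> \<open>Measurability of the identity is the nontrivial inclusion: every evaluation is
    already measurable for the \<sigma>-algebra generated by the countably many cylinders.\<close>
  have "(\<lambda>\<mu>. \<mu>) \<in> \<Sigma> \<rightarrow>\<^sub>M bf_measures"
  proof (rule measurable_bf_measuresI[OF bf])
    fix A :: "'a set" assume A: "A \<in> sets borel"
    have "emeasure \<mu> A = (SUP k. emeasure \<mu> (A \<inter> ball x0 (real k)))" if \<mu>: "\<mu> \<in> space \<Sigma>" for \<mu>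
    proof -
      have "(SUP k. emeasure \<mu> (A \<inter> ball x0 (real k))) = emeasure \<mu> (\<Union>k. A \<inter> ball x0 (real k))"
        using A by (intro SUP_emeasure_incseq) (auto simp: boundedly_finite_sets[OF bf[OF \<mu>]] incseq_def)
      also have "(\<Union>k. A \<inter> ball x0 (real k)) = A"
        using ball_of_nat_cover[of x0] by auto
      finally show ?thesis by simp
    qed
    then show "(\<lambda>\<mu>. emeasure \<mu> A) \<in> borel_measurable \<Sigma>"
      using ball[OF A] by (simp cong: measurable_cong)
  qed
  from measurable_sets[OF this] have "sets bf_measures \<subseteq> sets \<Sigma>"
    using sets.sets_into_space[of _ "bf_measures :: 'a measure measure"] by (auto simp: \<Sigma>(1) Int_absorb2)
  moreover have "sets \<Sigma> \<subseteq> sets bf_measures"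
    unfolding \<Sigma> using G by (intro sets.sigma_sets_subset)
  ultimately show thesis
    using that[of T] T1 T2 unfolding \<Sigma> G_def by blast
qed

section \<open>Size biasing of Poisson counts\<close>

text \<open>The pieces are the atoms of the algebra generated by the family on its union: two points
  share a piece when \<open>\<tau>\<close>, the subfamily of members containing a point, is the same
  for both. The bijection \<open>e\<close> numbers the subfamilies; a number that no point of the
  union attains gives an empty piece.\<close>

lemma finite_dissection:
  fixes \<F> :: "'a::metric_space set set"
  assumes "finite \<F>" and \<F>: "\<And>B. B \<in> \<F> \<Longrightarrow> B \<in> sets borel \<and> bounded B"
  obtains D :: "nat \<Rightarrow> 'a set" and m :: nat
  where "\<And>i. D i \<in> sets borel \<and> bounded (D i)" "disjoint_family D"
    "\<And>B. B \<in> \<F> \<Longrightarrow> \<exists>I. I \<subseteq> {..<m} \<and> B = (\<Union>i\<in>I. D i)"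
proof -
  obtain e :: "'a set set \<Rightarrow> nat" where e: "bij_betw e (Pow \<F>) {0..<card (Pow \<F>)}"
    using ex_bij_betw_finite_nat assms(1) by blast
  define \<tau> where "\<tau> x = {B \<in> \<F>. x \<in> B}" for x
  define D where "D i = {x \<in> \<Union>\<F>. e (\<tau> x) = i}" for i
  have e_inj: "e (\<tau> x) = e \<G> \<longleftrightarrow> \<tau> x = \<G>" if "\<G> \<subseteq> \<F>" for x \<G>
    using inj_onD[OF bij_betw_imp_inj_on[OF e]] that by (auto simp: \<tau>_def)
  have e_less: "e (\<tau> x) < card (Pow \<F>)" for x
    using bij_betw_apply[OF e, of "\<tau> x"] by (auto simp: \<tau>_def)
  have D_borel: "D i \<in> sets borel" for i
  proof (cases "\<exists>\<G>. \<G> \<subseteq> \<F> \<and> e \<G> = i")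
    case True
    then obtain \<G> where \<G>: "\<G> \<subseteq> \<F>" "e \<G> = i" by blast
    have "D i = \<Union>\<F> \<inter> {x \<in> space borel. \<forall>B\<in>\<F>. x \<in> B \<longleftrightarrow> B \<in> \<G>}"
      using e_inj[OF \<G>(1)] \<G> by (auto simp: D_def \<tau>_def)
    also have "\<dots> \<in> sets borel"
    proof (rule sets.Int)
      show "\<Union>\<F> \<in> sets borel"
        using assms by (intro sets.finite_Union) auto
      show "{x \<in> space borel. \<forall>B\<in>\<F>. x \<in> B \<longleftrightarrow> B \<in> \<G>} \<in> sets borel"
      proof (intro sets.sets_Collect_finite_All assms(1))
        fix B assume "B \<in> \<F>"
        then have [measurable]: "B \<in> sets borel" using \<F> by auto
        show "{x \<in> space borel. x \<in> B \<longleftrightarrow> B \<in> \<G>} \<in> sets borel"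
          by measurable
      qed
    qed
    finally show ?thesis .
  next
    case False
    then have "D i = {}"
      by (auto simp: D_def \<tau>_def)
    then show ?thesis by simp
  qed
  show thesis
  proof (rule that)
    have "bounded (\<Union>\<F>)"
      using assms by (intro bounded_Union) auto
    then show "D i \<in> sets borel \<and> bounded (D i)" for i
      using D_borel by (auto simp: D_def elim!: bounded_subset)
    show "disjoint_family D"
      by (auto simp: disjoint_family_on_def D_def)
    show "\<exists>I. I \<subseteq> {..<card (Pow \<F>)} \<and> B = (\<Union>i\<in>I. D i)" if "B \<in> \<F>" for B
    proof (intro exI conjI)
      show "(\<lambda>x. e (\<tau> x)) ` B \<subseteq> {..<card (Pow \<F>)}"
        using e_less by auto
      have "x \<in> B" if "e (\<tau> x) = e (\<tau> y)" "y \<in> B" for x y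
      proof -
        have "\<tau> x = \<tau> y"
          using e_inj[of "\<tau> y" x] that by (auto simp: \<tau>_def)
        then show ?thesis
          using \<open>y \<in> B\<close> \<open>B \<in> \<F>\<close> by (auto simp: \<tau>_def)
      qed
      then show "B = (\<Union>i\<in>(\<lambda>x. e (\<tau> x)) ` B. D i)"
        using that by (auto simp: D_def)
    qed
  qed
qed

locale poisson_random_measure =
  fixes \<nu> :: "'a::{metric_space,second_countable_topology} measure" and P :: "'a measure measure"
  assumes bf_mean: "boundedly_finite \<nu>"
    and poisson: "poisson_law \<nu> P"
begin

sublocale prob_space P
  using poisson by (simp add: poisson_law_def)

lemma sets_P [measurable_cong]: "sets P = sets bf_measures"
  using poisson by (simp add: poisson_law_def)

lemma space_P: "space P = {\<mu>. boundedly_finite \<mu>}"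
  using sets_eq_imp_space_eq[OF sets_P] by (simp add: space_bf_measures)

lemma bf_P: "N \<in> space P \<Longrightarrow> boundedly_finite N"
  by (simp add: space_P)

lemma measurable_emeasure_P [measurable]:
  "A \<in> sets borel \<Longrightarrow> (\<lambda>N. emeasure N A) \<in> borel_measurable P"
  by (intro measurable_emeasure_bf_measures) (simp_all add: measurable_ident_sets[OF sets_P])

text \<open>The hypothesis fixes only the probability of each natural value. Since these
  probabilities sum to 1 by the exponential series, the count is almost surely a finite natural
  number, and its expectation is a series over the values.\<close>

lemma nn_integral_count:
  assumes A: "A \<in> sets borel" "bounded A" and h: "h \<in> borel_measurable borel"
  shows "(\<integral>\<^sup>+ N. h (emeasure N A) \<partial>P) =
    (\<Sum>k. h (of_nat k) * ennreal (measure \<nu> A ^ k / fact k * exp (- measure \<nu> A)))"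
proof -
  define E where "E k = {N \<in> space P. emeasure N A = of_nat k}" for k :: nat
  define p where "p k = measure \<nu> A ^ k / fact k * exp (- measure \<nu> A)" for k :: nat
  have [measurable]: "E k \<in> sets P" for k
    unfolding E_def using A by measurable
  have prob_E: "prob (E k) = p k" for k
    using poisson A by (auto simp: poisson_law_def E_def p_def)
  have p_nonneg: "0 \<le> p k" for k
    by (simp add: p_def)
  have p_sums: "p sums 1"
    using sums_mult2[OF exp_converges, of "measure \<nu> A" "exp (- measure \<nu> A)"]
    by (simp add: p_def[abs_def] exp_minus divide_inverse mult_ac)
  have disj: "disjoint_family E"
    by (auto simp: disjoint_family_on_def E_def)
  have "(\<lambda>k. prob (E k)) sums prob (\<Union>k. E k)"
    using disj by (intro finite_measure_UNION) auto
  then have "prob (\<Union>k. E k) = 1"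
    using p_sums by (simp add: prob_E sums_unique2)
  then have "AE N in P. N \<in> (\<Union>k. E k)"
    by (subst (asm) prob_eq_1) auto
  then have "AE N in P. h (emeasure N A) = (\<Sum>k. h (of_nat k) * indicator (E k) N)"
  proof eventually_elim
    case (elim N)
    then obtain k where k: "N \<in> E k" by auto
    then have "(\<Sum>k. h (of_nat k) * indicator (E k) N) = (\<Sum>k\<in>{k}. h (of_nat k) * indicator (E k) N)"
      by (intro suminf_finite) (auto simp: E_def indicator_def)
    moreover have "emeasure N A = of_nat k"
      using k by (simp add: E_def)
    ultimately show ?case
      using k by simp
  qed
  then have "(\<integral>\<^sup>+ N. h (emeasure N A) \<partial>P) = (\<integral>\<^sup>+ N. (\<Sum>k. h (of_nat k) * indicator (E k) N) \<partial>P)"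
    by (rule nn_integral_cong_AE)
  also have "\<dots> = (\<Sum>k. \<integral>\<^sup>+ N. h (of_nat k) * indicator (E k) N \<partial>P)"
    by (intro nn_integral_suminf) measurable
  also have "\<dots> = (\<Sum>k. h (of_nat k) * ennreal (p k))"
    by (simp add: nn_integral_cmult emeasure_eq_measure prob_E)
  finally show ?thesis by (simp add: p_def)
qed

text \<open>The Poisson weights of mean l satisfy \<open>(k + 1) * p (k + 1) = l * p k\<close>. The
  term for k = 0 vanishes on the left, so the series can be shifted by one. The case l = 0 is
  covered as well.\<close>

lemma nn_integral_count_size_bias:
  assumes A: "A \<in> sets borel" "bounded A" and h: "h \<in> borel_measurable borel"
  shows "(\<integral>\<^sup>+ N. emeasure N A * h (emeasure N A) \<partial>P) =
    emeasure \<nu> A * (\<integral>\<^sup>+ N. h (emeasure N A + 1) \<partial>P)"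
proof -
  define l where "l = measure \<nu> A"
  define p where "p k = l ^ k / fact k * exp (- l)" for k :: nat
  have l: "emeasure \<nu> A = ennreal l" "0 \<le> l"
    using boundedly_finite_less_top[OF bf_mean A] by (auto simp: l_def emeasure_eq_ennreal_measure)
  have p: "of_nat (Suc k) * ennreal (p (Suc k)) = ennreal l * ennreal (p k)" for k
  proof -
    have "real (Suc k) * p (Suc k) = l * p k"
      by (simp add: p_def del: of_nat_Suc)
    then show ?thesis
      using l(2) by (metis ennreal_mult' ennreal_of_nat_eq_real_of_nat of_nat_0_le_iff)
  qed
  have "(\<integral>\<^sup>+ N. emeasure N A * h (emeasure N A) \<partial>P) =
      (\<Sum>k. of_nat k * h (of_nat k) * ennreal (p k))"
    using h nn_integral_count[OF A, of "\<lambda>y. y * h y"] by (simp add: p_def l_def)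
  also have "\<dots> = (\<Sum>k. of_nat (Suc k) * h (of_nat (Suc k)) * ennreal (p (Suc k)))"
    by (subst suminf_offset[where i=1]) (simp_all del: of_nat_Suc)
  also have "\<dots> = (\<Sum>k. ennreal l * (h (of_nat k + 1) * ennreal (p k)))"
  proof (rule suminf_cong)
    fix k
    have "of_nat (Suc k) * h (of_nat (Suc k)) * ennreal (p (Suc k)) =
      h (of_nat (Suc k)) * (of_nat (Suc k) * ennreal (p (Suc k)))"
      by (simp only: mult_ac)
    then show "of_nat (Suc k) * h (of_nat (Suc k)) * ennreal (p (Suc k)) =
      ennreal l * (h (of_nat k + 1) * ennreal (p k))"
      unfolding p by (simp add: mult_ac add.commute)
  qed
  also have "\<dots> = ennreal l * (\<integral>\<^sup>+ N. h (emeasure N A + 1) \<partial>P)"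
    using h nn_integral_count[OF A, of "\<lambda>y. h (y + 1)"] by (simp add: p_def l_def)
  finally show ?thesis by (simp add: l)
qed

text \<open>By independence the vector of counts has a product law, so the k-th count can be
  integrated with the others frozen, and there the identity for a single count applies. F may be any
  measurable function of the vector, in particular the indicator of a cylinder.\<close>

lemma nn_integral_counts_size_bias:
  fixes D :: "nat \<Rightarrow> 'a set"
  assumes D: "\<And>i. D i \<in> sets borel \<and> bounded (D i)" "disjoint_family D" and k: "k < m"
    and F: "F \<in> borel_measurable (PiM {..<m} (\<lambda>_. borel))"
  shows "(\<integral>\<^sup>+ N. emeasure N (D k) * F (\<lambda>i\<in>{..<m}. emeasure N (D i)) \<partial>P) =
    emeasure \<nu> (D k) *
      (\<integral>\<^sup>+ N. F ((\<lambda>i\<in>{..<m}. emeasure N (D i))(k := emeasure N (D k) + 1)) \<partial>P)"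
proof -
  define Q where "Q i = distr P borel (\<lambda>N. emeasure N (D i))" for i
  define Y where "Y N = (\<lambda>i\<in>{..<m}. emeasure N (D i))" for N :: "'a measure"
  have [measurable]: "D i \<in> sets borel" for i
    using D(1) by simp
  have Y [measurable]: "Y \<in> P \<rightarrow>\<^sub>M PiM {..<m} (\<lambda>_. borel)"
    unfolding Y_def by measurable
  have "disjoint_family_on D {..<m}"
    using D(2) by (auto simp: disjoint_family_on_def)
  then have "indep_vars (\<lambda>_. borel) (\<lambda>i N. emeasure N (D i)) {..<m}"
    using poisson[unfolded poisson_law_def, THEN conjunct2, THEN conjunct2, THEN conjunct2,
        THEN spec, THEN spec, THEN mp, of m D] D(1) by simp
  then have distr_Y: "distr P (PiM {..<m} (\<lambda>_. borel)) Y = PiM {..<m} Q"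
    unfolding Q_def Y_def using k by (subst (asm) indep_vars_iff_distr_eq_PiM') auto
  have "prob_space (Q i)" for i
    unfolding Q_def by (intro prob_space_distr) simp
  then interpret Q: product_prob_space Q
    by (simp add: product_prob_space_def product_prob_space_axioms_def product_sigma_finite_def prob_space_imp_sigma_finite)
  have sets_Q [measurable_cong]: "sets (Q i) = sets borel" for i
    by (simp add: Q_def)
  have sets_PiM_Q [measurable_cong]: "sets (PiM {..<m} Q) = sets (PiM {..<m} (\<lambda>_. borel))"
    by (intro sets_PiM_cong) (auto simp: sets_Q)
  have insert: "{..<m} = insert k ({..<m} - {k})"
    using k by auto
  note F [measurable]
  \<comment> \<open>Coordinate k is integrated innermost, and its law \<open>Q k\<close> is written
    again as an integral over P so that the identity for one count fits literally.\<close>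
  have split: "(\<integral>\<^sup>+ y. H y \<partial>PiM {..<m} Q) =
      (\<integral>\<^sup>+ x. \<integral>\<^sup>+ N. H (x(k := emeasure N (D k))) \<partial>P \<partial>PiM ({..<m} - {k}) Q)"
    if "H \<in> borel_measurable (PiM {..<m} (\<lambda>_. borel))" for H
  proof -
    have H: "H \<in> borel_measurable (PiM (insert k ({..<m} - {k})) Q)"
      unfolding insert[symmetric] using that by (simp add: measurable_cong_sets[OF sets_PiM_Q refl])
    have "(\<integral>\<^sup>+ y. H (x(k := y)) \<partial>Q k) = (\<integral>\<^sup>+ N. H (x(k := emeasure N (D k))) \<partial>P)"
      if "x \<in> space (PiM ({..<m} - {k}) Q)" for x
    proof -
      have "(\<lambda>y. x(k := y)) \<in> Q k \<rightarrow>\<^sub>M PiM (insert k ({..<m} - {k})) Q"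
        using that by (intro measurable_fun_upd[where J="{..<m} - {k}"]) auto
      from measurable_compose[OF this H] show ?thesis
        unfolding Q_def by (subst nn_integral_distr) simp_all
    qed
    then show ?thesis
      using H by (subst insert, subst Q.product_nn_integral_insert) (auto intro!: nn_integral_cong)
  qed
  have upd_Y: "(Y N)(k := emeasure N (D k) + 1) = (Y N)(k := Y N k + 1)" for N
    using k by (simp add: Y_def)
  have upd [measurable]: "(\<lambda>y::nat \<Rightarrow> ennreal. y(k := y k + 1)) \<in> PiM {..<m} (\<lambda>_. borel) \<rightarrow>\<^sub>M PiM {..<m} (\<lambda>_. borel)"
    using k by (intro measurable_fun_upd[where J="{..<m}"]) auto
  have F_upd: "(\<lambda>y. F (y(k := y k + 1))) \<in> borel_measurable (PiM {..<m} (\<lambda>_. borel))"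
    by measurable
  have F_mult: "(\<lambda>y. y k * F y) \<in> borel_measurable (PiM {..<m} (\<lambda>_. borel))"
    using k by (intro borel_measurable_times_ennreal measurable_component_singleton F) auto
  have section_F: "(\<lambda>y. F (x(k := y))) \<in> borel_measurable borel"
    if "x \<in> space (PiM ({..<m} - {k}) Q)" for x
  proof -
    have "x \<in> space (PiM ({..<m} - {k}) (\<lambda>_. borel))"
      using that sets_Q[THEN sets_eq_imp_space_eq] by (simp add: space_PiM)
    then have "(\<lambda>y. x(k := y)) \<in> borel \<rightarrow>\<^sub>M PiM {..<m} (\<lambda>_. borel)"
      using k by (intro measurable_fun_upd[where J="{..<m} - {k}"]) auto
    from measurable_compose[OF this F] show ?thesis .
  qed
  have "(\<integral>\<^sup>+ N. emeasure N (D k) * F (Y N) \<partial>P) = (\<integral>\<^sup>+ N. Y N k * F (Y N) \<partial>P)"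
    using k by (simp add: Y_def)
  also have "\<dots> = (\<integral>\<^sup>+ y. y k * F y \<partial>PiM {..<m} Q)"
    unfolding distr_Y[symmetric] by (simp add: nn_integral_distr[OF Y] F_mult)
  also have "\<dots> = (\<integral>\<^sup>+ x. \<integral>\<^sup>+ N. emeasure N (D k) * F (x(k := emeasure N (D k))) \<partial>P \<partial>PiM ({..<m} - {k}) Q)"
    by (subst split[OF F_mult]) simp
  also have "\<dots> = (\<integral>\<^sup>+ x. emeasure \<nu> (D k) * (\<integral>\<^sup>+ N. F (x(k := emeasure N (D k) + 1)) \<partial>P) \<partial>PiM ({..<m} - {k}) Q)"
    using D(1) by (intro nn_integral_cong nn_integral_count_size_bias section_F) auto
  also have "\<dots> = emeasure \<nu> (D k) *
      (\<integral>\<^sup>+ x. (\<integral>\<^sup>+ N. F (x(k := emeasure N (D k) + 1)) \<partial>P) \<partial>PiM ({..<m} - {k}) Q)"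
  proof (rule nn_integral_cmult)
    have upd2: "(\<lambda>w. (fst w)(k := emeasure (snd w) (D k) + 1)) \<in>
        PiM ({..<m} - {k}) Q \<Otimes>\<^sub>M P \<rightarrow>\<^sub>M PiM {..<m} (\<lambda>_. borel)"
    proof (rule measurable_fun_upd[where J="{..<m} - {k}"])
      show "fst \<in> PiM ({..<m} - {k}) Q \<Otimes>\<^sub>M P \<rightarrow>\<^sub>M PiM ({..<m} - {k}) (\<lambda>_. borel)"
        using measurable_fst[of "PiM ({..<m} - {k}) Q" P]
        by (simp add: measurable_cong_sets[OF refl sets_PiM_cong[OF refl sets_Q]])
    qed (use k in auto)
    show "(\<lambda>x. \<integral>\<^sup>+ N. F (x(k := emeasure N (D k) + 1)) \<partial>P) \<in> borel_measurable (PiM ({..<m} - {k}) Q)"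
      using measurable_compose[OF upd2 F]
      by (intro borel_measurable_nn_integral) (simp add: case_prod_beta')
  qed
  also have "\<dots> = emeasure \<nu> (D k) * (\<integral>\<^sup>+ y. F (y(k := y k + 1)) \<partial>PiM {..<m} Q)"
    by (subst split[OF F_upd]) simp
  also have "\<dots> = emeasure \<nu> (D k) * (\<integral>\<^sup>+ N. F ((Y N)(k := Y N k + 1)) \<partial>P)"
    unfolding distr_Y[symmetric] by (simp add: nn_integral_distr[OF Y] F_upd)
  finally show ?thesis
    by (simp add: Y_def[symmetric] upd_Y)
qed

end

section \<open>Mecke's formula\<close>

text \<open>For y in J the left side would count the atom at y twice and the right side once. This
  is where a new point and a repeated point part ways.\<close>

lemma add_atoms_insert:
  assumes "boundedly_finite \<mu>" "finite J" "y \<notin> J"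
  shows "add_atoms (add_atoms \<mu> {y} (\<lambda>x. x)) J (\<lambda>x. x) = add_atoms \<mu> (insert y J) (\<lambda>x. x)"
proof (rule measure_eqI)
  show "sets (add_atoms (add_atoms \<mu> {y} (\<lambda>x. x)) J (\<lambda>x. x)) = sets (add_atoms \<mu> (insert y J) (\<lambda>x. x))"
    using assms by (simp add: sets_add_atoms boundedly_finite_sets)
  fix A assume "A \<in> sets (add_atoms (add_atoms \<mu> {y} (\<lambda>x. x)) J (\<lambda>x. x))"
  then show "emeasure (add_atoms (add_atoms \<mu> {y} (\<lambda>x. x)) J (\<lambda>x. x)) A = emeasure (add_atoms \<mu> (insert y J) (\<lambda>x. x)) A"
    using assms by (simp add: sets_add_atoms emeasure_add_atoms boundedly_finite_sets add.assoc)
qed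

lemma add_atoms_empty: "boundedly_finite \<mu> \<Longrightarrow> add_atoms \<mu> {} x = \<mu>"
  by (rule measure_eqI) (simp_all add: sets_add_atoms emeasure_add_atoms boundedly_finite_sets)

text \<open>The index set \<open>{x z}\<close> moves with z, whereas measurability was shown for a
  fixed index set. A one-point index set carrying the value \<open>x z\<close> repairs this.\<close>

lemma measurable_add_atom:
  fixes \<kappa> :: "'b \<Rightarrow> 'a::metric_space measure"
  assumes "\<kappa> \<in> \<Lambda> \<rightarrow>\<^sub>M bf_measures" "x \<in> \<Lambda> \<rightarrow>\<^sub>M borel"
  shows "(\<lambda>z. add_atoms (\<kappa> z) {x z} (\<lambda>y. y)) \<in> \<Lambda> \<rightarrow>\<^sub>M bf_measures"
proof -
  have "add_atoms (\<kappa> z) {x z} (\<lambda>y. y) = add_atoms (\<kappa> z) {()} (\<lambda>_. x z)" for z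
    using add_atoms_reindex[of "\<lambda>_::unit. x z" "{()}" "\<lambda>_. x z" "\<lambda>y. y" "\<kappa> z"] by simp
  then show ?thesis
    using measurable_add_atoms[OF assms(1), of "{()}" "\<lambda>z _. x z"] assms(2) by simp
qed

context poisson_random_measure
begin

lemma measurable_ident_P: "(\<lambda>N. N) \<in> P \<rightarrow>\<^sub>M bf_measures"
  using measurable_ident_sets[OF sets_P] .

text \<open>On a common dissection of A and the sets occurring in F, the mass of A is a sum of
  counts and the cylinder event is a function \<open>\<Phi>\<close> of the counts. The size-bias
  identity is applied to each summand separately.\<close>

lemma mecke_cylinder:
  assumes A: "A \<in> sets borel" "bounded A" and "finite F"
    and F: "\<And>B S. (B, S) \<in> F \<Longrightarrow> B \<in> sets borel \<and> bounded B \<and> S \<in> sets borel"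
  shows "(\<integral>\<^sup>+ N. emeasure N A * indicator (cylinder F) N \<partial>P) =
    (\<integral>\<^sup>+ x. indicator A x * (\<integral>\<^sup>+ N. indicator (cylinder F) (add_atoms N {x} (\<lambda>y. y)) \<partial>P) \<partial>\<nu>)"
proof -
  have family: "B \<in> sets borel \<and> bounded B" if "B \<in> insert A (fst ` F)" for B
    using that A F by fastforce
  have "finite (insert A (fst ` F))"
    using \<open>finite F\<close> by simp
  from finite_dissection[OF this family]
  obtain D m where D: "\<And>i::nat. D i \<in> sets borel \<and> bounded (D i)" "disjoint_family D"
    and dissect: "\<And>B. B \<in> insert A (fst ` F) \<Longrightarrow> \<exists>I. I \<subseteq> {..<m} \<and> B = (\<Union>i\<in>I. D i)"
    by metis
  from dissect obtain IA where IA: "IA \<subseteq> {..<m}" "A = (\<Union>i\<in>IA. D i)" by auto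
  have "\<forall>p\<in>F. \<exists>I. I \<subseteq> {..<m} \<and> fst p = (\<Union>i\<in>I. D i)"
    using dissect by auto
  then obtain I where I: "\<And>p. p \<in> F \<Longrightarrow> I p \<subseteq> {..<m}" "\<And>p. p \<in> F \<Longrightarrow> fst p = (\<Union>i\<in>I p. D i)"
    by metis
  have [measurable]: "D i \<in> sets borel" for i
    using D(1) by simp
  have finite_I: "finite IA" "p \<in> F \<Longrightarrow> finite (I p)" for p
    using IA(1) I(1)[of p] finite_subset by auto
  define Y where "Y N = (\<lambda>i\<in>{..<m}. emeasure N (D i))" for N :: "'a measure"
  define \<Phi> where "\<Phi> y = (if \<forall>p\<in>F. (\<Sum>i\<in>I p. y i) \<in> snd p then 1 else 0 :: ennreal)" for y :: "nat \<Rightarrow> ennreal"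
  have emeasure_UN: "emeasure N (\<Union>i\<in>K. D i) = (\<Sum>i\<in>K. emeasure N (D i))"
    if "boundedly_finite N" "finite K" for N K
    using that D by (intro sum_emeasure[symmetric])
      (auto simp: boundedly_finite_sets disjoint_family_on_def)
  have \<Phi>: "indicator (cylinder F) N = \<Phi> (Y N)" if "boundedly_finite N" for N
  proof -
    have "emeasure N (fst p) = (\<Sum>i\<in>I p. Y N i)" if "p \<in> F" for p
    proof -
      have "emeasure N (fst p) = (\<Sum>i\<in>I p. emeasure N (D i))"
        using I(2)[OF that] emeasure_UN[OF \<open>boundedly_finite N\<close> finite_I(2)[OF that]] by simp
      also have "\<dots> = (\<Sum>i\<in>I p. Y N i)"
        using I(1)[OF that] by (intro sum.cong) (auto simp: Y_def)
      finally show ?thesis .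
    qed
    then show ?thesis
      using that by (auto simp: cylinder_def \<Phi>_def indicator_def split_beta)
  qed
  have \<Phi>_meas: "\<Phi> \<in> borel_measurable (PiM {..<m} (\<lambda>_. borel))"
    unfolding \<Phi>_def
  proof (intro measurable_If sets.sets_Collect_finite_All[OF _ \<open>finite F\<close>])
    fix p assume p: "p \<in> F"
    have "(\<lambda>y::nat\<Rightarrow>ennreal. \<Sum>i\<in>I p. y i) \<in> borel_measurable (PiM {..<m} (\<lambda>_. borel))"
      using I(1)[OF p] by (intro borel_measurable_sum measurable_component_singleton) auto
    moreover have "snd p \<in> sets borel"
      using F[of "fst p" "snd p"] p by simp
    ultimately have "(\<lambda>y::nat\<Rightarrow>ennreal. \<Sum>i\<in>I p. y i) -` snd p \<inter> space (PiM {..<m} (\<lambda>_. borel)) \<in> sets (PiM {..<m} (\<lambda>_. borel))"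
      by (rule measurable_sets)
    then show "{y \<in> space (PiM {..<m} (\<lambda>_. borel)). (\<Sum>i\<in>I p. y i) \<in> snd p} \<in> sets (PiM {..<m} (\<lambda>_. borel))"
      by (simp add: vimage_def Int_def conj_commute)
  qed auto
  \<comment> \<open>\<open>c k\<close> will be the value of the inner expectation on the right for
    every x in \<open>D k\<close>. Its constancy on each piece turns the finite sum into an integral
    against \<nu>.\<close>
  define c where "c k = (\<integral>\<^sup>+ N. \<Phi> ((Y N)(k := emeasure N (D k) + 1)) \<partial>P)" for k
  have Y_meas: "Y \<in> P \<rightarrow>\<^sub>M PiM {..<m} (\<lambda>_. borel)"
    unfolding Y_def by measurable
  have "(\<integral>\<^sup>+ N. emeasure N A * indicator (cylinder F) N \<partial>P) =
      (\<integral>\<^sup>+ N. (\<Sum>k\<in>IA. emeasure N (D k) * \<Phi> (Y N)) \<partial>P)"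
    by (intro nn_integral_cong)
      (simp add: IA(2) emeasure_UN finite_I bf_P \<Phi> sum_distrib_right)
  also have "\<dots> = (\<Sum>k\<in>IA. \<integral>\<^sup>+ N. emeasure N (D k) * \<Phi> (Y N) \<partial>P)"
    using measurable_compose[OF Y_meas \<Phi>_meas]
    by (intro nn_integral_sum borel_measurable_times_ennreal) auto
  also have "\<dots> = (\<Sum>k\<in>IA. emeasure \<nu> (D k) * c k)"
  proof (rule sum.cong)
    fix k assume "k \<in> IA"
    then have "k < m" using IA(1) by auto
    from nn_integral_counts_size_bias[OF D this \<Phi>_meas]
    show "(\<integral>\<^sup>+ N. emeasure N (D k) * \<Phi> (Y N) \<partial>P) = emeasure \<nu> (D k) * c k"
      by (simp add: Y_def c_def)
  qed simp
  also have "\<dots> = (\<Sum>k\<in>IA. \<integral>\<^sup>+ x. c k * indicator (D k) x \<partial>\<nu>)"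
    using D(1) by (intro sum.cong)
      (auto simp: nn_integral_cmult_indicator boundedly_finite_sets[OF bf_mean] mult.commute)
  also have "\<dots> = (\<integral>\<^sup>+ x. (\<Sum>k\<in>IA. c k * indicator (D k) x) \<partial>\<nu>)"
    by (rule nn_integral_sum[symmetric])
      (auto intro!: borel_measurable_times_ennreal borel_measurable_indicator simp: boundedly_finite_sets[OF bf_mean])
  also have "\<dots> = (\<integral>\<^sup>+ x. indicator A x * (\<integral>\<^sup>+ N. indicator (cylinder F) (add_atoms N {x} (\<lambda>y. y)) \<partial>P) \<partial>\<nu>)"
  proof (rule nn_integral_cong)
    fix x
    show "(\<Sum>k\<in>IA. c k * indicator (D k) x) =
      indicator A x * (\<integral>\<^sup>+ N. indicator (cylinder F) (add_atoms N {x} (\<lambda>y. y)) \<partial>P)"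
    proof (cases "x \<in> A")
      case True
      then obtain k where k: "k \<in> IA" "x \<in> D k"
        using IA by auto
      \<comment> \<open>By disjointness, an atom at x raises the k-th count by one and no
        other.\<close>
      have D_iff: "x \<in> D i \<longleftrightarrow> i = k" for i
        using k(2) D(2) by (auto simp: disjoint_family_on_def)
      have "\<Phi> ((Y N)(k := emeasure N (D k) + 1)) = indicator (cylinder F) (add_atoms N {x} (\<lambda>y. y))"
        if N: "N \<in> space P" for N
      proof -
        have "(Y N)(k := emeasure N (D k) + 1) = Y (add_atoms N {x} (\<lambda>y. y))"
          using k IA(1) by (auto simp: Y_def fun_eq_iff emeasure_add_atoms boundedly_finite_sets[OF bf_P[OF N]] D_iff)
        then show ?thesis
          by (simp add: \<Phi>[OF boundedly_finite_add_atoms[OF bf_P[OF N]]])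
      qed
      then have "c k = (\<integral>\<^sup>+ N. indicator (cylinder F) (add_atoms N {x} (\<lambda>y. y)) \<partial>P)"
        unfolding c_def by (intro nn_integral_cong) simp
      moreover have "(\<Sum>i\<in>IA. c i * indicator (D i) x) = c k"
        using k(1) finite_I(1) by (simp add: indicator_def D_iff sum.delta if_distrib[of "\<lambda>u. c _ * u"] cong: if_cong)
      ultimately show ?thesis
        using True by simp
    next
      case False
      then have "x \<notin> D k" if "k \<in> IA" for k
        using that IA by auto
      then show ?thesis
        using False by simp
    qed
  qed
  finally show ?thesis .
qed

text \<open>Both sides are integrals of g over pairs \<open>(x, N)\<close>, against
  \<open>\<mu>1\<close> on the left and \<open>\<mu>2\<close> on the right, so the identity for all
  g is the equality of these two measures.\<close>

theorem mecke:
  assumes g: "(\<lambda>(x, N). g x N) \<in> borel_measurable (borel \<Otimes>\<^sub>M bf_measures)"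
  shows "(\<integral>\<^sup>+ N. \<integral>\<^sup>+ x. g x N \<partial>N \<partial>P) = (\<integral>\<^sup>+ x. \<integral>\<^sup>+ N. g x (add_atoms N {x} (\<lambda>y. y)) \<partial>P \<partial>\<nu>)"
proof -
  obtain T :: "('a set \<times> ennreal set) set" where "countable T" and
    T: "\<And>B S. (B, S) \<in> T \<Longrightarrow> B \<in> sets borel \<and> bounded B \<and> S \<in> sets borel"
    and gen: "sets bf_measures = sigma_sets (space bf_measures) {cylinder F | F. finite F \<and> F \<subseteq> T}"
    by (rule bf_measures_generator) (rule that)
  obtain x0 :: 'a where True by simp
  define S :: "('a \<times> 'a measure) measure" where "S = borel \<Otimes>\<^sub>M bf_measures"
  define \<kappa>1 where "\<kappa>1 N = distr N S (\<lambda>x. (x, N))" for N :: "'a measure"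
  define \<kappa>2 where "\<kappa>2 x = distr P S (\<lambda>N. (x, add_atoms N {x} (\<lambda>y. y)))" for x
  define \<mu>1 where "\<mu>1 = measure_of (space S) (sets S) (\<lambda>B. \<integral>\<^sup>+ N. emeasure (\<kappa>1 N) B \<partial>P)"
  define \<mu>2 where "\<mu>2 = measure_of (space S) (sets S) (\<lambda>B. \<integral>\<^sup>+ x. emeasure (\<kappa>2 x) B \<partial>\<nu>)"
  have pair1: "(\<lambda>x. (x, N)) \<in> N \<rightarrow>\<^sub>M S" if "N \<in> space P" for N
    unfolding S_def using that
    by (intro measurable_Pair measurable_const measurable_ident_sets)
      (auto simp: boundedly_finite_sets[OF bf_P] space_P space_bf_measures)
  have add_meas: "(\<lambda>w. add_atoms (snd w) {fst w} (\<lambda>y. y)) \<in> borel \<Otimes>\<^sub>M P \<rightarrow>\<^sub>M bf_measures"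
    using measurable_compose[OF measurable_snd measurable_ident_P, of "borel :: 'a measure"]
    by (intro measurable_add_atom) auto
  then have pair2': "(\<lambda>w. (fst w, add_atoms (snd w) {fst w} (\<lambda>y. y))) \<in> borel \<Otimes>\<^sub>M P \<rightarrow>\<^sub>M S"
    unfolding S_def by measurable
  from measurable_compose[OF measurable_Pair1' this] have pair2: "(\<lambda>N. (x, add_atoms N {x} (\<lambda>y. y))) \<in> P \<rightarrow>\<^sub>M S" for x
    by simp
  interpret m1: mixture P S \<kappa>1 \<mu>1
  proof
    fix B assume B: "B \<in> sets S"
    have "emeasure (\<kappa>1 N) B = (\<integral>\<^sup>+ x. indicator B (x, N) \<partial>N)" if N: "N \<in> space P" for N
    proof -
      have "emeasure (\<kappa>1 N) B = (\<integral>\<^sup>+ w. indicator B w \<partial>\<kappa>1 N)"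
        using B by (intro nn_integral_indicator[symmetric]) (simp add: \<kappa>1_def)
      also have "\<dots> = (\<integral>\<^sup>+ x. indicator B (x, N) \<partial>N)"
        unfolding \<kappa>1_def using B by (intro nn_integral_distr[OF pair1[OF N]]) simp
      finally show ?thesis .
    qed
    moreover have "(\<lambda>N. \<integral>\<^sup>+ x. indicator B (x, N) \<partial>N) \<in> borel_measurable P"
    proof (rule measurable_nn_integral_bf_measures[OF measurable_ident_P])
      have "(\<lambda>w. (snd w, fst w)) \<in> P \<Otimes>\<^sub>M borel \<rightarrow>\<^sub>M S"
        unfolding S_def by (simp add: measurable_cong_sets[OF sets_pair_measure_cong[OF sets_P refl] refl])
      from measurable_compose[OF this borel_measurable_indicator[OF B]]
      show "(\<lambda>(N, x). indicator B (x, N)) \<in> borel_measurable (P \<Otimes>\<^sub>M borel)"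
        by (simp add: case_prod_beta')
    qed
    ultimately show "(\<lambda>N. emeasure (\<kappa>1 N) B) \<in> borel_measurable P"
      by (simp cong: measurable_cong)
  qed (simp_all add: \<kappa>1_def \<mu>1_def)
  interpret m2: mixture \<nu> S \<kappa>2 \<mu>2
  proof
    fix B assume B: "B \<in> sets S"
    have "emeasure (\<kappa>2 x) B = (\<integral>\<^sup>+ N. indicator B (x, add_atoms N {x} (\<lambda>y. y)) \<partial>P)" for x
    proof -
      have "emeasure (\<kappa>2 x) B = (\<integral>\<^sup>+ w. indicator B w \<partial>\<kappa>2 x)"
        using B by (intro nn_integral_indicator[symmetric]) (simp add: \<kappa>2_def)
      also have "\<dots> = (\<integral>\<^sup>+ N. indicator B (x, add_atoms N {x} (\<lambda>y. y)) \<partial>P)"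
        unfolding \<kappa>2_def using B by (intro nn_integral_distr[OF pair2]) simp
      finally show ?thesis .
    qed
    moreover have "(\<lambda>x. \<integral>\<^sup>+ N. indicator B (x, add_atoms N {x} (\<lambda>y. y)) \<partial>P) \<in> borel_measurable borel"
      using measurable_compose[OF pair2' borel_measurable_indicator[OF B]]
      by (intro borel_measurable_nn_integral) (simp add: case_prod_beta')
    ultimately show "(\<lambda>x. emeasure (\<kappa>2 x) B) \<in> borel_measurable \<nu>"
      by (simp add: measurable_cong_sets[OF boundedly_finite_sets[OF bf_mean] refl])
  qed (simp_all add: \<kappa>2_def \<mu>2_def)
  define E where "E = {A \<times> cylinder F | A F. A \<in> sets (borel :: 'a measure) \<and> bounded A \<and> finite F \<and> F \<subseteq> T}"
  have sets_S: "sets S = sigma_sets (space S) E"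
  proof -
    have "sets S = sets (sigma (space (borel::'a measure) \<times> space bf_measures)
      {a \<times> b | a b. a \<in> {A \<in> sets (borel::'a measure). bounded A} \<and> b \<in> {cylinder F | F. finite F \<and> F \<subseteq> T}})"
      unfolding S_def
    \<comment> \<open>Rectangles of generators generate the product \<sigma>-algebra because each
      factor is covered by countably many generators: balls in the first, \<open>cylinder {}\<close>
      in the second.\<close>
    proof (rule sets_pair_eq[where Ca="range (\<lambda>k::nat. ball x0 (real k))" and Cb="{cylinder {}}"])
      show "sets borel = sigma_sets (space (borel::'a measure)) {A \<in> sets borel. bounded A}"
      proof
        show "sets (borel::'a measure) \<subseteq> sigma_sets (space borel) {A \<in> sets borel. bounded A}"
        proof
          fix A :: "'a set" assume "A \<in> sets borel"
          then have "(\<Union>k::nat. A \<inter> ball x0 (real k)) \<in> sigma_sets (space borel) {A \<in> sets borel. bounded A}"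
            by (intro sigma_sets.Union sigma_sets.Basic) (auto simp: bounded_Int)
          also have "(\<Union>k::nat. A \<inter> ball x0 (real k)) = A"
            using ball_of_nat_cover[of x0] by auto
          finally show "A \<in> sigma_sets (space borel) {A \<in> sets borel. bounded A}" .
        qed
        show "sigma_sets (space (borel::'a measure)) {A \<in> sets borel. bounded A} \<subseteq> sets borel"
          by (rule sets.sigma_sets_subset) auto
      qed
    qed (use gen ball_of_nat_cover[of x0] in \<open>auto simp: cylinder_def space_bf_measures\<close>)
    also have "{a \<times> b | a b. a \<in> {A \<in> sets (borel::'a measure). bounded A} \<and> b \<in> {cylinder F | F. finite F \<and> F \<subseteq> T}} = E"
      unfolding E_def by blast
    finally show ?thesis
      by (subst (asm) sets_measure_of) (auto simp: S_def space_pair_measure E_def cylinder_def space_bf_measures)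
  qed
  have em1: "emeasure \<mu>1 (A \<times> cylinder F) = (\<integral>\<^sup>+ N. emeasure N A * indicator (cylinder F) N \<partial>P)"
    if "A \<in> sets borel" "bounded A" "finite F" "F \<subseteq> T" for A F
  proof -
    have cyl: "cylinder F \<in> sets bf_measures"
      using that T by (intro cylinder_in_sets) auto
    have "emeasure (\<kappa>1 N) (A \<times> cylinder F) = emeasure N A * indicator (cylinder F) N" if "N \<in> space P" for N
      using that \<open>A \<in> sets borel\<close> cyl unfolding \<kappa>1_def
      by (subst emeasure_distr[OF pair1]) (auto simp: S_def indicator_def vimage_def boundedly_finite_space[OF bf_P])
    then show ?thesis
      using that cyl by (subst m1.emeasure_mixture) (auto simp: S_def intro!: nn_integral_cong)
  qed
  have em2: "emeasure \<mu>2 (A \<times> cylinder F) =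
    (\<integral>\<^sup>+ x. indicator A x * (\<integral>\<^sup>+ N. indicator (cylinder F) (add_atoms N {x} (\<lambda>y. y)) \<partial>P) \<partial>\<nu>)"
    if "A \<in> sets borel" "bounded A" "finite F" "F \<subseteq> T" for A F
  proof -
    have "cylinder F \<in> sets bf_measures"
      using that T by (intro cylinder_in_sets) auto
    then have rect: "A \<times> cylinder F \<in> sets S"
      using that by (auto simp: S_def)
    have "emeasure (\<kappa>2 x) (A \<times> cylinder F) =
      indicator A x * (\<integral>\<^sup>+ N. indicator (cylinder F) (add_atoms N {x} (\<lambda>y. y)) \<partial>P)" for x
    proof -
      have "emeasure (\<kappa>2 x) (A \<times> cylinder F) = (\<integral>\<^sup>+ w. indicator (A \<times> cylinder F) w \<partial>\<kappa>2 x)"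
        using rect by (intro nn_integral_indicator[symmetric]) (simp add: \<kappa>2_def)
      also have "\<dots> = (\<integral>\<^sup>+ N. indicator (A \<times> cylinder F) (x, add_atoms N {x} (\<lambda>y. y)) \<partial>P)"
        unfolding \<kappa>2_def using rect by (intro nn_integral_distr[OF pair2]) simp
      also have "\<dots> = indicator A x * (\<integral>\<^sup>+ N. indicator (cylinder F) (add_atoms N {x} (\<lambda>y. y)) \<partial>P)"
        by (cases "x \<in> A") (simp_all add: indicator_times)
      finally show ?thesis .
    qed
    then show ?thesis
      using rect by (simp add: m2.emeasure_mixture)
  qed
  have "\<mu>1 = \<mu>2"
  proof (rule measure_eqI_generator_eq[where E=E and \<Omega>="space S" and A="\<lambda>k::nat. ball x0 (real k) \<times> cylinder {}"])
    show "Int_stable E"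
    proof (rule Int_stableI)
      fix a b assume "a \<in> E" "b \<in> E"
      then obtain A F B G where "a = A \<times> cylinder F" "b = B \<times> cylinder G" "A \<in> sets borel" "bounded A" "B \<in> sets borel"
        "finite F" "F \<subseteq> T" "finite G" "G \<subseteq> T"
        by (auto simp: E_def)
      then show "a \<inter> b \<in> E"
        by (auto simp: E_def cylinder_Int Times_Int_Times bounded_Int intro!: exI[of _ "A \<inter> B"] exI[of _ "F \<union> G"])
    qed
    show "E \<subseteq> Pow (space S)"
      by (auto simp: E_def S_def space_pair_measure cylinder_def space_bf_measures)
    show "emeasure \<mu>1 X = emeasure \<mu>2 X" if X: "X \<in> E" for X
    proof -
      obtain A F where AF: "X = A \<times> cylinder F" "A \<in> sets borel" "bounded A" "finite F" "F \<subseteq> T"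
        using X by (auto simp: E_def)
      then show ?thesis
        using T by (subst AF(1), simp only: em1 em2, intro mecke_cylinder) auto
    qed
    show "sets \<mu>1 = sigma_sets (space S) E" "sets \<mu>2 = sigma_sets (space S) E"
      using m1.sets_mixture m2.sets_mixture sets_S by auto
    show "range (\<lambda>k::nat. ball x0 (real k) \<times> cylinder {}) \<subseteq> E"
      by (force simp: E_def)
    show "(\<Union>k::nat. ball x0 (real k) \<times> cylinder {}) = space S"
      using ball_of_nat_cover[of x0]
      by (auto simp: S_def space_pair_measure cylinder_def space_bf_measures)
    show "emeasure \<mu>1 (ball x0 (real k) \<times> cylinder {}) \<noteq> \<infinity>" for k :: nat
    proof -
      have "indicator (cylinder {}) N = (1::ennreal)" if "N \<in> space P" for N
        using bf_P[OF that] by (simp add: cylinder_def)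
      then have "emeasure \<mu>1 (ball x0 (real k) \<times> cylinder {}) = (\<integral>\<^sup>+ N. emeasure N (ball x0 (real k)) * 1 \<partial>P)"
        by (subst em1) (auto intro!: nn_integral_cong)
      \<comment> \<open>Size bias with the constant function 1: the expected count of a bounded set
        is its \<nu>-mass, which is finite.\<close>
      also have "\<dots> = emeasure \<nu> (ball x0 (real k))"
        by (subst nn_integral_count_size_bias) (auto simp: emeasure_space_1)
      finally show ?thesis
        using boundedly_finite_less_top[OF bf_mean, of "ball x0 (real k)"] by simp
    qed
  qed
  define f where "f = (\<lambda>(x, N). g x N)"
  have f: "f \<in> borel_measurable S"
    using g by (simp add: f_def S_def)
  have "(\<integral>\<^sup>+ N. \<integral>\<^sup>+ x. g x N \<partial>N \<partial>P) = (\<integral>\<^sup>+ N. \<integral>\<^sup>+ w. f w \<partial>\<kappa>1 N \<partial>P)"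
    unfolding \<kappa>1_def using f by (intro nn_integral_cong) (simp add: nn_integral_distr pair1 f_def)
  also have "\<dots> = (\<integral>\<^sup>+ x. \<integral>\<^sup>+ w. f w \<partial>\<kappa>2 x \<partial>\<nu>)"
    using \<open>\<mu>1 = \<mu>2\<close> by (simp add: m1.nn_integral_mixture[OF f, symmetric] m2.nn_integral_mixture[OF f, symmetric])
  also have "\<dots> = (\<integral>\<^sup>+ x. \<integral>\<^sup>+ N. g x (add_atoms N {x} (\<lambda>y. y)) \<partial>P \<partial>\<nu>)"
    unfolding \<kappa>2_def using f by (intro nn_integral_cong) (simp add: nn_integral_distr pair2 f_def)
  finally show ?thesis .
qed

end

section \<open>The multivariate formula in sequential form\<close>

declare One_nat_def [simp del]

lemma measurable_fun_upd_points:
  assumes X: "X \<in> \<Lambda> \<rightarrow>\<^sub>M points n" and y: "y \<in> \<Lambda> \<rightarrow>\<^sub>M borel"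
  shows "(\<lambda>z. (X z)(Suc n := y z)) \<in> \<Lambda> \<rightarrow>\<^sub>M points (Suc n)"
  by (rule measurable_fun_upd[OF _ X y]) auto

lemma fun_upd_image_Suc: "(X(Suc n := y)) ` {1..Suc n} = insert y (X ` {1..n})"
  by (auto simp: image_iff atLeastAtMostSuc_conv)

context poisson_random_measure
begin

lemma sets_mean: "sets \<nu> = sets borel"
  using boundedly_finite_sets[OF bf_mean] .

lemma sets_PiM_P: "N \<in> space P \<Longrightarrow> sets (PiM {1..n} (\<lambda>_. N)) = sets (points n)"
  by (rule sets_PiM_boundedly_finite[OF bf_P])

lemma measurable_nn_integral_PiM_P:
  assumes "(\<lambda>(X, N). f X N) \<in> borel_measurable (points n \<Otimes>\<^sub>M bf_measures)"
  shows "(\<lambda>N. \<integral>\<^sup>+ X. f X N \<partial>PiM {1..n} (\<lambda>_. N)) \<in> borel_measurable P"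
proof (rule measurable_nn_integral_PiM_bf_measures[OF _ measurable_ident_P])
  have "(\<lambda>w. (snd w, fst w)) \<in> P \<Otimes>\<^sub>M points n \<rightarrow>\<^sub>M points n \<Otimes>\<^sub>M bf_measures"
    by (simp add: measurable_cong_sets[OF sets_pair_measure_cong[OF sets_P refl] refl])
  from measurable_compose[OF this assms]
  show "(\<lambda>(N, X). f X N) \<in> borel_measurable (P \<Otimes>\<^sub>M points n)"
    by (simp add: case_prod_beta')
qed simp

lemma measurable_joint_kernel:
  assumes "N \<in> space P"
  shows "(\<lambda>X. (X, N)) \<in> PiM {1..n} (\<lambda>_. N) \<rightarrow>\<^sub>M points n \<Otimes>\<^sub>M bf_measures"
  using assms
  by (intro measurable_Pair measurable_const measurable_ident_sets sets_PiM_P)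
    (auto simp: space_P space_bf_measures)

lemma emeasure_joint_kernel:
  assumes B: "B \<in> sets (points n \<Otimes>\<^sub>M bf_measures)" and N: "N \<in> space P"
  shows "emeasure (distr (PiM {1..n} (\<lambda>_. N)) (points n \<Otimes>\<^sub>M bf_measures) (\<lambda>X. (X, N))) B =
      emeasure (PiM {1..n} (\<lambda>_. N)) {X. (X, N) \<in> B}"
proof -
  have "(\<lambda>X. (X, N)) -` B \<inter> space (PiM {1..n} (\<lambda>_. N)) = {X. (X, N) \<in> B}"
    using sets.sets_into_space[OF B] sets_eq_imp_space_eq[OF sets_PiM_P[OF N, of n]]
    by (auto simp: space_pair_measure)
  then show ?thesis
    using B by (simp add: emeasure_distr measurable_joint_kernel[OF N])
qed

text \<open>The kernel has to live on pairs, so the n-fold power of N is pushed forward under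
  \<open>\<lambda>X. (X, N)\<close>. Its mass on B is that of the section used in the definition of
  the joint measure.\<close>

lemma mixture_joint:
  "mixture P (points n \<Otimes>\<^sub>M bf_measures)
    (\<lambda>N. distr (PiM {1..n} (\<lambda>_. N)) (points n \<Otimes>\<^sub>M bf_measures) (\<lambda>X. (X, N))) (joint_measure n P)"
proof
  let ?S = "(points n :: (nat \<Rightarrow> 'a) measure) \<Otimes>\<^sub>M (bf_measures :: 'a measure measure)"
  fix B assume B: "B \<in> sets ?S"
  have "emeasure (PiM {1..n} (\<lambda>_. N)) {X. (X, N) \<in> B} = (\<integral>\<^sup>+ X. indicator B (X, N) \<partial>PiM {1..n} (\<lambda>_. N))"
    if N: "N \<in> space P" for N
  proof -
    have "(\<integral>\<^sup>+ X. indicator B (X, N) \<partial>PiM {1..n} (\<lambda>_. N)) =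
        (\<integral>\<^sup>+ w. indicator B w \<partial>distr (PiM {1..n} (\<lambda>_. N)) ?S (\<lambda>X. (X, N)))"
      using B by (intro nn_integral_distr[symmetric] measurable_joint_kernel N) simp
    then show ?thesis
      using B N by (simp add: emeasure_joint_kernel)
  qed
  moreover have "(\<lambda>N. \<integral>\<^sup>+ X. indicator B (X, N) \<partial>PiM {1..n} (\<lambda>_. N)) \<in> borel_measurable P"
    using B by (intro measurable_nn_integral_PiM_P) simp
  ultimately show "(\<lambda>N. emeasure (distr (PiM {1..n} (\<lambda>_. N)) ?S (\<lambda>X. (X, N))) B) \<in> borel_measurable P"
    using B by (simp add: emeasure_joint_kernel cong: measurable_cong)
next
  let ?S = "(points n :: (nat \<Rightarrow> 'a) measure) \<Otimes>\<^sub>M (bf_measures :: 'a measure measure)"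
  show "joint_measure n P = measure_of (space ?S) (sets ?S)
    (\<lambda>B. \<integral>\<^sup>+ N. emeasure (distr (PiM {1..n} (\<lambda>_. N)) ?S (\<lambda>X. (X, N))) B \<partial>P)"
    unfolding joint_measure_def
    by (intro measure_of_eq sets.space_closed nn_integral_cong)
      (simp add: emeasure_joint_kernel sets.sigma_sets_eq)
qed simp

lemma sets_joint_measure: "sets (joint_measure n P) = sets (points n \<Otimes>\<^sub>M bf_measures)"
  using mixture.sets_mixture[OF mixture_joint] .

lemma nn_integral_joint_measure:
  assumes "f \<in> borel_measurable (points n \<Otimes>\<^sub>M bf_measures)"
  shows "(\<integral>\<^sup>+ w. f w \<partial>joint_measure n P) = (\<integral>\<^sup>+ N. \<integral>\<^sup>+ X. f (X, N) \<partial>PiM {1..n} (\<lambda>_. N) \<partial>P)"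
  unfolding mixture.nn_integral_mixture[OF mixture_joint assms]
  using assms by (intro nn_integral_cong) (simp add: nn_integral_distr measurable_joint_kernel)

lemma mixture_moment: "mixture P (points n) (\<lambda>N. PiM {1..n} (\<lambda>_. N)) (moment_measure n P)"
proof
  fix B assume B: "B \<in> sets (points n :: (nat \<Rightarrow> 'a) measure)"
  have "(\<lambda>N. \<integral>\<^sup>+ X. indicator B X \<partial>PiM {1..n} (\<lambda>_. N)) \<in> borel_measurable P"
    using B by (intro measurable_nn_integral_PiM_P) (simp add: case_prod_beta')
  then show "(\<lambda>N. emeasure (PiM {1..n} (\<lambda>_. N)) B) \<in> borel_measurable P"
    using B by (simp add: sets_PiM_P cong: measurable_cong)
qed (simp_all add: sets_PiM_P moment_measure_def)

lemma measurable_add_atoms_mean: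
  "(\<lambda>X. add_atoms \<nu> (X ` {1..n}) (\<lambda>x. x)) \<in> points n \<rightarrow>\<^sub>M bf_measures"
  by (rule measurable_add_atoms_image) (simp_all add: space_bf_measures bf_mean)

lemma measurable_sequential_kernel:
  assumes "X \<in> space (points i)"
  shows "(\<lambda>y. X(Suc i := y)) \<in> add_atoms \<nu> (X ` {1..i}) (\<lambda>x. x) \<rightarrow>\<^sub>M points (Suc i)"
  using measurable_fun_upd_points[where \<Lambda>=borel, OF measurable_const[OF assms] measurable_ident]
  by (simp add: measurable_cong_sets[OF sets_add_atoms[OF sets_mean] refl])

lemma emeasure_sequential_kernel:
  assumes B: "B \<in> sets (points (Suc i))" and X: "X \<in> space (points i)"
  shows "emeasure (distr (add_atoms \<nu> (X ` {1..i}) (\<lambda>x. x)) (points (Suc i)) (\<lambda>y. X(Suc i := y))) B =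
    emeasure (add_atoms \<nu> (X ` {1..i}) (\<lambda>x. x)) {y. X(Suc i := y) \<in> B}"
proof -
  have "space (add_atoms \<nu> (X ` {1..i}) (\<lambda>x. x)) = UNIV"
    by (subst sets_eq_imp_space_eq[OF sets_add_atoms[OF sets_mean]]) simp_all
  then show ?thesis
    using B by (simp add: emeasure_distr measurable_sequential_kernel[OF X] vimage_def)
qed

lemma sets_sequential_measure: "sets (sequential_measure \<nu> i) = sets (points i)"
  by (cases i) simp_all

lemma mixture_sequential:
  "mixture (sequential_measure \<nu> i) (points (Suc i))
    (\<lambda>X. distr (add_atoms \<nu> (X ` {1..i}) (\<lambda>x. x)) (points (Suc i)) (\<lambda>y. X(Suc i := y)))
    (sequential_measure \<nu> (Suc i))"
proof
  let ?\<kappa> = "\<lambda>X. distr (add_atoms \<nu> (X ` {1..i}) (\<lambda>x. x)) (points (Suc i)) (\<lambda>y. X(Suc i := y))"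
  fix B assume B: "B \<in> sets (points (Suc i) :: (nat \<Rightarrow> 'a) measure)"
  have "emeasure (?\<kappa> X) B = (\<integral>\<^sup>+ y. indicator B (X(Suc i := y)) \<partial>add_atoms \<nu> (X ` {1..i}) (\<lambda>x. x))"
    if X: "X \<in> space (points i)" for X
  proof -
    have "emeasure (?\<kappa> X) B = (\<integral>\<^sup>+ w. indicator B w \<partial>?\<kappa> X)"
      using B by (intro nn_integral_indicator[symmetric]) simp
    also have "\<dots> = (\<integral>\<^sup>+ y. indicator B (X(Suc i := y)) \<partial>add_atoms \<nu> (X ` {1..i}) (\<lambda>x. x))"
      using B by (intro nn_integral_distr measurable_sequential_kernel X) simp
    finally show ?thesis .
  qed
  moreover have "(\<lambda>X. \<integral>\<^sup>+ y. indicator B (X(Suc i := y)) \<partial>add_atoms \<nu> (X ` {1..i}) (\<lambda>x. x)) \<in> borel_measurable (points i)"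
  proof (rule measurable_nn_integral_bf_measures[OF measurable_add_atoms_mean])
    have "(\<lambda>w. (fst w)(Suc i := snd w)) \<in> points i \<Otimes>\<^sub>M borel \<rightarrow>\<^sub>M points (Suc i)"
      by (intro measurable_fun_upd_points measurable_fst measurable_snd)
    from measurable_compose[OF this borel_measurable_indicator[OF B]]
    show "(\<lambda>(X, y). indicator B (X(Suc i := y))) \<in> borel_measurable (points i \<Otimes>\<^sub>M borel)"
      by (simp add: case_prod_beta')
  qed
  ultimately show "(\<lambda>X. emeasure (?\<kappa> X) B) \<in> borel_measurable (sequential_measure \<nu> i)"
    unfolding measurable_cong_sets[OF sets_sequential_measure refl] by (simp cong: measurable_cong)
next
  let ?\<kappa> = "\<lambda>X. distr (add_atoms \<nu> (X ` {1..i}) (\<lambda>x. x)) (points (Suc i)) (\<lambda>y. X(Suc i := y))"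
  have space: "space (sequential_measure \<nu> i) = space (points i)"
    by (rule sets_eq_imp_space_eq[OF sets_sequential_measure])
  show "sequential_measure \<nu> (Suc i) = measure_of (space (points (Suc i))) (sets (points (Suc i)))
     (\<lambda>B. \<integral>\<^sup>+ X. emeasure (?\<kappa> X) B \<partial>sequential_measure \<nu> i)"
    unfolding sequential_measure.simps
    by (intro measure_of_eq sets.space_closed nn_integral_cong)
      (simp add: emeasure_sequential_kernel sets.sigma_sets_eq space)
qed simp

text \<open>The last factor integrates as the sum of its \<nu>-part and its atomic part. The
  multivariate formula, the expansion over partitions and the mass bound for boxes all unfold this
  recursion.\<close>

lemma nn_integral_sequential_Suc:
  assumes f: "f \<in> borel_measurable (points (Suc i))"
  shows "(\<integral>\<^sup>+ X. f X \<partial>sequential_measure \<nu> (Suc i)) =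
    (\<integral>\<^sup>+ X. (\<integral>\<^sup>+ y. f (X(Suc i := y)) \<partial>\<nu>) + (\<Sum>x\<in>X ` {1..i}. f (X(Suc i := x)))
      \<partial>sequential_measure \<nu> i)"
  unfolding mixture.nn_integral_mixture[OF mixture_sequential f]
proof (rule nn_integral_cong)
  fix X assume "X \<in> space (sequential_measure \<nu> i)"
  then have X: "X \<in> space (points i)"
    using sets_eq_imp_space_eq[OF sets_sequential_measure] by simp
  have "(\<lambda>y. f (X(Suc i := y))) \<in> borel_measurable borel"
    using measurable_compose[OF measurable_sequential_kernel[OF X] f]
    by (simp add: measurable_cong_sets[OF sets_add_atoms[OF sets_mean] refl])
  then show "(\<integral>\<^sup>+ Y. f Y \<partial>distr (add_atoms \<nu> (X ` {1..i}) (\<lambda>x. x)) (points (Suc i)) (\<lambda>y. X(Suc i := y))) =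
      (\<integral>\<^sup>+ y. f (X(Suc i := y)) \<partial>\<nu>) + (\<Sum>x\<in>X ` {1..i}. f (X(Suc i := x)))"
    using f by (simp add: nn_integral_distr measurable_sequential_kernel[OF X] nn_integral_add_atoms sets_mean)
qed

lemma measurable_nn_integral_augmented:
  assumes f: "(\<lambda>(X, N). f X N) \<in> borel_measurable (points n \<Otimes>\<^sub>M bf_measures)"
    and X: "X \<in> \<Lambda> \<rightarrow>\<^sub>M points n"
  shows "(\<lambda>z. \<integral>\<^sup>+ N. f (X z) (add_atoms N (X z ` {1..n}) (\<lambda>x. x)) \<partial>P) \<in> borel_measurable \<Lambda>"
proof (rule borel_measurable_nn_integral)
  have snd: "snd \<in> \<Lambda> \<Otimes>\<^sub>M P \<rightarrow>\<^sub>M bf_measures"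
    using measurable_compose[OF measurable_snd measurable_ident_P] by simp
  have "(\<lambda>w. (X (fst w), add_atoms (snd w) (X (fst w) ` {1..n}) (\<lambda>x. x))) \<in> \<Lambda> \<Otimes>\<^sub>M P \<rightarrow>\<^sub>M points n \<Otimes>\<^sub>M bf_measures"
    by (intro measurable_Pair measurable_add_atoms_image[OF snd] measurable_compose[OF measurable_fst X])
  from measurable_compose[OF this f]
  show "(\<lambda>(z, N). f (X z) (add_atoms N (X z ` {1..n}) (\<lambda>x. x))) \<in> borel_measurable (\<Lambda> \<Otimes>\<^sub>M P)"
    by (simp add: case_prod_beta')
qed

end

locale diffuse_poisson_random_measure = poisson_random_measure +
  assumes diffuse_mean: "diffuse \<nu>"
begin

text \<open>Diffuseness acts through this fact: a fresh point drawn from \<nu> avoids the finitely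
  many values seen before.\<close>

lemma AE_not_in_finite:
  assumes "finite J"
  shows "AE y in \<nu>. y \<notin> J"
proof -
  have "{y} \<in> null_sets \<nu>" for y
    using diffuse_mean sets_eq_imp_space_eq[OF sets_mean]
    by (auto simp: diffuse_def null_sets_def sets_mean)
  then have "(\<Union>y\<in>J. {y}) \<in> null_sets \<nu>"
    using assms by (intro null_sets_UN' countable_finite) auto
  then have "J \<in> null_sets \<nu>" by simp
  then show ?thesis by (rule AE_not_in)
qed

text \<open>The last coordinate is integrated out first, giving \<open>G\<close>, and the induction
  hypothesis turns the earlier coordinates into added atoms. N occurs in \<open>G\<close> both as
  argument and as integrator, so under the hypothesis the last integral is taken against the
  augmented measure and splits.\<close>

theorem multivariate_mecke:
  assumes "(\<lambda>(X, N). f X N) \<in> borel_measurable (points n \<Otimes>\<^sub>M bf_measures)"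
  shows "(\<integral>\<^sup>+ N. \<integral>\<^sup>+ X. f X N \<partial>PiM {1..n} (\<lambda>_. N) \<partial>P) =
    (\<integral>\<^sup>+ X. \<integral>\<^sup>+ N. f X (add_atoms N (X ` {1..n}) (\<lambda>x. x)) \<partial>P \<partial>sequential_measure \<nu> n)"
  using assms
proof (induction n arbitrary: f)
  case 0
  have undef: "(\<lambda>_. undefined) \<in> space (points 0)"
    by (simp add: space_PiM)
  have "(\<lambda>X. \<integral>\<^sup>+ N. f X (add_atoms N (X ` {1..0}) (\<lambda>x. x)) \<partial>P) \<in> borel_measurable (points 0)"
    using measurable_nn_integral_augmented[OF 0, of "\<lambda>X. X" "points 0"] by simp
  then have "(\<integral>\<^sup>+ X. \<integral>\<^sup>+ N. f X (add_atoms N (X ` {1..0}) (\<lambda>x. x)) \<partial>P \<partial>sequential_measure \<nu> 0) =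
      (\<integral>\<^sup>+ N. f (\<lambda>_. undefined) (add_atoms N {} (\<lambda>x. x)) \<partial>P)"
    using undef by (simp add: nn_integral_return)
  also have "\<dots> = (\<integral>\<^sup>+ N. f (\<lambda>_. undefined) N \<partial>P)"
    by (intro nn_integral_cong) (simp add: add_atoms_empty bf_P)
  finally show ?case
    by (simp add: PiM_empty nn_integral_count_space_finite)
next
  case (Suc n)
  note f = Suc.prems
  define h where "h X = (\<integral>\<^sup>+ N. f X (add_atoms N (X ` {1..Suc n}) (\<lambda>x. x)) \<partial>P)" for X
  have h: "h \<in> borel_measurable (points (Suc n))"
    unfolding h_def using measurable_nn_integral_augmented[OF f, of "\<lambda>X. X" "points (Suc n)"] by simp
  define G where "G X N = (\<integral>\<^sup>+ y. f (X(Suc n := y)) N \<partial>N)" for X N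
  have upd: "(\<lambda>w. ((fst (fst w))(Suc n := snd w), snd (fst w))) \<in>
      (points n \<Otimes>\<^sub>M bf_measures) \<Otimes>\<^sub>M borel \<rightarrow>\<^sub>M points (Suc n) \<Otimes>\<^sub>M (bf_measures :: 'a measure measure)"
    by (intro measurable_Pair measurable_fun_upd_points measurable_snd
        measurable_compose[OF measurable_fst measurable_fst] measurable_compose[OF measurable_fst measurable_snd])
  have "(\<lambda>w. \<integral>\<^sup>+ y. f ((fst w)(Suc n := y)) (snd w) \<partial>snd w) \<in> borel_measurable (points n \<Otimes>\<^sub>M bf_measures)"
    using measurable_compose[OF upd f]
    by (intro measurable_nn_integral_bf_measures measurable_snd) (simp add: case_prod_beta')
  then have G: "(\<lambda>(X, N). G X N) \<in> borel_measurable (points n \<Otimes>\<^sub>M bf_measures)"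
    by (simp add: G_def case_prod_beta')
  have insert: "{1..Suc n} = insert (Suc n) {1..n}"
    by auto
  have "(\<integral>\<^sup>+ N. \<integral>\<^sup>+ X. f X N \<partial>PiM {1..Suc n} (\<lambda>_. N) \<partial>P) = (\<integral>\<^sup>+ N. \<integral>\<^sup>+ X. G X N \<partial>PiM {1..n} (\<lambda>_. N) \<partial>P)"
  proof (rule nn_integral_cong)
    fix N assume N: "N \<in> space P"
    have "(\<lambda>X. f X N) \<in> borel_measurable (PiM {1..Suc n} (\<lambda>_. N))"
      using measurable_compose[OF measurable_joint_kernel[OF N] f] by simp
    then have "(\<lambda>X. f X N) \<in> borel_measurable (PiM (insert (Suc n) {1..n}) (\<lambda>_. N))"
      by (simp only: insert)
    from product_sigma_finite.product_nn_integral_insert[OF boundedly_finite_product_sigma_finite[OF bf_P[OF N]] _ _ this]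
    show "(\<integral>\<^sup>+ X. f X N \<partial>PiM {1..Suc n} (\<lambda>_. N)) = (\<integral>\<^sup>+ X. G X N \<partial>PiM {1..n} (\<lambda>_. N))"
      unfolding insert G_def by simp
  qed
  also have "\<dots> = (\<integral>\<^sup>+ X. \<integral>\<^sup>+ N. G X (add_atoms N (X ` {1..n}) (\<lambda>x. x)) \<partial>P \<partial>sequential_measure \<nu> n)"
    by (rule Suc.IH[OF G])
  also have "\<dots> = (\<integral>\<^sup>+ X. (\<integral>\<^sup>+ y. h (X(Suc n := y)) \<partial>\<nu>) + (\<Sum>x\<in>X ` {1..n}. h (X(Suc n := x))) \<partial>sequential_measure \<nu> n)"
  proof (rule nn_integral_cong)
    fix X assume "X \<in> space (sequential_measure \<nu> n)"
    then have X: "X \<in> space (points n)"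
      using sets_eq_imp_space_eq[OF sets_sequential_measure] by simp
    define J where "J = X ` {1..n}"
    have J: "finite J" by (simp add: J_def)
    have image_upd: "(X(Suc n := y)) ` {1..Suc n} = insert y J" for y
      unfolding J_def by (rule fun_upd_image_Suc)
    have sect: "(\<lambda>w. f (X(Suc n := fst w)) (snd w)) \<in> borel_measurable (borel \<Otimes>\<^sub>M bf_measures)"
    proof -
      have "(\<lambda>w. (X(Suc n := fst w), snd w)) \<in> borel \<Otimes>\<^sub>M bf_measures \<rightarrow>\<^sub>M points (Suc n) \<Otimes>\<^sub>M (bf_measures :: 'a measure measure)"
        by (intro measurable_Pair measurable_fun_upd_points measurable_const X measurable_fst measurable_snd)
      from measurable_compose[OF this f] show ?thesis by simp
    qed
    have aug: "(\<lambda>w. (fst w, add_atoms (snd w) J (\<lambda>x. x))) \<in> borel \<Otimes>\<^sub>M bf_measures \<rightarrow>\<^sub>M borel \<Otimes>\<^sub>M (bf_measures :: 'a measure measure)"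
      using J by (intro measurable_Pair measurable_add_atoms measurable_fst measurable_snd measurable_const) simp_all
    have sect_aug: "(\<lambda>(y, N). f (X(Suc n := y)) (add_atoms N J (\<lambda>x. x))) \<in> borel_measurable (borel \<Otimes>\<^sub>M bf_measures)"
      using measurable_compose[OF aug sect] by (simp add: case_prod_beta')
    have sect_y: "(\<lambda>N. f (X(Suc n := y)) (add_atoms N J (\<lambda>x. x))) \<in> borel_measurable P" for y
      using measurable_compose[OF measurable_Pair[OF measurable_const measurable_ident_P] sect_aug, of y] by simp
    have int_N: "(\<lambda>N. \<integral>\<^sup>+ y. f (X(Suc n := y)) (add_atoms N J (\<lambda>x. x)) \<partial>N) \<in> borel_measurable P"
    proof (rule measurable_nn_integral_bf_measures[OF measurable_ident_P])
      have "(\<lambda>w. (snd w, fst w)) \<in> P \<Otimes>\<^sub>M borel \<rightarrow>\<^sub>M borel \<Otimes>\<^sub>M bf_measures"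
        by (simp add: measurable_cong_sets[OF sets_pair_measure_cong[OF sets_P refl] refl])
      from measurable_compose[OF this sect_aug]
      show "(\<lambda>(N, y). f (X(Suc n := y)) (add_atoms N J (\<lambda>x. x))) \<in> borel_measurable (P \<Otimes>\<^sub>M borel)"
        by (simp add: case_prod_beta')
    qed
    have "(\<integral>\<^sup>+ N. G X (add_atoms N J (\<lambda>x. x)) \<partial>P) =
      (\<integral>\<^sup>+ N. (\<integral>\<^sup>+ y. f (X(Suc n := y)) (add_atoms N J (\<lambda>x. x)) \<partial>N) +
        (\<Sum>x\<in>J. f (X(Suc n := x)) (add_atoms N J (\<lambda>x. x))) \<partial>P)"
    proof (rule nn_integral_cong)
      fix N assume N: "N \<in> space P"
      then have "add_atoms N J (\<lambda>x. x) \<in> space bf_measures"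
        using J by (simp add: space_bf_measures boundedly_finite_add_atoms bf_P)
      then have "(\<lambda>y. f (X(Suc n := y)) (add_atoms N J (\<lambda>x. x))) \<in> borel_measurable borel"
        using measurable_compose[OF measurable_Pair[OF measurable_ident measurable_const] sect] by simp
      then show "G X (add_atoms N J (\<lambda>x. x)) = (\<integral>\<^sup>+ y. f (X(Suc n := y)) (add_atoms N J (\<lambda>x. x)) \<partial>N) +
        (\<Sum>x\<in>J. f (X(Suc n := x)) (add_atoms N J (\<lambda>x. x)))"
        using J unfolding G_def by (intro nn_integral_add_atoms boundedly_finite_sets bf_P N)
    qed
    also have "\<dots> = (\<integral>\<^sup>+ N. \<integral>\<^sup>+ y. f (X(Suc n := y)) (add_atoms N J (\<lambda>x. x)) \<partial>N \<partial>P) +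
        (\<Sum>x\<in>J. \<integral>\<^sup>+ N. f (X(Suc n := x)) (add_atoms N J (\<lambda>x. x)) \<partial>P)"
      using sect_y int_N by (subst nn_integral_add) (auto intro: nn_integral_sum)
    \<comment> \<open>A value x already in J adds no further atom, so the augmentation by J is the
      one that \<open>h\<close> prescribes for the extended point.\<close>
    also have "(\<Sum>x\<in>J. \<integral>\<^sup>+ N. f (X(Suc n := x)) (add_atoms N J (\<lambda>x. x)) \<partial>P) = (\<Sum>x\<in>J. h (X(Suc n := x)))"
      unfolding h_def image_upd by (intro sum.cong refl) (simp add: insert_absorb)
    \<comment> \<open>The one-point formula is applied with J frozen; the atom at y is therefore
      added beneath those of J.\<close>
    also have "(\<integral>\<^sup>+ N. \<integral>\<^sup>+ y. f (X(Suc n := y)) (add_atoms N J (\<lambda>x. x)) \<partial>N \<partial>P) =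
        (\<integral>\<^sup>+ y. \<integral>\<^sup>+ N. f (X(Suc n := y)) (add_atoms (add_atoms N {y} (\<lambda>x. x)) J (\<lambda>x. x)) \<partial>P \<partial>\<nu>)"
      by (rule mecke[OF sect_aug])
    \<comment> \<open>Off the null set J the two successive augmentations merge into the single one
      by \<open>insert y J\<close>.\<close>
    also have "\<dots> = (\<integral>\<^sup>+ y. h (X(Suc n := y)) \<partial>\<nu>)"
    proof (rule nn_integral_cong_AE)
      show "AE y in \<nu>. (\<integral>\<^sup>+ N. f (X(Suc n := y)) (add_atoms (add_atoms N {y} (\<lambda>x. x)) J (\<lambda>x. x)) \<partial>P) = h (X(Suc n := y))"
        using AE_not_in_finite[OF J]
      proof eventually_elim
        case (elim y)
        then show ?case
          unfolding h_def image_upd using J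
          by (intro nn_integral_cong) (simp add: add_atoms_insert bf_P)
      qed
    qed
    finally show "(\<integral>\<^sup>+ N. G X (add_atoms N (X ` {1..n}) (\<lambda>x. x)) \<partial>P) =
      (\<integral>\<^sup>+ y. h (X(Suc n := y)) \<partial>\<nu>) + (\<Sum>x\<in>X ` {1..n}. h (X(Suc n := x)))"
      by (simp only: J_def)
  qed
  also have "\<dots> = (\<integral>\<^sup>+ X. h X \<partial>sequential_measure \<nu> (Suc n))"
    by (rule nn_integral_sequential_Suc[OF h, symmetric])
  finally show ?case
    by (simp only: h_def)
qed

text \<open>For an integrand that does not depend on N, the inner expectation in the multivariate
  formula is constant because P has mass 1.\<close>

lemma moment_measure_eq_sequential: "moment_measure n P = sequential_measure \<nu> n"
proof (rule measure_eqI)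
  show "sets (moment_measure n P) = sets (sequential_measure \<nu> n)"
    by (simp only: mixture.sets_mixture[OF mixture_moment] sets_sequential_measure)
  fix B assume "B \<in> sets (moment_measure n P)"
  then have B: "B \<in> sets (points n)"
    by (simp only: mixture.sets_mixture[OF mixture_moment])
  have "emeasure (moment_measure n P) B = (\<integral>\<^sup>+ N. \<integral>\<^sup>+ X. indicator B X \<partial>PiM {1..n} (\<lambda>_. N) \<partial>P)"
    using B by (simp add: mixture.emeasure_mixture[OF mixture_moment] sets_PiM_P cong: nn_integral_cong)
  also have "\<dots> = (\<integral>\<^sup>+ X. \<integral>\<^sup>+ N. indicator B X \<partial>P \<partial>sequential_measure \<nu> n)"
    using B by (intro multivariate_mecke) (simp add: case_prod_beta')
  also have "\<dots> = emeasure (sequential_measure \<nu> n) B"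
    using B by (simp add: emeasure_space_1 sets_sequential_measure)
  finally show "emeasure (moment_measure n P) B = emeasure (sequential_measure \<nu> n) B" .
qed

end

section \<open>Expansion over partitions\<close>

text \<open>A partition of \<open>{1..n}\<close> is represented by the map sending every index to the least
  element of its cell. Unlike a numbering of the cells, this index survives the passage from
  \<open>n\<close> to \<open>n + 1\<close>.\<close>

definition least_representatives :: "nat \<Rightarrow> (nat \<Rightarrow> nat) set" where
  "least_representatives n =
    {r \<in> {1..n} \<rightarrow>\<^sub>E {1..n}. \<forall>i\<in>{1..n}. r i \<le> i \<and> r (r i) = r i}"

definition fibres :: "nat \<Rightarrow> (nat \<Rightarrow> nat) \<Rightarrow> nat set set" where
  "fibres n r = (\<lambda>k. {i \<in> {1..n}. r i = k}) ` r ` {1..n}"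

lemma finite_least_representatives: "finite (least_representatives n)"
  unfolding least_representatives_def by (intro finite_Collect_conjI disjI1) (auto intro: finite_PiE)

lemma least_representatives_0: "least_representatives 0 = {\<lambda>_. undefined}"
  by (auto simp: least_representatives_def)

text \<open>The new index \<open>Suc n\<close> either opens a cell, of which it is the least
  element, or joins an old cell named by a value of r. As it exceeds all old indices, no old least
  element changes, and restriction to \<open>{1..n}\<close> inverts the construction.\<close>

lemma least_representatives_Suc:
  "bij_betw (\<lambda>(r, k). r(Suc n := k))
    (SIGMA r:least_representatives n. insert (Suc n) (r ` {1..n})) (least_representatives (Suc n))"
proof (rule bij_betw_byWitness[where f'="\<lambda>r. (restrict r {1..n}, r (Suc n))"])
  show "\<forall>a\<in>SIGMA r:least_representatives n. insert (Suc n) (r ` {1..n}).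
      (\<lambda>r. (restrict r {1..n}, r (Suc n))) ((\<lambda>(r, k). r(Suc n := k)) a) = a"
  proof
    fix a assume "a \<in> (SIGMA r:least_representatives n. insert (Suc n) (r ` {1..n}))"
    then obtain r k where a: "a = (r, k)" and "r \<in> least_representatives n"
      by auto
    then have "r i = undefined" if "i \<notin> {1..n}" for i
      using that by (auto simp: least_representatives_def PiE_def extensional_def)
    then show "(\<lambda>r. (restrict r {1..n}, r (Suc n))) ((\<lambda>(r, k). r(Suc n := k)) a) = a"
      by (auto simp: a restrict_def fun_eq_iff)
  qed
  show "\<forall>r\<in>least_representatives (Suc n).
      (\<lambda>(r, k). r(Suc n := k)) ((\<lambda>r. (restrict r {1..n}, r (Suc n))) r) = r"
  proof
    fix r assume "r \<in> least_representatives (Suc n)"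
    then have "r i = undefined" if "i \<notin> {1..Suc n}" for i
      using that by (auto simp: least_representatives_def PiE_def extensional_def)
    then show "(\<lambda>(r, k). r(Suc n := k)) ((\<lambda>r. (restrict r {1..n}, r (Suc n))) r) = r"
      by (auto simp: restrict_def fun_eq_iff not_le)
  qed
  show "(\<lambda>(r, k). r(Suc n := k)) ` (SIGMA r:least_representatives n. insert (Suc n) (r ` {1..n}))
      \<subseteq> least_representatives (Suc n)"
  proof
    fix s assume "s \<in> (\<lambda>(r, k). r(Suc n := k)) ` (SIGMA r:least_representatives n. insert (Suc n) (r ` {1..n}))"
    then obtain r k where s: "s = r(Suc n := k)" and r: "r \<in> least_representatives n"
      and k: "k \<in> insert (Suc n) (r ` {1..n})"
      by auto
    have r': "r i \<in> {1..n}" "r i \<le> i" "r (r i) = r i" if "i \<in> {1..n}" for i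
      using r that by (auto simp: least_representatives_def)
    have undef: "r i = undefined" if "i \<notin> {1..n}" for i
      using r that by (auto simp: least_representatives_def PiE_def extensional_def)
    have k': "k = Suc n \<or> (k \<in> {1..n} \<and> r k = k)"
      using k r' by auto
    show "s \<in> least_representatives (Suc n)"
      unfolding least_representatives_def s
    proof (intro CollectI conjI ballI PiE_I)
      fix i assume "i \<in> {1..Suc n}"
      then consider "i = Suc n" | "i \<in> {1..n}" by force
      then have "(r(Suc n := k)) i \<in> {1..Suc n} \<and> (r(Suc n := k)) i \<le> i \<and>
        (r(Suc n := k)) ((r(Suc n := k)) i) = (r(Suc n := k)) i"
      proof cases
        case 1
        then show ?thesis using k' by auto
      next
        case 2
        then have "i \<noteq> Suc n" "r i \<noteq> Suc n"
          using r'(1)[OF 2] by auto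
        then show ?thesis
          using r'[OF 2] by auto
      qed
      then show "(r(Suc n := k)) i \<in> {1..Suc n}" "(r(Suc n := k)) i \<le> i"
        "(r(Suc n := k)) ((r(Suc n := k)) i) = (r(Suc n := k)) i"
        by blast+
    next
      fix i assume "i \<notin> {1..Suc n}"
      then show "(r(Suc n := k)) i = undefined"
        using undef[of i] by auto
    qed
  qed
  show "(\<lambda>r. (restrict r {1..n}, r (Suc n))) ` least_representatives (Suc n)
      \<subseteq> (SIGMA r:least_representatives n. insert (Suc n) (r ` {1..n}))"
  proof
    fix a assume "a \<in> (\<lambda>r. (restrict r {1..n}, r (Suc n))) ` least_representatives (Suc n)"
    then obtain r where a: "a = (restrict r {1..n}, r (Suc n))" and r: "r \<in> least_representatives (Suc n)"
      by auto
    have r': "r i \<in> {1..Suc n}" "r i \<le> i" "r (r i) = r i" if "i \<in> {1..Suc n}" for i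
      using r that by (auto simp: least_representatives_def)
    have r'': "r i \<in> {1..n}" if "i \<in> {1..n}" for i
      using r'(1,2)[of i] that by auto
    have "restrict r {1..n} \<in> least_representatives n"
      unfolding least_representatives_def
      using r' r'' by (auto simp: restrict_def)
    moreover have "r (Suc n) \<in> insert (Suc n) (r ` {1..n})"
    proof (cases "r (Suc n) = Suc n")
      case False
      then have "r (Suc n) \<in> {1..n}"
        using r'(1)[of "Suc n"] by auto
      moreover have "r (Suc n) = r (r (Suc n))"
        using r'(3)[of "Suc n"] by simp
      ultimately show ?thesis
        by blast
    qed simp
    ultimately show "a \<in> (SIGMA r:least_representatives n. insert (Suc n) (r ` {1..n}))"
      by (auto simp: a)
  qed
qed

text \<open>Idempotence puts \<open>r i\<close> into its own fibre, and \<open>r j \<le> j\<close>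
  makes it a lower bound there.\<close>

lemma Min_fibre:
  assumes r: "r \<in> least_representatives n" and i: "i \<in> {1..n}"
  shows "Min {j \<in> {1..n}. r j = r i} = r i"
proof (rule Min_eqI)
  show "r i \<in> {j \<in> {1..n}. r j = r i}"
    using r i by (auto simp: least_representatives_def)
  show "r i \<le> j" if "j \<in> {j \<in> {1..n}. r j = r i}" for j
  proof -
    have "\<forall>i\<in>{1..n}. r i \<le> i"
      using r by (simp add: least_representatives_def)
    then have "r j \<le> j"
      using that by blast
    then show ?thesis
      using that by simp
  qed
qed simp

lemma partition_on_fibres: "partition_on {1..n} (fibres n r)"
  by (rule partition_onI) (auto simp: fibres_def disjnt_def)

text \<open>A representative map is recovered from its fibres by taking minima, which gives
  injectivity. Conversely, sending each index to the minimum of its cell yields a map whose fibres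
  are the given cells.\<close>

lemma bij_betw_fibres: "bij_betw (fibres n) (least_representatives n) {p. partition_on {1..n} p}"
  unfolding bij_betw_def
proof
  show "inj_on (fibres n) (least_representatives n)"
  proof (rule inj_onI)
    fix r r' assume r: "r \<in> least_representatives n" and r': "r' \<in> least_representatives n"
      and eq: "fibres n r = fibres n r'"
    have "r i = r' i" if i: "i \<in> {1..n}" for i
    proof -
      have "{j \<in> {1..n}. r j = r i} \<in> fibres n r'"
        using i unfolding eq[symmetric] by (auto simp: fibres_def)
      then obtain k where k: "{j \<in> {1..n}. r j = r i} = {j \<in> {1..n}. r' j = k}"
        by (auto simp: fibres_def)
      then have "i \<in> {j \<in> {1..n}. r' j = k}"
        using i by blast
      then have "k = r' i" by simp
      then show ?thesis
        using k Min_fibre[OF r i] Min_fibre[OF r' i] by simp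
    qed
    moreover have "r \<in> extensional {1..n}" "r' \<in> extensional {1..n}"
      using r r' by (auto simp: least_representatives_def PiE_def)
    ultimately show "r = r'"
      by (intro extensionalityI)
  qed
  show "fibres n ` least_representatives n = {p. partition_on {1..n} p}"
  proof safe
    show "partition_on {1..n} (fibres n r)" for r
      by (rule partition_on_fibres)
    fix p assume p: "partition_on {1..n} p"
    have "\<forall>i\<in>{1..n}. \<exists>c. c \<in> p \<and> i \<in> c"
      using partition_onD1[OF p] by blast
    then obtain cell where cell: "\<And>i. i \<in> {1..n} \<Longrightarrow> cell i \<in> p" "\<And>i. i \<in> {1..n} \<Longrightarrow> i \<in> cell i"
      by metis
    have eq: "c = d" if "c \<in> p" "d \<in> p" "i \<in> c" "i \<in> d" for c d i
      using partition_onD2[OF p] that by (auto simp: disjoint_def)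
    have c: "c \<subseteq> {1..n}" "finite c" "c \<noteq> {}" if "c \<in> p" for c
    proof -
      show "c \<subseteq> {1..n}"
        using partition_onD1[OF p] that by blast
      then show "finite c"
        by (rule finite_subset) simp
      show "c \<noteq> {}"
        using partition_onD3[OF p] that by blast
    qed
    define r where "r = (\<lambda>i\<in>{1..n}. Min (cell i))"
    have r: "r i = Min c" if "c \<in> p" "i \<in> c" for c i
    proof -
      have "i \<in> {1..n}" using c(1)[OF that(1)] that(2) by auto
      then show ?thesis
        using eq[OF cell(1) that(1) cell(2) that(2)] by (simp add: r_def)
    qed
    have r_cell: "r i \<in> cell i" "r i \<le> i" if "i \<in> {1..n}" for i
      using r[OF cell[OF that]] c(2,3)[OF cell(1)[OF that]] cell(2)[OF that] by simp_all
    have "r \<in> least_representatives n"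
      unfolding least_representatives_def
    proof (intro CollectI conjI ballI PiE_I)
      fix i assume i: "i \<in> {1..n}"
      show "r i \<in> {1..n}" "r i \<le> i"
        using r_cell[OF i] c(1)[OF cell(1)[OF i]] by auto
      show "r (r i) = r i"
        using r[OF cell(1)[OF i] r_cell(1)[OF i]] r[OF cell[OF i]] by simp
    qed (auto simp: r_def)
    moreover have "fibres n r = p"
    proof -
      have fibre: "{j \<in> {1..n}. r j = r i} = d" if "d \<in> p" "i \<in> d" for d i
      proof -
        have "j \<in> d" if j: "j \<in> {1..n}" "r j = r i" for j
        proof -
          have "r j \<in> cell j" "r j \<in> d"
            using r_cell[OF j(1)] j(2) r[OF \<open>d \<in> p\<close> \<open>i \<in> d\<close>] c(2,3)[OF \<open>d \<in> p\<close>] by simp_all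
          then have "cell j = d"
            using eq cell(1)[OF j(1)] \<open>d \<in> p\<close> by blast
          then show ?thesis
            using cell(2)[OF j(1)] by simp
        qed
        then show ?thesis
          using c(1)[OF \<open>d \<in> p\<close>] r[OF \<open>d \<in> p\<close>] \<open>i \<in> d\<close> by auto
      qed
      show ?thesis
      proof safe
        fix d assume "d \<in> fibres n r"
        then obtain i where "i \<in> {1..n}" "d = {j \<in> {1..n}. r j = r i}"
          by (auto simp: fibres_def)
        then show "d \<in> p"
          using fibre[OF cell] cell(1) by simp
      next
        fix d assume d: "d \<in> p"
        then obtain i where i: "i \<in> d" using c(3) by blast
        then have "i \<in> {1..n}" using c(1)[OF d] by auto
        then show "d \<in> fibres n r"
          using fibre[OF d i] by (auto simp: fibres_def image_iff)
      qed
    qed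
    ultimately show "p \<in> fibres n ` least_representatives n"
      by blast
  qed
qed

section \<open>Numbered cells and the points they encode\<close>

lemma numbering_cell:
  assumes "partition_on {1..n} p" "numbering p c" "i \<in> {1..n}"
  shows "\<exists>!j. j \<in> {1..card p} \<and> i \<in> c j"
proof -
  obtain d where d: "d \<in> p" "i \<in> d"
    using partition_onD1[OF assms(1)] assms(3) by blast
  have c: "bij_betw c {1..card p} p"
    using assms(2) by (simp add: numbering_def)
  have "d \<in> c ` {1..card p}"
    using d(1) bij_betw_imp_surj_on[OF c] by simp
  then obtain j where j: "j \<in> {1..card p}" "c j = d"
    by blast
  moreover have "j' = j" if "j' \<in> {1..card p}" "i \<in> c j'" for j'
  proof -
    have "c j' \<in> p" using c that(1) by (auto simp: bij_betw_def)
    then have "c j' = d"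
      using partition_onD2[OF assms(1)] d that(2) by (auto simp: disjoint_def)
    then show ?thesis
      using c j that(1) by (auto simp: bij_betw_def dest: inj_onD)
  qed
  ultimately show ?thesis
    using d(2) by auto
qed

lemma numbering_cell_nonempty:
  assumes "partition_on {1..n} p" "numbering p c" "j \<in> {1..card p}"
  obtains i where "i \<in> {1..n}" "i \<in> c j"
proof -
  have "c j \<in> p"
    using assms(2,3) by (auto simp: numbering_def bij_betw_def)
  then have "c j \<noteq> {}" "c j \<subseteq> {1..n}"
    using partition_onD1[OF assms(1)] partition_onD3[OF assms(1)] by auto
  then show thesis
    using that by blast
qed

lemma point_of_eq:
  assumes "partition_on {1..n} p" "numbering p c" "i \<in> {1..n}" "j \<in> {1..card p}" "i \<in> c j"
  shows "point_of n p c Xs i = Xs j"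
proof -
  have "(THE j. j \<in> {1..card p} \<and> i \<in> c j) = j"
    using numbering_cell[OF assms(1-3)] assms(4,5) by (intro the1_equality) auto
  then show ?thesis
    using assms(3) by (simp add: point_of_def)
qed

lemma point_of_image:
  assumes "partition_on {1..n} p" "numbering p c"
  shows "point_of n p c Xs ` {1..n} = Xs ` {1..card p}"
proof safe
  fix i assume i: "i \<in> {1..n}"
  then obtain j where "j \<in> {1..card p}" "i \<in> c j"
    using numbering_cell[OF assms i] by auto
  then show "point_of n p c Xs i \<in> Xs ` {1..card p}"
    using point_of_eq[OF assms i, of j Xs] by auto
next
  fix j assume j: "j \<in> {1..card p}"
  then obtain i where "i \<in> {1..n}" "i \<in> c j"
    using numbering_cell_nonempty[OF assms] by blast
  then show "Xs j \<in> point_of n p c Xs ` {1..n}"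
    using point_of_eq[OF assms _ j] by (metis imageI)
qed

lemma encodes_image:
  assumes enc: "encodes n X p c Xs" and num: "numbering p c"
  shows "X ` {1..n} = Xs ` {1..card p}"
proof -
  have p: "partition_on {1..n} p"
    and X: "\<And>i j. i \<in> {1..n} \<Longrightarrow> j \<in> {1..card p} \<Longrightarrow> X i = Xs j \<longleftrightarrow> i \<in> c j"
    using enc by (auto simp: encodes_def)
  have "X i = point_of n p c Xs i" if i: "i \<in> {1..n}" for i
  proof -
    obtain j where "j \<in> {1..card p}" "i \<in> c j"
      using numbering_cell[OF p num i] by auto
    then show ?thesis
      using X[OF i, of j] point_of_eq[OF p num i, of j Xs] by simp
  qed
  then show ?thesis
    using point_of_image[OF p num, of Xs] by (metis (no_types, lifting) image_cong)
qed

text \<open>\<open>encodes\<close> demands distinct values \<open>Xs j\<close>, so the numbered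
  atoms are counted once each and form the set of values of X.\<close>

lemma add_atoms_encodes:
  assumes "encodes n X p c Xs" "numbering p c"
  shows "add_atoms \<mu> {1..card p} Xs = add_atoms \<mu> (X ` {1..n}) (\<lambda>x. x)"
  unfolding encodes_image[OF assms]
  using assms(1) by (intro add_atoms_reindex[symmetric]) (auto simp: encodes_def)

lemma measurable_point_of:
  assumes "partition_on {1..n} p" "numbering p c"
  shows "point_of n p c \<in> PiM {1..card p} (\<lambda>_. M) \<rightarrow>\<^sub>M PiM {1..n} (\<lambda>_. M)"
  unfolding point_of_def
proof (rule measurable_restrict)
  fix i assume "i \<in> {1..n}"
  then have "(THE j. j \<in> {1..card p} \<and> i \<in> c j) \<in> {1..card p}"
    using theI'[OF numbering_cell[OF assms]] by auto
  then show "(\<lambda>Xs. Xs (THE j. j \<in> {1..card p} \<and> i \<in> c j)) \<in> PiM {1..card p} (\<lambda>_. M) \<rightarrow>\<^sub>M M"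
    by (rule measurable_component_singleton)
qed

text \<open>A box pulls back to a box with its sides permuted, and the product of the side masses is
  unchanged. For \<sigma>-finite factors the masses of boxes determine the product measure.\<close>

lemma distr_PiM_reindex_sigma_finite:
  assumes "sigma_finite_measure M" "finite I" and h: "bij_betw h I J"
  shows "distr (PiM J (\<lambda>_. M)) (PiM I (\<lambda>_. M)) (\<lambda>Z. \<lambda>i\<in>I. Z (h i)) = PiM I (\<lambda>_. M)"
proof -
  interpret product_sigma_finite "\<lambda>_. M"
    using assms(1) by (simp add: product_sigma_finite_def)
  have J: "finite J"
    using assms(2) h by (simp add: bij_betw_finite)
  have hJ: "i \<in> I \<Longrightarrow> h i \<in> J" for i
    using h by (auto simp: bij_betw_def)
  have meas: "(\<lambda>Z. \<lambda>i\<in>I. Z (h i)) \<in> PiM J (\<lambda>_. M) \<rightarrow>\<^sub>M PiM I (\<lambda>_. M)"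
    using hJ by (intro measurable_restrict measurable_component_singleton)
  have inv: "the_inv_into I h (h i) = i" if "i \<in> I" for i
    using h that by (auto simp: bij_betw_def the_inv_into_f_f)
  show ?thesis
  proof (rule PiM_eqI[OF assms(2)])
    fix A assume A: "\<And>i. i \<in> I \<Longrightarrow> A i \<in> sets M"
    have A': "A (the_inv_into I h j) \<in> sets M" if "j \<in> J" for j
      using that h A inv by (auto simp: bij_betw_def)
    have "(\<lambda>Z. \<lambda>i\<in>I. Z (h i)) -` (Pi\<^sub>E I A) \<inter> space (PiM J (\<lambda>_. M)) = (\<Pi>\<^sub>E j\<in>J. A (the_inv_into I h j))"
    proof (intro set_eqI iffI)
      fix Z assume "Z \<in> (\<lambda>Z. \<lambda>i\<in>I. Z (h i)) -` (Pi\<^sub>E I A) \<inter> space (PiM J (\<lambda>_. M))"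
      then have Z: "Z \<in> space (PiM J (\<lambda>_. M))" and "(\<lambda>i\<in>I. Z (h i)) \<in> Pi\<^sub>E I A"
        by auto
      then have "Z (h i) \<in> A i" if "i \<in> I" for i
        using that by (auto simp: PiE_iff)
      then show "Z \<in> (\<Pi>\<^sub>E j\<in>J. A (the_inv_into I h j))"
        using Z h inv by (auto simp: space_PiM PiE_iff bij_betw_def)
    next
      fix Z assume Z: "Z \<in> (\<Pi>\<^sub>E j\<in>J. A (the_inv_into I h j))"
      have "Z (h i) \<in> A i" if "i \<in> I" for i
        using PiE_mem[OF Z hJ[OF that]] inv[OF that] by simp
      moreover have "Z \<in> space (PiM J (\<lambda>_. M))"
        using Z sets.sets_into_space[OF A'] by (fastforce simp: space_PiM PiE_iff)
      ultimately show "Z \<in> (\<lambda>Z. \<lambda>i\<in>I. Z (h i)) -` (Pi\<^sub>E I A) \<inter> space (PiM J (\<lambda>_. M))"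
        by auto
    qed
    then have "emeasure (distr (PiM J (\<lambda>_. M)) (PiM I (\<lambda>_. M)) (\<lambda>Z. \<lambda>i\<in>I. Z (h i))) (Pi\<^sub>E I A) =
        emeasure (PiM J (\<lambda>_. M)) (\<Pi>\<^sub>E j\<in>J. A (the_inv_into I h j))"
      using A assms(2) by (subst emeasure_distr[OF meas]) (auto intro!: sets_PiM_I_finite)
    also have "\<dots> = (\<Prod>j\<in>J. emeasure M (A (the_inv_into I h j)))"
      using A' J by (intro emeasure_PiM)
    also have "\<dots> = (\<Prod>i\<in>I. emeasure M (A i))"
      by (subst prod.reindex_bij_betw[OF h, symmetric]) (simp add: inv)
    finally show "emeasure (distr (PiM J (\<lambda>_. M)) (PiM I (\<lambda>_. M)) (\<lambda>Z. \<lambda>i\<in>I. Z (h i))) (Pi\<^sub>E I A) =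
        (\<Prod>i\<in>I. emeasure M (A i))" .
  qed simp
qed

text \<open>A cell can be named by its number j or by its least element. The map \<open>h\<close>,
  taking j to the minimum of \<open>c j\<close>, is a bijection between the two namings, so the
  integrals differ by a renaming of coordinates, whatever the numbering.\<close>

lemma nn_integral_point_of_fibres:
  assumes "sigma_finite_measure M" and r: "r \<in> least_representatives n"
    and num: "numbering (fibres n r) c" and f: "f \<in> borel_measurable (PiM {1..n} (\<lambda>_. M))"
  shows "(\<integral>\<^sup>+ Xs. f (point_of n (fibres n r) c Xs) \<partial>PiM {1..card (fibres n r)} (\<lambda>_. M)) =
    (\<integral>\<^sup>+ Z. f (\<lambda>i\<in>{1..n}. Z (r i)) \<partial>PiM (r ` {1..n}) (\<lambda>_. M))"
proof -
  define p where "p = fibres n r"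
  define h where "h j = Min (c j)" for j
  have p: "partition_on {1..n} p"
    unfolding p_def by (rule partition_on_fibres)
  have num: "numbering p c"
    using num by (simp add: p_def)
  have h_eq: "h j = r i" if "j \<in> {1..card p}" "i \<in> c j" for i j
  proof -
    have "c j \<in> p"
      using num that(1) by (auto simp: numbering_def bij_betw_def)
    then obtain k where "c j = {i \<in> {1..n}. r i = k}"
      by (auto simp: p_def fibres_def)
    then have "c j = {j \<in> {1..n}. r j = r i}" "i \<in> {1..n}"
      using that(2) by auto
    then show ?thesis
      unfolding h_def using Min_fibre[OF r, of i] by simp
  qed
  have h: "bij_betw h {1..card p} (r ` {1..n})"
    unfolding bij_betw_def
  proof
    show "inj_on h {1..card p}"
    proof (rule inj_onI)
      fix j j' assume j: "j \<in> {1..card p}" "j' \<in> {1..card p}" "h j = h j'"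
      obtain i where i: "i \<in> {1..n}" "i \<in> c j"
        using numbering_cell_nonempty[OF p num j(1)] .
      obtain i' where i': "i' \<in> {1..n}" "i' \<in> c j'"
        using numbering_cell_nonempty[OF p num j(2)] .
      have "r i = r i'"
        using j h_eq[OF j(1) i(2)] h_eq[OF j(2) i'(2)] by simp
      moreover have "c j' \<in> p"
        using num j(2) by (auto simp: numbering_def bij_betw_def)
      then obtain k where "c j' = {i \<in> {1..n}. r i = k}"
        by (auto simp: p_def fibres_def)
      ultimately have "i \<in> c j'"
        using i(1) i'(2) by simp
      then show "j = j'"
        using numbering_cell[OF p num i(1)] i(2) j by blast
    qed
    show "h ` {1..card p} = r ` {1..n}"
    proof safe
      fix j assume j: "j \<in> {1..card p}"
      then obtain i where "i \<in> {1..n}" "i \<in> c j"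
        using numbering_cell_nonempty[OF p num] by blast
      then show "h j \<in> r ` {1..n}"
        using h_eq[OF j] by auto
    next
      fix i assume "i \<in> {1..n}"
      then obtain j where "j \<in> {1..card p}" "i \<in> c j"
        using numbering_cell[OF p num] by blast
      then show "r i \<in> h ` {1..card p}"
        using h_eq[of j i] by (metis imageI)
    qed
  qed
  have point: "point_of n p c (\<lambda>j\<in>{1..card p}. Z (h j)) = (\<lambda>i\<in>{1..n}. Z (r i))" for Z :: "nat \<Rightarrow> 'a"
  proof
    fix i
    show "point_of n p c (\<lambda>j\<in>{1..card p}. Z (h j)) i = (\<lambda>i\<in>{1..n}. Z (r i)) i"
    proof (cases "i \<in> {1..n}")
      case True
      then obtain j where "j \<in> {1..card p}" "i \<in> c j"
        using numbering_cell[OF p num] by blast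
      then show ?thesis
        using True by (simp add: point_of_eq[OF p num True] h_eq)
    next
      case False
      then show ?thesis by (simp only: point_of_def restrict_apply if_False)
    qed
  qed
  have f_point: "(\<lambda>Xs. f (point_of n p c Xs)) \<in> borel_measurable (PiM {1..card p} (\<lambda>_. M))"
    using measurable_compose[OF measurable_point_of[OF p num] f] .
  have meas: "(\<lambda>Z. \<lambda>j\<in>{1..card p}. Z (h j)) \<in> PiM (r ` {1..n}) (\<lambda>_. M) \<rightarrow>\<^sub>M PiM {1..card p} (\<lambda>_. M)"
    using bij_betw_apply[OF h] by (intro measurable_restrict measurable_component_singleton)
  have "(\<integral>\<^sup>+ Xs. f (point_of n p c Xs) \<partial>PiM {1..card p} (\<lambda>_. M)) =
    (\<integral>\<^sup>+ Z. f (point_of n p c (\<lambda>j\<in>{1..card p}. Z (h j))) \<partial>PiM (r ` {1..n}) (\<lambda>_. M))"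
    using f_point
    by (subst distr_PiM_reindex_sigma_finite[OF assms(1) _ h, symmetric], simp,
        intro nn_integral_distr[OF meas]) simp
  then show ?thesis
    by (simp add: point p_def[symmetric])
qed

section \<open>Expansion of the sequential measure over representative maps\<close>

context diffuse_poisson_random_measure
begin

lemma sigma_finite_mean: "sigma_finite_measure \<nu>"
  by (rule boundedly_finite_sigma_finite[OF bf_mean])

lemma product_sigma_finite_mean: "product_sigma_finite (\<lambda>_. \<nu>)"
  by (rule boundedly_finite_product_sigma_finite[OF bf_mean])

lemma sets_PiM_mean: "sets (PiM I (\<lambda>_. \<nu>)) = sets (PiM I (\<lambda>_. borel))"
  by (rule sets_PiM_boundedly_finite[OF bf_mean])

text \<open>For each pair of indices, integrating the tie event innermost over one coordinate with
  the other fixed leaves the \<nu>-mass of a single point, which is 0. There are finitely many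
  pairs.\<close>

lemma AE_PiM_inj_on:
  assumes J: "finite J"
  shows "AE Z in PiM J (\<lambda>_. \<nu>). inj_on Z J"
proof -
  interpret product_sigma_finite "\<lambda>_. \<nu>"
    by (rule product_sigma_finite_mean)
  have "AE Z in PiM J (\<lambda>_. \<nu>). Z j \<noteq> Z k" if jk: "j \<in> J" "k \<in> J" "j \<noteq> k" for j k
  proof -
    define I where "I = J - {j}"
    have I: "finite I" "j \<notin> I" "insert j I = J" "k \<in> I"
      using J jk by (auto simp: I_def)
    have comp: "(\<lambda>Z. Z i) \<in> PiM J (\<lambda>_. \<nu>) \<rightarrow>\<^sub>M borel" if "i \<in> J" for i
      using measurable_component_singleton[OF that, of "\<lambda>_. \<nu>"]
      by (simp add: measurable_cong_sets[OF refl sets_mean])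
    have D: "{Z \<in> space (PiM J (\<lambda>_. \<nu>)). Z j = Z k} \<in> sets (PiM J (\<lambda>_. \<nu>))" (is "?D \<in> _")
      using comp[OF jk(1)] comp[OF jk(2)] by measurable
    have "emeasure (PiM J (\<lambda>_. \<nu>)) ?D = (\<integral>\<^sup>+ Z. indicator ?D Z \<partial>PiM (insert j I) (\<lambda>_. \<nu>))"
      using D by (simp add: I(3))
    also have "\<dots> = (\<integral>\<^sup>+ Z. \<integral>\<^sup>+ y. indicator ?D (Z(j := y)) \<partial>\<nu> \<partial>PiM I (\<lambda>_. \<nu>))"
      using I D by (intro product_nn_integral_insert) simp_all
    also have "\<dots> = (\<integral>\<^sup>+ Z. 0 \<partial>PiM I (\<lambda>_. \<nu>))"
    proof (rule nn_integral_cong)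
      fix Z :: "'b \<Rightarrow> 'a"
      have "(\<integral>\<^sup>+ y. indicator ?D (Z(j := y)) \<partial>\<nu>) = (\<integral>\<^sup>+ y. 0 \<partial>\<nu>)"
      proof (rule nn_integral_cong_AE)
        show "AE y in \<nu>. indicator ?D (Z(j := y)) = (0::ennreal)"
          using AE_not_in_finite[of "{Z k}"] jk by (auto simp: indicator_def elim!: eventually_mono)
      qed
      then show "(\<integral>\<^sup>+ y. indicator ?D (Z(j := y)) \<partial>\<nu>) = 0"
        by simp
    qed
    finally have "?D \<in> null_sets (PiM J (\<lambda>_. \<nu>))"
      using D by (simp add: null_sets_def)
    then show ?thesis
      by (rule AE_I') auto
  qed
  then have "AE Z in PiM J (\<lambda>_. \<nu>). \<forall>j\<in>J. \<forall>k\<in>J. j \<noteq> k \<longrightarrow> Z j \<noteq> Z k"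
    using J by (intro AE_finite_allI) (auto simp: AE_conj_iff)
  then show ?thesis
    by (auto simp: inj_on_def elim!: eventually_mono)
qed

text \<open>The recursion sums over the set of previous values, the combinatorial expansion over
  representatives of previous cells. For almost every Z these correspond one to one, and each step
  then mirrors the extension of a representative map by one index.\<close>

lemma nn_integral_sequential_least_representatives:
  assumes "f \<in> borel_measurable (points n)"
  shows "(\<integral>\<^sup>+ X. f X \<partial>sequential_measure \<nu> n) =
    (\<Sum>r\<in>least_representatives n. \<integral>\<^sup>+ Z. f (\<lambda>i\<in>{1..n}. Z (r i)) \<partial>PiM (r ` {1..n}) (\<lambda>_. \<nu>))"
  using assms
proof (induction n arbitrary: f)
  case 0
  have "(\<lambda>_. undefined) \<in> space (points 0)"
    by (simp add: space_PiM)
  then show ?case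
    using 0 by (simp add: least_representatives_0 nn_integral_return restrict_def
        PiM_empty nn_integral_count_space_finite)
next
  case (Suc n)
  interpret product_sigma_finite "\<lambda>_. \<nu>"
    by (rule product_sigma_finite_mean)
  note f = Suc.prems
  define G where "G r = (\<integral>\<^sup>+ Z. f (\<lambda>i\<in>{1..Suc n}. Z (r i)) \<partial>PiM (r ` {1..Suc n}) (\<lambda>_. \<nu>))" for r :: "nat \<Rightarrow> nat"
  define F where "F X = (\<integral>\<^sup>+ y. f (X(Suc n := y)) \<partial>\<nu>) + (\<Sum>x\<in>X ` {1..n}. f (X(Suc n := x)))" for X
  have upd: "(\<lambda>w. (fst w)(Suc n := snd w)) \<in> points n \<Otimes>\<^sub>M borel \<rightarrow>\<^sub>M (points (Suc n) :: (nat \<Rightarrow> 'a) measure)"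
    by (intro measurable_fun_upd_points measurable_fst measurable_snd)
  have F: "F \<in> borel_measurable (points n)"
  proof -
    have "(\<lambda>X. \<integral>\<^sup>+ y. f (X(Suc n := y)) \<partial>add_atoms \<nu> (X ` {1..n}) (\<lambda>x. x)) \<in> borel_measurable (points n)"
      using measurable_compose[OF upd f]
      by (intro measurable_nn_integral_bf_measures[OF measurable_add_atoms_mean]) (simp only: case_prod_beta')
    moreover have "(\<integral>\<^sup>+ y. f (X(Suc n := y)) \<partial>add_atoms \<nu> (X ` {1..n}) (\<lambda>x. x)) = F X"
      if "X \<in> space (points n)" for X
    proof -
      have "(\<lambda>y. X(Suc n := y)) \<in> borel \<rightarrow>\<^sub>M points (Suc n)"
        by (intro measurable_fun_upd_points measurable_const[OF that]) simp
      note meas = measurable_compose[OF this f]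
      show ?thesis
        unfolding F_def by (rule nn_integral_add_atoms[OF sets_mean _ meas]) simp
    qed
    ultimately show ?thesis
      by (simp cong: measurable_cong)
  qed
  have step: "(\<integral>\<^sup>+ Z. F (\<lambda>i\<in>{1..n}. Z (r i)) \<partial>PiM (r ` {1..n}) (\<lambda>_. \<nu>)) =
      (\<Sum>k\<in>insert (Suc n) (r ` {1..n}). G (r(Suc n := k)))"
    if r: "r \<in> least_representatives n" for r
  proof -
    define J where "J = r ` {1..n}"
    have J: "finite J" "Suc n \<notin> J"
      using r by (auto simp: J_def least_representatives_def)
    have X_meas: "(\<lambda>Z. \<lambda>i\<in>{1..n}. Z (r i)) \<in> PiM J (\<lambda>_. \<nu>) \<rightarrow>\<^sub>M points n"
      unfolding measurable_cong_sets[OF sets_PiM_mean refl] J_def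
      by (intro measurable_restrict measurable_component_singleton imageI)
    have comp: "(\<lambda>Z. Z k) \<in> PiM J (\<lambda>_. \<nu>) \<rightarrow>\<^sub>M borel" if "k \<in> J" for k
      unfolding measurable_cong_sets[OF sets_PiM_mean refl]
      using that by (rule measurable_component_singleton)
    have image: "(r(Suc n := k)) ` {1..Suc n} = insert k J" for k
      unfolding J_def by (rule fun_upd_image_Suc)
    \<comment> \<open>The drawn point becomes a fresh coordinate \<open>Suc n\<close> of the
      product, its cell being represented by its own index.\<close>
    have new: "(\<integral>\<^sup>+ Z. \<integral>\<^sup>+ y. f ((\<lambda>i\<in>{1..n}. Z (r i))(Suc n := y)) \<partial>\<nu> \<partial>PiM J (\<lambda>_. \<nu>)) = G (r(Suc n := Suc n))"
    proof -
      have rS: "(r(Suc n := Suc n)) i \<in> insert (Suc n) J" if "i \<in> {1..Suc n}" for i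
        using image[of "Suc n"] that by blast
      have "(\<lambda>Z. \<lambda>i\<in>{1..Suc n}. Z ((r(Suc n := Suc n)) i)) \<in> PiM (insert (Suc n) J) (\<lambda>_. \<nu>) \<rightarrow>\<^sub>M points (Suc n)"
        unfolding measurable_cong_sets[OF sets_PiM_mean refl]
        using rS by (intro measurable_restrict measurable_component_singleton)
      note meas = measurable_compose[OF this f]
      have r_neq: "r i \<noteq> Suc n" if "1 \<le> i" "i \<le> n" for i
        using J(2) that unfolding J_def by (metis atLeastAtMost_iff imageI)
      have "G (r(Suc n := Suc n)) = (\<integral>\<^sup>+ Z. \<integral>\<^sup>+ y. f (\<lambda>i\<in>{1..Suc n}. (Z(Suc n := y)) ((r(Suc n := Suc n)) i)) \<partial>\<nu> \<partial>PiM J (\<lambda>_. \<nu>))"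
        unfolding G_def image by (rule product_nn_integral_insert[OF J meas])
      also have "\<dots> = (\<integral>\<^sup>+ Z. \<integral>\<^sup>+ y. f ((\<lambda>i\<in>{1..n}. Z (r i))(Suc n := y)) \<partial>\<nu> \<partial>PiM J (\<lambda>_. \<nu>))"
      proof (intro nn_integral_cong arg_cong[where f=f])
        fix Z :: "nat \<Rightarrow> 'a" and y
        show "(\<lambda>i\<in>{1..Suc n}. (Z(Suc n := y)) ((r(Suc n := Suc n)) i)) = (\<lambda>i\<in>{1..n}. Z (r i))(Suc n := y)"
          using r_neq by (auto simp: fun_eq_iff restrict_def)
      qed
      finally show ?thesis by simp
    qed
    \<comment> \<open>A repetition of the value at k introduces no new coordinate, so both sides are
      integrals over the same product.\<close>
    have old: "(\<integral>\<^sup>+ Z. f ((\<lambda>i\<in>{1..n}. Z (r i))(Suc n := Z k)) \<partial>PiM J (\<lambda>_. \<nu>)) = G (r(Suc n := k))"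
      if "k \<in> J" for k
    proof -
      have "(\<lambda>i\<in>{1..Suc n}. Z ((r(Suc n := k)) i)) = (\<lambda>i\<in>{1..n}. Z (r i))(Suc n := Z k)" for Z :: "nat \<Rightarrow> 'a"
        by (auto simp: fun_eq_iff restrict_def)
      then show ?thesis
        unfolding G_def image using that by (simp add: insert_absorb)
    qed
    have "(\<integral>\<^sup>+ Z. F (\<lambda>i\<in>{1..n}. Z (r i)) \<partial>PiM J (\<lambda>_. \<nu>)) =
        (\<integral>\<^sup>+ Z. (\<integral>\<^sup>+ y. f ((\<lambda>i\<in>{1..n}. Z (r i))(Suc n := y)) \<partial>\<nu>) +
          (\<Sum>k\<in>J. f ((\<lambda>i\<in>{1..n}. Z (r i))(Suc n := Z k))) \<partial>PiM J (\<lambda>_. \<nu>))"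
    proof (rule nn_integral_cong_AE)
      show "AE Z in PiM J (\<lambda>_. \<nu>). F (\<lambda>i\<in>{1..n}. Z (r i)) =
          (\<integral>\<^sup>+ y. f ((\<lambda>i\<in>{1..n}. Z (r i))(Suc n := y)) \<partial>\<nu>) +
          (\<Sum>k\<in>J. f ((\<lambda>i\<in>{1..n}. Z (r i))(Suc n := Z k)))"
        using AE_PiM_inj_on[OF J(1)]
      proof eventually_elim
        case (elim Z)
        have "(\<lambda>i\<in>{1..n}. Z (r i)) ` {1..n} = Z ` J"
          by (auto simp: J_def image_image)
        then show ?case
          using elim by (simp add: F_def sum.reindex)
      qed
    qed
    also have "\<dots> = (\<integral>\<^sup>+ Z. \<integral>\<^sup>+ y. f ((\<lambda>i\<in>{1..n}. Z (r i))(Suc n := y)) \<partial>\<nu> \<partial>PiM J (\<lambda>_. \<nu>)) +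
        (\<Sum>k\<in>J. \<integral>\<^sup>+ Z. f ((\<lambda>i\<in>{1..n}. Z (r i))(Suc n := Z k)) \<partial>PiM J (\<lambda>_. \<nu>))"
    proof (subst nn_integral_add)
      have "(\<lambda>w. (\<lambda>i\<in>{1..n}. (fst w) (r i))(Suc n := snd w)) \<in> PiM J (\<lambda>_. \<nu>) \<Otimes>\<^sub>M \<nu> \<rightarrow>\<^sub>M points (Suc n)"
        by (intro measurable_fun_upd_points measurable_compose[OF measurable_fst X_meas])
          (simp add: measurable_cong_sets[OF refl sets_mean, symmetric])
      from measurable_compose[OF this f]
      show "(\<lambda>Z. \<integral>\<^sup>+ y. f ((\<lambda>i\<in>{1..n}. Z (r i))(Suc n := y)) \<partial>\<nu>) \<in> borel_measurable (PiM J (\<lambda>_. \<nu>))"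
        by (intro sigma_finite_measure.borel_measurable_nn_integral[OF sigma_finite_mean]) (simp only: case_prod_beta')
      have atom_meas: "(\<lambda>Z. f ((\<lambda>i\<in>{1..n}. Z (r i))(Suc n := Z k))) \<in> borel_measurable (PiM J (\<lambda>_. \<nu>))"
        if "k \<in> J" for k
        using measurable_compose[OF measurable_fun_upd_points[OF X_meas comp[OF that]] f] .
      then show "(\<lambda>Z. \<Sum>k\<in>J. f ((\<lambda>i\<in>{1..n}. Z (r i))(Suc n := Z k))) \<in> borel_measurable (PiM J (\<lambda>_. \<nu>))"
        by (rule borel_measurable_sum)
      show "(\<integral>\<^sup>+ Z. \<integral>\<^sup>+ y. f ((\<lambda>i\<in>{1..n}. Z (r i))(Suc n := y)) \<partial>\<nu> \<partial>PiM J (\<lambda>_. \<nu>)) +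
          (\<integral>\<^sup>+ Z. (\<Sum>k\<in>J. f ((\<lambda>i\<in>{1..n}. Z (r i))(Suc n := Z k))) \<partial>PiM J (\<lambda>_. \<nu>)) =
        (\<integral>\<^sup>+ Z. \<integral>\<^sup>+ y. f ((\<lambda>i\<in>{1..n}. Z (r i))(Suc n := y)) \<partial>\<nu> \<partial>PiM J (\<lambda>_. \<nu>)) +
          (\<Sum>k\<in>J. \<integral>\<^sup>+ Z. f ((\<lambda>i\<in>{1..n}. Z (r i))(Suc n := Z k)) \<partial>PiM J (\<lambda>_. \<nu>))"
        using atom_meas by (subst nn_integral_sum) simp_all
    qed
    also have "\<dots> = G (r(Suc n := Suc n)) + (\<Sum>k\<in>J. G (r(Suc n := k)))"
      using old new by simp
    also have "\<dots> = (\<Sum>k\<in>insert (Suc n) J. G (r(Suc n := k)))"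
      using J by simp
    finally show ?thesis
      by (simp only: J_def)
  qed
  have "(\<integral>\<^sup>+ X. f X \<partial>sequential_measure \<nu> (Suc n)) = (\<integral>\<^sup>+ X. F X \<partial>sequential_measure \<nu> n)"
    unfolding F_def by (rule nn_integral_sequential_Suc[OF f])
  also have "\<dots> = (\<Sum>r\<in>least_representatives n. \<Sum>k\<in>insert (Suc n) (r ` {1..n}). G (r(Suc n := k)))"
    unfolding Suc.IH[OF F] by (intro sum.cong refl step)
  also have "\<dots> = (\<Sum>(r, k)\<in>(SIGMA r:least_representatives n. insert (Suc n) (r ` {1..n})). G (r(Suc n := k)))"
    by (intro sum.Sigma finite_least_representatives) simp
  also have "\<dots> = (\<Sum>r\<in>least_representatives (Suc n). G r)"
    using sum.reindex_bij_betw[OF least_representatives_Suc, of G n] by (simp add: case_prod_beta')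
  finally show ?case
    by (simp only: G_def)
qed

lemma nn_integral_sequential_partitions:
  assumes f: "f \<in> borel_measurable (points n)"
    and cells: "\<And>p. partition_on {1..n} p \<Longrightarrow> numbering p (C p)"
  shows "(\<integral>\<^sup>+ X. f X \<partial>sequential_measure \<nu> n) =
    (\<Sum>p | partition_on {1..n} p. \<integral>\<^sup>+ Xs. f (point_of n p (C p) Xs) \<partial>PiM {1..card p} (\<lambda>_. \<nu>))"
proof -
  have "f \<in> borel_measurable (PiM {1..n} (\<lambda>_. \<nu>))"
    using f by (simp add: measurable_cong_sets[OF sets_PiM_mean refl])
  then have "(\<integral>\<^sup>+ X. f X \<partial>sequential_measure \<nu> n) = (\<Sum>r\<in>least_representatives n.
      \<integral>\<^sup>+ Xs. f (point_of n (fibres n r) (C (fibres n r)) Xs) \<partial>PiM {1..card (fibres n r)} (\<lambda>_. \<nu>))"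
    unfolding nn_integral_sequential_least_representatives[OF f]
    by (intro sum.cong refl nn_integral_point_of_fibres[symmetric] sigma_finite_mean cells partition_on_fibres)
  also have "\<dots> = (\<Sum>p | partition_on {1..n} p. \<integral>\<^sup>+ Xs. f (point_of n p (C p) Xs) \<partial>PiM {1..card p} (\<lambda>_. \<nu>))"
    by (rule sum.reindex_bij_betw[OF bij_betw_fibres])
  finally show ?thesis .
qed

end

section \<open>Conditional laws\<close>

text \<open>Applied to the norm of g, the hypothesis bounds every summand by a finite integral. All
  positive and negative parts then have finite integrals, and the two sums can be subtracted in the
  reals.\<close>

lemma integral_eq_sum_of_nn_integral_eq_sum:
  fixes g :: "'a \<Rightarrow> real"
  assumes "finite I"
    and T: "\<And>i. i \<in> I \<Longrightarrow> T i \<in> M i \<rightarrow>\<^sub>M N"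
    and eq: "\<And>f::'a \<Rightarrow> ennreal. f \<in> borel_measurable N \<Longrightarrow> (\<integral>\<^sup>+ x. f x \<partial>N) = (\<Sum>i\<in>I. \<integral>\<^sup>+ y. f (T i y) \<partial>M i)"
    and g: "integrable N g"
  shows "\<And>i. i \<in> I \<Longrightarrow> integrable (M i) (\<lambda>y. g (T i y))"
    and "(\<integral>x. g x \<partial>N) = (\<Sum>i\<in>I. \<integral>y. g (T i y) \<partial>M i)"
proof -
  note [measurable] = borel_measurable_integrable[OF g]
  have bound: "(\<integral>\<^sup>+ y. f (T i y) \<partial>M i) \<le> (\<integral>\<^sup>+ x. f x \<partial>N)"
    if "f \<in> borel_measurable N" "i \<in> I" for f :: "'a \<Rightarrow> ennreal" and i
    unfolding eq[OF that(1)] by (rule member_le_sum) (use that assms(1) in auto)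
  have g_T: "(\<lambda>y. g (T i y)) \<in> borel_measurable (M i)" if "i \<in> I" for i
    using T[OF that] by measurable
  show int: "integrable (M i) (\<lambda>y. g (T i y))" if "i \<in> I" for i
  proof (rule integrableI_bounded[OF g_T[OF that]])
    have "(\<integral>\<^sup>+ y. ennreal (norm (g (T i y))) \<partial>M i) \<le> (\<integral>\<^sup>+ x. ennreal (norm (g x)) \<partial>N)"
      using bound[of "\<lambda>x. ennreal (norm (g x))"] that by simp
    also have "\<dots> < \<infinity>"
      using g by (simp add: integrable_iff_bounded)
    finally show "(\<integral>\<^sup>+ y. ennreal (norm (g (T i y))) \<partial>M i) < \<infinity>" .
  qed
  have fin: "(\<integral>\<^sup>+ y. ennreal (g (T i y)) \<partial>M i) < \<top>" "(\<integral>\<^sup>+ y. ennreal (- g (T i y)) \<partial>M i) < \<top>"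
    if "i \<in> I" for i
    using int[OF that] by (auto simp: real_integrable_def less_top)
  have "(\<integral>x. g x \<partial>N) = enn2real (\<Sum>i\<in>I. \<integral>\<^sup>+ y. ennreal (g (T i y)) \<partial>M i) -
      enn2real (\<Sum>i\<in>I. \<integral>\<^sup>+ y. ennreal (- g (T i y)) \<partial>M i)"
    using g by (simp add: real_lebesgue_integral_def eq)
  also have "\<dots> = (\<Sum>i\<in>I. enn2real (\<integral>\<^sup>+ y. ennreal (g (T i y)) \<partial>M i)) -
      (\<Sum>i\<in>I. enn2real (\<integral>\<^sup>+ y. ennreal (- g (T i y)) \<partial>M i))"
    using fin by (simp add: enn2real_sum)
  also have "\<dots> = (\<Sum>i\<in>I. \<integral>y. g (T i y) \<partial>M i)"
    using int by (simp add: real_lebesgue_integral_def sum_subtractf)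
  finally show "(\<integral>x. g x \<partial>N) = (\<Sum>i\<in>I. \<integral>y. g (T i y) \<partial>M i)" .
qed

context diffuse_poisson_random_measure
begin

lemma measurable_snd_P: "snd \<in> M \<Otimes>\<^sub>M P \<rightarrow>\<^sub>M bf_measures"
  by (rule measurable_compose[OF measurable_snd measurable_ident_P])

lemma measurable_point_add_atoms:
  assumes "partition_on {1..n} p" "numbering p c"
  shows "(\<lambda>w. (point_of n p c (fst w), add_atoms (snd w) {1..card p} (fst w))) \<in>
    PiM {1..card p} (\<lambda>_. \<nu>) \<Otimes>\<^sub>M P \<rightarrow>\<^sub>M points n \<Otimes>\<^sub>M bf_measures"
proof (intro measurable_Pair measurable_add_atoms)
  show "(\<lambda>w. point_of n p c (fst w)) \<in> PiM {1..card p} (\<lambda>_. \<nu>) \<Otimes>\<^sub>M P \<rightarrow>\<^sub>M points n"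
    using measurable_compose[OF measurable_fst measurable_point_of[OF assms, of \<nu>]]
    by (simp add: measurable_cong_sets[OF refl sets_PiM_mean])
  show "snd \<in> PiM {1..card p} (\<lambda>_. \<nu>) \<Otimes>\<^sub>M P \<rightarrow>\<^sub>M bf_measures"
    by (rule measurable_snd_P)
  show "(\<lambda>w. fst w j) \<in> PiM {1..card p} (\<lambda>_. \<nu>) \<Otimes>\<^sub>M P \<rightarrow>\<^sub>M borel" if "j \<in> {1..card p}" for j
    using measurable_compose[OF measurable_fst measurable_component_singleton[OF that, of "\<lambda>_. \<nu>"]]
    by (simp add: measurable_cong_sets[OF refl sets_mean])
qed simp

lemma nn_integral_joint_augmented:
  assumes g: "g \<in> borel_measurable (points n \<Otimes>\<^sub>M bf_measures)"
  shows "(\<integral>\<^sup>+ w. g w \<partial>joint_measure n P) =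
    (\<integral>\<^sup>+ X. \<integral>\<^sup>+ N. g (X, add_atoms N (X ` {1..n}) (\<lambda>x. x)) \<partial>P \<partial>moment_measure n P)"
  unfolding nn_integral_joint_measure[OF g] moment_measure_eq_sequential
  using g by (intro multivariate_mecke) simp

lemma nn_integral_joint_partitions:
  assumes g: "g \<in> borel_measurable (points n \<Otimes>\<^sub>M bf_measures)"
    and cells: "\<And>p. partition_on {1..n} p \<Longrightarrow> numbering p (C p)"
  shows "(\<integral>\<^sup>+ w. g w \<partial>joint_measure n P) =
    (\<Sum>p | partition_on {1..n} p.
       \<integral>\<^sup>+ Xs. \<integral>\<^sup>+ N. g (point_of n p (C p) Xs, add_atoms N {1..card p} Xs) \<partial>P \<partial>PiM {1..card p} (\<lambda>_. \<nu>))"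
proof -
  define f where "f X = (\<integral>\<^sup>+ N. g (X, add_atoms N (X ` {1..n}) (\<lambda>x. x)) \<partial>P)" for X
  have f: "f \<in> borel_measurable (points n)"
    using measurable_nn_integral_augmented[of "\<lambda>X N. g (X, N)" n "\<lambda>X. X" "points n"] g
    by (simp add: f_def[abs_def])
  have "(\<integral>\<^sup>+ w. g w \<partial>joint_measure n P) =
      (\<Sum>p | partition_on {1..n} p. \<integral>\<^sup>+ Xs. f (point_of n p (C p) Xs) \<partial>PiM {1..card p} (\<lambda>_. \<nu>))"
    unfolding nn_integral_joint_augmented[OF g] moment_measure_eq_sequential f_def[symmetric]
    by (rule nn_integral_sequential_partitions[OF f cells])
  also have "\<dots> = (\<Sum>p | partition_on {1..n} p.
       \<integral>\<^sup>+ Xs. \<integral>\<^sup>+ N. g (point_of n p (C p) Xs, add_atoms N {1..card p} Xs) \<partial>P \<partial>PiM {1..card p} (\<lambda>_. \<nu>))"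
  proof (intro sum.cong refl nn_integral_cong_AE)
    fix p assume "p \<in> {p. partition_on {1..n} p}"
    then have p: "partition_on {1..n} p" by simp
    \<comment> \<open>Adding atoms over indices and over values agree where the values are distinct,
      and this holds almost everywhere.\<close>
    show "AE Xs in PiM {1..card p} (\<lambda>_. \<nu>). f (point_of n p (C p) Xs) =
        (\<integral>\<^sup>+ N. g (point_of n p (C p) Xs, add_atoms N {1..card p} Xs) \<partial>P)"
      using AE_PiM_inj_on[of "{1..card p}", simplified]
    proof eventually_elim
      case (elim Xs)
      then have "add_atoms N (Xs ` {1..card p}) (\<lambda>x. x) = add_atoms N {1..card p} Xs" for N
        by (intro add_atoms_reindex) auto
      then show ?case
        by (simp add: f_def point_of_image[OF p cells[OF p]])
    qed
  qed
  finally show ?thesis .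
qed

text \<open>The map \<open>T p\<close> sends \<open>(Xs, N)\<close> to the encoded point together
  with the augmented measure. The non-negative formula becomes a sum of integrals along the
  \<open>T p\<close>, is transferred to integrable g on the products with P, and is iterated by
  Fubini.\<close>

lemma integral_joint_partitions:
  fixes g :: "(nat \<Rightarrow> 'a) \<times> 'a measure \<Rightarrow> real"
  assumes g: "integrable (joint_measure n P) g"
    and cells: "\<And>p. partition_on {1..n} p \<Longrightarrow> numbering p (C p)"
  shows "partition_on {1..n} p \<Longrightarrow> AE Xs in PiM {1..card p} (\<lambda>_. \<nu>).
      integrable P (\<lambda>N. g (point_of n p (C p) Xs, add_atoms N {1..card p} Xs))"
    and "partition_on {1..n} p \<Longrightarrow> integrable (PiM {1..card p} (\<lambda>_. \<nu>))
      (\<lambda>Xs. \<integral>N. g (point_of n p (C p) Xs, add_atoms N {1..card p} Xs) \<partial>P)"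
    and "(\<integral>w. g w \<partial>joint_measure n P) = (\<Sum>p | partition_on {1..n} p.
      \<integral>Xs. (\<integral>N. g (point_of n p (C p) Xs, add_atoms N {1..card p} Xs) \<partial>P) \<partial>PiM {1..card p} (\<lambda>_. \<nu>))"
proof -
  let ?M = "\<lambda>p. PiM {1..card p} (\<lambda>_::nat. \<nu>) \<Otimes>\<^sub>M P"
  define T where "T p w = (point_of n p (C p) (fst w), add_atoms (snd w) {1..card p} (fst w))"
    for p and w :: "(nat \<Rightarrow> 'a) \<times> 'a measure"
  have pair: "pair_sigma_finite (PiM {1..card p} (\<lambda>_::nat. \<nu>)) P" for p :: "nat set set"
    by (intro pair_sigma_finite.intro product_sigma_finite.sigma_finite[OF product_sigma_finite_mean]
        sigma_finite_measure_axioms) simp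
  have T: "T p \<in> ?M p \<rightarrow>\<^sub>M points n \<Otimes>\<^sub>M bf_measures" if "partition_on {1..n} p" for p
    unfolding T_def using measurable_point_add_atoms[OF that cells[OF that]] .
  have fin: "finite {p. partition_on {1..n} p}"
    by (rule finitely_many_partition_on) simp
  have eq: "(\<integral>\<^sup>+ w. f w \<partial>joint_measure n P) = (\<Sum>p | partition_on {1..n} p. \<integral>\<^sup>+ w. f (T p w) \<partial>?M p)"
    if "f \<in> borel_measurable (joint_measure n P)" for f :: "_ \<Rightarrow> ennreal"
  proof -
    have f: "f \<in> borel_measurable (points n \<Otimes>\<^sub>M bf_measures)"
      using that by (simp add: measurable_cong_sets[OF sets_joint_measure refl])
    have "(\<integral>\<^sup>+ w. f w \<partial>joint_measure n P) = (\<Sum>p | partition_on {1..n} p.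
        \<integral>\<^sup>+ Xs. \<integral>\<^sup>+ N. f (point_of n p (C p) Xs, add_atoms N {1..card p} Xs) \<partial>P \<partial>PiM {1..card p} (\<lambda>_. \<nu>))"
      by (rule nn_integral_joint_partitions[OF f cells])
    also have "\<dots> = (\<Sum>p | partition_on {1..n} p. \<integral>\<^sup>+ w. f (T p w) \<partial>?M p)"
    proof (intro sum.cong refl)
      fix p assume "p \<in> {p. partition_on {1..n} p}"
      then have "(\<lambda>w. f (T p w)) \<in> borel_measurable (?M p)"
        using measurable_compose[OF T f] by simp
      then show "(\<integral>\<^sup>+ Xs. \<integral>\<^sup>+ N. f (point_of n p (C p) Xs, add_atoms N {1..card p} Xs) \<partial>P \<partial>PiM {1..card p} (\<lambda>_. \<nu>)) =
          (\<integral>\<^sup>+ w. f (T p w) \<partial>?M p)"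
        by (subst nn_integral_fst[symmetric]) (simp_all add: T_def)
    qed
    finally show ?thesis .
  qed
  have T_joint: "T p \<in> ?M p \<rightarrow>\<^sub>M joint_measure n P" if "p \<in> {p. partition_on {1..n} p}" for p
    using T that by (simp add: measurable_cong_sets[OF refl sets_joint_measure])
  note split = integral_eq_sum_of_nn_integral_eq_sum[OF fin T_joint eq g]
  have int: "integrable (?M p) (\<lambda>w. g (T p w))" if "partition_on {1..n} p" for p
    using split(1)[of p] that by simp
  show "AE Xs in PiM {1..card p} (\<lambda>_. \<nu>).
      integrable P (\<lambda>N. g (point_of n p (C p) Xs, add_atoms N {1..card p} Xs))" if "partition_on {1..n} p"
    using pair_sigma_finite.AE_integrable_fst'[OF pair int[OF that]] by (simp add: T_def)
  show "integrable (PiM {1..card p} (\<lambda>_. \<nu>))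
      (\<lambda>Xs. \<integral>N. g (point_of n p (C p) Xs, add_atoms N {1..card p} Xs) \<partial>P)" if "partition_on {1..n} p"
    using pair_sigma_finite.integrable_fst'[OF pair int[OF that]] by (simp add: T_def)
  have "(\<integral>w. g (T p w) \<partial>?M p) = (\<integral>Xs. (\<integral>N. g (point_of n p (C p) Xs, add_atoms N {1..card p} Xs) \<partial>P) \<partial>PiM {1..card p} (\<lambda>_. \<nu>))"
    if "partition_on {1..n} p" for p
    using pair_sigma_finite.integral_fst'[OF pair int[OF that]] by (simp add: T_def)
  then show "(\<integral>w. g w \<partial>joint_measure n P) = (\<Sum>p | partition_on {1..n} p.
      \<integral>Xs. (\<integral>N. g (point_of n p (C p) Xs, add_atoms N {1..card p} Xs) \<partial>P) \<partial>PiM {1..card p} (\<lambda>_. \<nu>))"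
    using split(2) by simp
qed

text \<open>The law depends on X through its set of values alone, so it is defined at every X
  without choosing an encoding, and its measurability in X follows from that of the augmented
  measure.\<close>

definition augmented_law :: "nat \<Rightarrow> (nat \<Rightarrow> 'a) \<Rightarrow> 'a measure measure" where
  "augmented_law n X = distr P bf_measures (\<lambda>N. add_atoms N (X ` {1..n}) (\<lambda>x. x))"

lemma measurable_augment: "(\<lambda>N. add_atoms N (X ` {1..n::nat}) (\<lambda>x. x)) \<in> P \<rightarrow>\<^sub>M bf_measures"
  by (rule measurable_add_atoms[OF measurable_ident_P]) simp_all

lemma augmented_law_measurable: "augmented_law n \<in> points n \<rightarrow>\<^sub>M prob_algebra bf_measures"
proof -
  have "(\<lambda>_. P) \<in> points n \<rightarrow>\<^sub>M prob_algebra P"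
    using prob_space_axioms by (simp add: space_prob_algebra)
  moreover have "(\<lambda>w. add_atoms (snd w) (fst w ` {1..n}) (\<lambda>x. x)) \<in> points n \<Otimes>\<^sub>M P \<rightarrow>\<^sub>M bf_measures"
    by (intro measurable_add_atoms_image measurable_fst measurable_snd_P)
  ultimately show ?thesis
    unfolding augmented_law_def
    by (intro measurable_distr_prob_space2) (simp_all add: case_prod_beta')
qed

text \<open>The disintegration is the multivariate formula for indicators of measurable sets of
  pairs, with the sequential measure read as the marginal.\<close>

lemma conditional_law_augmented_law: "conditional_law n P (augmented_law n)"
  unfolding conditional_law_def
proof (intro conjI ballI augmented_law_measurable)
  fix B :: "((nat \<Rightarrow> 'a) \<times> 'a measure) set"
  assume B: "B \<in> sets (points n \<Otimes>\<^sub>M bf_measures)"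
  have "emeasure (joint_measure n P) B = (\<integral>\<^sup>+ w. indicator B w \<partial>joint_measure n P)"
    using B by (simp add: sets_joint_measure)
  also have "\<dots> = (\<integral>\<^sup>+ X. \<integral>\<^sup>+ N. indicator B (X, add_atoms N (X ` {1..n}) (\<lambda>x. x)) \<partial>P \<partial>moment_measure n P)"
    using B by (intro nn_integral_joint_augmented) simp
  also have "\<dots> = (\<integral>\<^sup>+ X. emeasure (augmented_law n X) {N. (X, N) \<in> B} \<partial>moment_measure n P)"
  proof (rule nn_integral_cong)
    fix X :: "nat \<Rightarrow> 'a"
    have S: "{N. (X, N) \<in> B} \<in> sets bf_measures"
      using sets_Pair1[OF B, of X] by (simp add: vimage_def)
    have "emeasure (augmented_law n X) {N. (X, N) \<in> B} = (\<integral>\<^sup>+ N. indicator {N. (X, N) \<in> B} N \<partial>augmented_law n X)"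
      using S by (intro nn_integral_indicator[symmetric]) (simp add: augmented_law_def)
    also have "\<dots> = (\<integral>\<^sup>+ N. indicator {N. (X, N) \<in> B} (add_atoms N (X ` {1..n}) (\<lambda>x. x)) \<partial>P)"
      unfolding augmented_law_def using S by (intro nn_integral_distr[OF measurable_augment]) simp
    finally show "(\<integral>\<^sup>+ N. indicator B (X, add_atoms N (X ` {1..n}) (\<lambda>x. x)) \<partial>P) =
        emeasure (augmented_law n X) {N. (X, N) \<in> B}"
      by (simp add: indicator_def)
  qed
  finally show "emeasure (joint_measure n P) B =
      (\<integral>\<^sup>+ X. emeasure (augmented_law n X) {N. (X, N) \<in> B} \<partial>moment_measure n P)" .
qed

text \<open>At most n distinct values precede the next one, so passing from n to n + 1 coordinates
  multiplies the mass of the box by at most \<open>emeasure \<nu> A + of_nat n\<close>. The moments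
  are thus bounded by rising factorials of the mass of A.\<close>

lemma emeasure_sequential_box:
  assumes A: "A \<in> sets borel" "bounded A"
  shows "emeasure (sequential_measure \<nu> n) (\<Pi>\<^sub>E i\<in>{1..n}. A) < \<top>"
proof (induction n)
  case 0
  then show ?case
    by (simp add: sets_PiM_empty)
next
  case (Suc n)
  let ?B = "\<lambda>n. \<Pi>\<^sub>E i\<in>{1..n::nat}. A"
  have box: "?B m \<in> sets (points m)" for m
    using A by (intro sets_PiM_I_finite) auto
  have upd: "indicator (?B (Suc n)) (X(Suc n := y)) = (indicator (?B n) X * indicator A y :: ennreal)"
    if "X \<in> space (points n)" for X y
  proof -
    have "X \<in> extensional {1..n}"
      using that by (simp add: space_PiM PiE_def)
    moreover have "{1..Suc n} = insert (Suc n) {1..n}" by auto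
    ultimately have "X(Suc n := y) \<in> ?B (Suc n) \<longleftrightarrow> X \<in> ?B n \<and> y \<in> A"
      by (auto simp: PiE_iff extensional_def)
    then show ?thesis
      by (simp add: indicator_def)
  qed
  have "emeasure (sequential_measure \<nu> (Suc n)) (?B (Suc n)) =
      (\<integral>\<^sup>+ X. indicator (?B (Suc n)) X \<partial>sequential_measure \<nu> (Suc n))"
    using box by (intro nn_integral_indicator[symmetric]) (simp add: sets_sequential_measure)
  also have "\<dots> = (\<integral>\<^sup>+ X. (\<integral>\<^sup>+ y. indicator (?B (Suc n)) (X(Suc n := y)) \<partial>\<nu>) +
      (\<Sum>x\<in>X ` {1..n}. indicator (?B (Suc n)) (X(Suc n := x))) \<partial>sequential_measure \<nu> n)"
    using box by (intro nn_integral_sequential_Suc) simp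
  also have "\<dots> \<le> (\<integral>\<^sup>+ X. (emeasure \<nu> A + of_nat n) * indicator (?B n) X \<partial>sequential_measure \<nu> n)"
  proof (rule nn_integral_mono)
    fix X assume "X \<in> space (sequential_measure \<nu> n)"
    then have X: "X \<in> space (points n)"
      using sets_eq_imp_space_eq[OF sets_sequential_measure] by simp
    have "(\<integral>\<^sup>+ y. indicator (?B (Suc n)) (X(Suc n := y)) \<partial>\<nu>) = indicator (?B n) X * emeasure \<nu> A"
      unfolding upd[OF X] using A by (intro nn_integral_cmult_indicator) (simp add: sets_mean)
    moreover have "(\<Sum>x\<in>X ` {1..n}. indicator (?B (Suc n)) (X(Suc n := x)) :: ennreal) \<le>
        (\<Sum>x\<in>X ` {1..n}. indicator (?B n) X)"
      unfolding upd[OF X] by (intro sum_mono) (simp add: indicator_def)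
    moreover have "(\<Sum>x\<in>X ` {1..n}. indicator (?B n) X :: ennreal) \<le> of_nat n * indicator (?B n) X"
      using card_image_le[of "{1..n}" X] by (auto intro!: mult_right_mono)
    ultimately show "(\<integral>\<^sup>+ y. indicator (?B (Suc n)) (X(Suc n := y)) \<partial>\<nu>) +
        (\<Sum>x\<in>X ` {1..n}. indicator (?B (Suc n)) (X(Suc n := x))) \<le> (emeasure \<nu> A + of_nat n) * indicator (?B n) X"
      by (auto simp: distrib_right mult.commute intro: order_trans add_mono)
  qed
  also have "\<dots> = (emeasure \<nu> A + of_nat n) * emeasure (sequential_measure \<nu> n) (?B n)"
    using box by (simp add: nn_integral_cmult_indicator sets_sequential_measure)
  also have "\<dots> < \<top>"
    using Suc boundedly_finite_less_top[OF bf_mean A] by (simp add: ennreal_mult_less_top of_nat_less_top)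
  finally show ?case .
qed

lemma sets_moment_measure: "sets (moment_measure n P) = sets (points n)"
  by (simp only: moment_measure_eq_sequential sets_sequential_measure)

lemma sigma_finite_moment: "sigma_finite_measure (moment_measure n P)"
proof
  obtain x0 :: 'a where True by simp
  let ?B = "\<lambda>k::nat. \<Pi>\<^sub>E i\<in>{1..n}. ball x0 (real k)"
  note sets = sets_moment_measure[of n]
  have "(\<Union>k. ?B k) = space (points n)"
  proof
    show "space (points n) \<subseteq> (\<Union>k. ?B k)"
    proof
      fix X :: "nat \<Rightarrow> 'a" assume X: "X \<in> space (points n)"
      \<comment> \<open>The inserted 0 keeps the set whose maximum is taken nonempty.\<close>
      obtain k :: nat where k: "Max (insert 0 ((\<lambda>i. dist x0 (X i)) ` {1..n})) < real k"
        using reals_Archimedean2 by blast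
      have "dist x0 (X i) < real k" if "i \<in> {1..n}" for i
        using that by (intro le_less_trans[OF _ k] Max_ge) auto
      then have "X \<in> ?B k"
        using X by (auto simp: space_PiM PiE_iff)
      then show "X \<in> (\<Union>k. ?B k)" by blast
    qed
  qed (auto simp: space_PiM PiE_iff)
  moreover have "?B k \<in> sets (points n)" for k
    by (intro sets_PiM_I_finite) auto
  moreover have "emeasure (moment_measure n P) (?B k) \<noteq> \<infinity>" for k
    using emeasure_sequential_box[of "ball x0 (real k)" n] by (simp add: moment_measure_eq_sequential)
  ultimately show "\<exists>A. countable A \<and> A \<subseteq> sets (moment_measure n P) \<and>
      \<Union> A = space (moment_measure n P) \<and> (\<forall>a\<in>A. emeasure (moment_measure n P) a \<noteq> \<infinity>)"
    using sets_eq_imp_space_eq[OF sets] by (intro exI[of _ "range ?B"]) (auto simp: sets)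
qed

text \<open>For a fixed cylinder, the masses that K and L assign to it are densities, with respect
  to the moment measure, of one and the same measure: the joint mass of B times the cylinder as a
  function of B. Densities with respect to a \<sigma>-finite measure are unique almost
  everywhere.\<close>

lemma conditional_law_unique:
  assumes K: "conditional_law n P K" and L: "conditional_law n P L"
  shows "AE X in moment_measure n P. K X = L X"
proof -
  obtain T :: "('a set \<times> ennreal set) set" where T: "countable T"
    "\<And>B S. (B, S) \<in> T \<Longrightarrow> B \<in> sets borel \<and> bounded B \<and> S \<in> sets borel"
    "sets bf_measures = sigma_sets (space bf_measures) {cylinder F | F. finite F \<and> F \<subseteq> T}"
    by (rule bf_measures_generator) (rule that)
  note sets = sets_moment_measure[of n]
  have space: "space (moment_measure n P) = space (points n)"
    by (rule sets_eq_imp_space_eq[OF sets])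
  interpret M: sigma_finite_measure "moment_measure n P"
    by (rule sigma_finite_moment)
  have cyl: "cylinder F \<in> sets bf_measures" if "finite F" "F \<subseteq> T" for F
    using that T(2) by (intro cylinder_in_sets) auto
  have meas: "(\<lambda>X. emeasure (J X) E) \<in> borel_measurable (moment_measure n P)"
    if "conditional_law n P J" "E \<in> sets bf_measures" for J E
  proof -
    have "J \<in> points n \<rightarrow>\<^sub>M prob_algebra bf_measures"
      using that(1) by (simp add: conditional_law_def)
    from measurable_emeasure_kernel[OF measurable_prob_algebraD[OF this] that(2)] show ?thesis
      by (simp add: measurable_cong_sets[OF sets refl])
  qed
  have rect: "(\<integral>\<^sup>+ X. emeasure (J X) E * indicator B X \<partial>moment_measure n P) = emeasure (joint_measure n P) (B \<times> E)"
    if "conditional_law n P J" "E \<in> sets bf_measures" "B \<in> sets (points n)" for J E B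
  proof -
    have "B \<times> E \<in> sets (points n \<Otimes>\<^sub>M bf_measures)"
      using that by simp
    then have "emeasure (joint_measure n P) (B \<times> E) =
        (\<integral>\<^sup>+ X. emeasure (J X) {N. (X, N) \<in> B \<times> E} \<partial>moment_measure n P)"
      using that(1) by (simp add: conditional_law_def)
    then show ?thesis
      by (auto intro!: nn_integral_cong simp: indicator_def)
  qed
  have "AE X in moment_measure n P. emeasure (K X) (cylinder F) = emeasure (L X) (cylinder F)"
    if F: "finite F" "F \<subseteq> T" for F
  proof (rule M.density_unique)
    show "density (moment_measure n P) (\<lambda>X. emeasure (K X) (cylinder F)) =
        density (moment_measure n P) (\<lambda>X. emeasure (L X) (cylinder F))"
      by (rule measure_eqI)
        (simp_all add: emeasure_density meas K L cyl F rect sets)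
  qed (simp_all add: meas K L cyl F)
  \<comment> \<open>There are countably many finite subsets of T, so one null set serves all
    cylinders at once.\<close>
  then have "AE X in moment_measure n P. \<forall>F\<in>{F. F \<subseteq> T \<and> finite F}. emeasure (K X) (cylinder F) = emeasure (L X) (cylinder F)"
    using countable_Collect_finite_subset[OF T(1)] by (subst AE_ball_countable) (auto simp: conj_commute)
  then show ?thesis
    using AE_space
  proof eventually_elim
    case (elim X)
    have "prob_space (J X)" "sets (J X) = sets bf_measures" if "conditional_law n P J" for J
      using that elim(2) measurable_space[of J "points n" "prob_algebra bf_measures" X]
      by (auto simp: conditional_law_def space space_prob_algebra)
    note J = this[OF K] this[OF L]
    show ?case
    proof (rule measure_eqI_generator_eq[where E="{cylinder F | F. finite F \<and> F \<subseteq> T}" and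
          \<Omega>="space bf_measures" and A="\<lambda>_. cylinder {}"])
      show "Int_stable {cylinder F | F. finite F \<and> F \<subseteq> T}"
      proof (rule Int_stableI)
        fix a b assume "a \<in> {cylinder F | F. finite F \<and> F \<subseteq> T}" "b \<in> {cylinder F | F. finite F \<and> F \<subseteq> T}"
        then obtain F G where "a = cylinder F" "finite F" "F \<subseteq> T" "b = cylinder G" "finite G" "G \<subseteq> T"
          by auto
        then show "a \<inter> b \<in> {cylinder F | F. finite F \<and> F \<subseteq> T}"
          by (auto simp: cylinder_Int intro!: exI[of _ "F \<union> G"])
      qed
      show "{cylinder F | F. finite F \<and> F \<subseteq> T} \<subseteq> Pow (space bf_measures)"
        by (auto simp: cylinder_def space_bf_measures)
      show "emeasure (K X) E = emeasure (L X) E" if "E \<in> {cylinder F | F. finite F \<and> F \<subseteq> T}" for E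
        using that elim(1) by auto
      show "sets (K X) = sigma_sets (space bf_measures) {cylinder F | F. finite F \<and> F \<subseteq> T}"
        "sets (L X) = sigma_sets (space bf_measures) {cylinder F | F. finite F \<and> F \<subseteq> T}"
        using J T(3) by simp_all
      show "range (\<lambda>_. cylinder {}) \<subseteq> {cylinder F | F. finite F \<and> F \<subseteq> T}"
        by auto
      show "(\<Union>i::nat. cylinder {}) = space bf_measures"
        by (simp add: cylinder_def space_bf_measures)
      show "emeasure (K X) (cylinder {}) \<noteq> \<infinity>" for i :: nat
        using prob_space.emeasure_le_1[OF J(1), of "cylinder {}"] by (auto simp: top_unique)
    qed
  qed
qed

text \<open>The exceptional null set comes from uniqueness alone, so the quantifiers over encodings
  may stand inside the almost-everywhere statement.\<close>

lemma AE_conditional_law: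
  assumes K: "conditional_law n P K"
  shows "AE X in moment_measure n P. \<forall>p c Xs. encodes n X p c Xs \<longrightarrow> numbering p c \<longrightarrow>
    K X = distr P bf_measures (\<lambda>N. add_atoms N {1..card p} Xs)"
  using conditional_law_unique[OF K conditional_law_augmented_law]
  by eventually_elim (simp add: augmented_law_def add_atoms_encodes)

lemma AE_conditional_law_nn_integral:
  fixes g :: "(nat \<Rightarrow> 'a) \<times> 'a measure \<Rightarrow> ennreal"
  assumes K: "conditional_law n P K" and g: "g \<in> borel_measurable (points n \<Otimes>\<^sub>M bf_measures)"
  shows "AE X in moment_measure n P. \<forall>p c Xs. encodes n X p c Xs \<longrightarrow> numbering p c \<longrightarrow>
    (\<integral>\<^sup>+ N. g (X, add_atoms N {1..card p} Xs) \<partial>P) = (\<integral>\<^sup>+ N. g (X, N) \<partial>K X)"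
  using conditional_law_unique[OF K conditional_law_augmented_law] AE_space
proof eventually_elim
  case (elim X)
  have "X \<in> space (points n)"
    using elim(2) sets_eq_imp_space_eq[OF sets_moment_measure] by simp
  from measurable_compose[OF measurable_Pair1'[OF this] g]
  have "(\<integral>\<^sup>+ N. g (X, N) \<partial>K X) = (\<integral>\<^sup>+ N. g (X, add_atoms N (X ` {1..n}) (\<lambda>x. x)) \<partial>P)"
    unfolding elim(1) augmented_law_def by (intro nn_integral_distr[OF measurable_augment]) simp
  then show ?case
    by (simp add: add_atoms_encodes)
qed

text \<open>The function \<open>f\<close> below is the expectation of \<open>norm g\<close> under
  the augmented law. Its integral against the moment measure is the joint integral of
  \<open>norm g\<close>, so \<open>f\<close> is finite almost everywhere, which gives integrability
  on both sides at such X.\<close>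

lemma AE_conditional_law_integral:
  fixes g :: "(nat \<Rightarrow> 'a) \<times> 'a measure \<Rightarrow> real"
  assumes K: "conditional_law n P K" and g: "integrable (joint_measure n P) g"
  shows "AE X in moment_measure n P. \<forall>p c Xs. encodes n X p c Xs \<longrightarrow> numbering p c \<longrightarrow>
    integrable P (\<lambda>N. g (X, add_atoms N {1..card p} Xs)) \<and>
    integrable (K X) (\<lambda>N. g (X, N)) \<and>
    (\<integral>N. g (X, add_atoms N {1..card p} Xs) \<partial>P) = (\<integral>N. g (X, N) \<partial>K X)"
proof -
  have meas: "g \<in> borel_measurable (points n \<Otimes>\<^sub>M bf_measures)"
    using borel_measurable_integrable[OF g] by (simp add: measurable_cong_sets[OF sets_joint_measure refl])
  define f where "f X = (\<integral>\<^sup>+ N. ennreal (norm (g (X, add_atoms N (X ` {1..n}) (\<lambda>x. x)))) \<partial>P)" for X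
  have "(\<lambda>(X, N). ennreal (norm (g (X, N)))) \<in> borel_measurable (points n \<Otimes>\<^sub>M bf_measures)"
    using meas by simp
  from measurable_nn_integral_augmented[OF this measurable_ident]
  have "f \<in> borel_measurable (points n)"
    unfolding f_def id_apply .
  then have "f \<in> borel_measurable (moment_measure n P)"
    by (simp only: measurable_cong_sets[OF sets_moment_measure refl])
  moreover have "(\<integral>\<^sup>+ X. f X \<partial>moment_measure n P) = (\<integral>\<^sup>+ w. ennreal (norm (g w)) \<partial>joint_measure n P)"
    unfolding f_def using meas by (intro nn_integral_joint_augmented[symmetric]) simp
  ultimately have "AE X in moment_measure n P. f X \<noteq> \<infinity>"
    using g by (intro nn_integral_PInf_AE) (auto simp: integrable_iff_bounded)
  then show ?thesis
    using conditional_law_unique[OF K conditional_law_augmented_law] AE_space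
  proof eventually_elim
    case (elim X)
    have "X \<in> space (points n)"
      using elim(3) sets_eq_imp_space_eq[OF sets_moment_measure] by simp
    from measurable_compose[OF measurable_Pair1'[OF this] meas]
    have gX: "(\<lambda>N. g (X, N)) \<in> borel_measurable bf_measures" .
    have "integrable P (\<lambda>N. g (X, add_atoms N (X ` {1..n}) (\<lambda>x. x)))"
      using elim(1) measurable_compose[OF measurable_augment gX]
      by (intro integrableI_bounded) (auto simp: f_def less_top)
    then show ?case
      unfolding elim(2) augmented_law_def
      by (simp add: integrable_distr_eq[OF measurable_augment gX] integral_distr[OF measurable_augment gX]
          add_atoms_encodes)
  qed
qed

end

text \<open>The integral of a non-integrable real function is 0 by convention. For real g,
  integrability of the inner and outer integrands is therefore asserted along with the identities,
  which would otherwise say too little. \<open>C\<close> is an arbitrary choice of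
  numberings.\<close>

theorem lemma2p2:
  fixes \<nu> :: "'a::polish_space measure"
    and P :: "'a measure measure"
    and n :: nat
    and C :: "nat set set \<Rightarrow> nat \<Rightarrow> nat set"
  assumes bf: "boundedly_finite \<nu>"
    and diffuse: "diffuse \<nu>"
    and poisson: "poisson_law \<nu> P"
    and n: "n \<ge> 1"
    and cells: "\<And>p. partition_on {1..n} p \<Longrightarrow> numbering p (C p)"
  shows
    "(\<forall>g :: (nat \<Rightarrow> 'a) \<times> 'a measure \<Rightarrow> ennreal.
        g \<in> borel_measurable (points n \<Otimes>\<^sub>M bf_measures) \<longrightarrow>
        (\<integral>\<^sup>+ z. g z \<partial>joint_measure n P) =
        (\<Sum>p | partition_on {1..n} p.
           \<integral>\<^sup>+ Xs. (\<integral>\<^sup>+ N. g (point_of n p (C p) Xs, add_atoms N {1..card p} Xs) \<partial>P)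
             \<partial>PiM {1..card p} (\<lambda>_. \<nu>)))
     \<and>
     (\<forall>g :: (nat \<Rightarrow> 'a) \<times> 'a measure \<Rightarrow> real.
        integrable (joint_measure n P) g \<longrightarrow>
        (\<forall>p. partition_on {1..n} p \<longrightarrow>
           (AE Xs in PiM {1..card p} (\<lambda>_. \<nu>).
              integrable P (\<lambda>N. g (point_of n p (C p) Xs, add_atoms N {1..card p} Xs))) \<and>
           integrable (PiM {1..card p} (\<lambda>_. \<nu>))
             (\<lambda>Xs. \<integral>N. g (point_of n p (C p) Xs, add_atoms N {1..card p} Xs) \<partial>P)) \<and>
        (\<integral>z. g z \<partial>joint_measure n P) =
        (\<Sum>p | partition_on {1..n} p.
           \<integral>Xs. (\<integral>N. g (point_of n p (C p) Xs, add_atoms N {1..card p} Xs) \<partial>P)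
             \<partial>PiM {1..card p} (\<lambda>_. \<nu>)))
     \<and>
     conditional_law n P (\<lambda>X. distr P bf_measures (\<lambda>N. add_atoms N (X ` {1..n}) (\<lambda>x. x)))
     \<and>
     (\<forall>K. conditional_law n P K \<longrightarrow>
        (AE X in moment_measure n P. \<forall>p Xs. encodes n X p (C p) Xs \<longrightarrow>
           K X = distr P bf_measures (\<lambda>N. add_atoms N {1..card p} Xs)) \<and>
        (\<forall>g :: (nat \<Rightarrow> 'a) \<times> 'a measure \<Rightarrow> ennreal.
           g \<in> borel_measurable (points n \<Otimes>\<^sub>M bf_measures) \<longrightarrow>
           (AE X in moment_measure n P. \<forall>p Xs. encodes n X p (C p) Xs \<longrightarrow>
              (\<integral>\<^sup>+ N. g (X, add_atoms N {1..card p} Xs) \<partial>P) = (\<integral>\<^sup>+ N. g (X, N) \<partial>K X))) \<and>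
        (\<forall>g :: (nat \<Rightarrow> 'a) \<times> 'a measure \<Rightarrow> real.
           integrable (joint_measure n P) g \<longrightarrow>
           (AE X in moment_measure n P. \<forall>p Xs. encodes n X p (C p) Xs \<longrightarrow>
              integrable P (\<lambda>N. g (X, add_atoms N {1..card p} Xs)) \<and>
              integrable (K X) (\<lambda>N. g (X, N)) \<and>
              (\<integral>N. g (X, add_atoms N {1..card p} Xs) \<partial>P) = (\<integral>N. g (X, N) \<partial>K X))))
     \<and>
     moment_measure n P = sequential_measure \<nu> n"
proof -
  interpret diffuse_poisson_random_measure \<nu> P
    using bf diffuse poisson
    by (simp add: diffuse_poisson_random_measure_def diffuse_poisson_random_measure_axioms_def
        poisson_random_measure_def)
  \<comment> \<open>An encoding includes that p is a partition of \<open>{1..n}\<close>, so the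
    chosen numbering is available for it.\<close>
  have num: "numbering p (C p)" if "encodes n X p (C p) Xs" for X :: "nat \<Rightarrow> 'a" and p Xs
    using that cells by (simp add: encodes_def)
  show ?thesis
  proof (intro conjI allI impI)
    fix g :: "(nat \<Rightarrow> 'a) \<times> 'a measure \<Rightarrow> ennreal"
    assume g: "g \<in> borel_measurable (points n \<Otimes>\<^sub>M bf_measures)"
    show "(\<integral>\<^sup>+ z. g z \<partial>joint_measure n P) =
        (\<Sum>p | partition_on {1..n} p.
           \<integral>\<^sup>+ Xs. (\<integral>\<^sup>+ N. g (point_of n p (C p) Xs, add_atoms N {1..card p} Xs) \<partial>P)
             \<partial>PiM {1..card p} (\<lambda>_. \<nu>))"
      by (rule nn_integral_joint_partitions[OF g cells])
  next
    fix g :: "(nat \<Rightarrow> 'a) \<times> 'a measure \<Rightarrow> real" and p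
    assume g: "integrable (joint_measure n P) g" and p: "partition_on {1..n} p"
    show "AE Xs in PiM {1..card p} (\<lambda>_. \<nu>).
        integrable P (\<lambda>N. g (point_of n p (C p) Xs, add_atoms N {1..card p} Xs))"
      by (rule integral_joint_partitions(1)[OF g cells p])
    show "integrable (PiM {1..card p} (\<lambda>_. \<nu>))
        (\<lambda>Xs. \<integral>N. g (point_of n p (C p) Xs, add_atoms N {1..card p} Xs) \<partial>P)"
      by (rule integral_joint_partitions(2)[OF g cells p])
  next
    fix g :: "(nat \<Rightarrow> 'a) \<times> 'a measure \<Rightarrow> real"
    assume g: "integrable (joint_measure n P) g"
    show "(\<integral>z. g z \<partial>joint_measure n P) =
        (\<Sum>p | partition_on {1..n} p.
           \<integral>Xs. (\<integral>N. g (point_of n p (C p) Xs, add_atoms N {1..card p} Xs) \<partial>P)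
             \<partial>PiM {1..card p} (\<lambda>_. \<nu>))"
      by (rule integral_joint_partitions(3)[OF g cells])
  next
    show "conditional_law n P (\<lambda>X. distr P bf_measures (\<lambda>N. add_atoms N (X ` {1..n}) (\<lambda>x. x)))"
      using conditional_law_augmented_law[of n] by (simp add: augmented_law_def[abs_def])
  next
    fix K assume K: "conditional_law n P K"
    show "AE X in moment_measure n P. \<forall>p Xs. encodes n X p (C p) Xs \<longrightarrow>
        K X = distr P bf_measures (\<lambda>N. add_atoms N {1..card p} Xs)"
      using AE_conditional_law[OF K] num by (auto elim!: eventually_mono)
    show "AE X in moment_measure n P. \<forall>p Xs. encodes n X p (C p) Xs \<longrightarrow>
        (\<integral>\<^sup>+ N. g (X, add_atoms N {1..card p} Xs) \<partial>P) = (\<integral>\<^sup>+ N. g (X, N) \<partial>K X)"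
      if "g \<in> borel_measurable (points n \<Otimes>\<^sub>M bf_measures)" for g :: "(nat \<Rightarrow> 'a) \<times> 'a measure \<Rightarrow> ennreal"
      using AE_conditional_law_nn_integral[OF K that] num by (auto elim!: eventually_mono)
    show "AE X in moment_measure n P. \<forall>p Xs. encodes n X p (C p) Xs \<longrightarrow>
        integrable P (\<lambda>N. g (X, add_atoms N {1..card p} Xs)) \<and>
        integrable (K X) (\<lambda>N. g (X, N)) \<and>
        (\<integral>N. g (X, add_atoms N {1..card p} Xs) \<partial>P) = (\<integral>N. g (X, N) \<partial>K X)"
      if "integrable (joint_measure n P) g" for g :: "(nat \<Rightarrow> 'a) \<times> 'a measure \<Rightarrow> real"
      using AE_conditional_law_integral[OF K that] num by (fastforce elim!: eventually_mono)
  next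
    show "moment_measure n P = sequential_measure \<nu> n"
      by (rule moment_measure_eq_sequential)
  qed
qed

end
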